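(* If $G$ is an infinite hereditarily minimal locally compact solvable group, then $G$ is compact and metabelian.
   Context: All topological groups are Hausdorff. A Hausdorff topological group $(G,\tau)$ is minimal if there is no Hausdorff group topology on $G$ strictly coarser than $\tau$. A topological group is hereditarily minimal if every subgroup of it (not necessarily closed), with the subspace topology, is minimal. A group is metabelian if it is solvable of class at most $2$. *)

theory Defs
  imports "HOL-Analysis.Analysis" "HOL-Algebra.Solvable_Groups"
begin

definition hausdorff_group_topology :: "('a, 'b) monoid_scheme \<Rightarrow> 'a topology \<Rightarrow> bool"
  where "hausdorff_group_topology G T \<longleftrightarrow>
    topspace T = carrier G \<and>
    continuous_map (prod_topology T T) T (\<lambda>(x, y). x \<otimes>\<^bsub>G\<^esub> y) \<and>
    continuous_map T T (\<lambda>x. inv\<^bsub>G\<^esub> x) \<and>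
    Hausdorff_space T"

definition hausdorff_topological_group :: "('a, 'b) monoid_scheme \<Rightarrow> 'a topology \<Rightarrow> bool"
  where "hausdorff_topological_group G T \<longleftrightarrow> group G \<and> hausdorff_group_topology G T"

definition strictly_coarser :: "'a topology \<Rightarrow> 'a topology \<Rightarrow> bool"
  where "strictly_coarser S T \<longleftrightarrow>
    topspace S = topspace T \<and> (\<forall>U. openin S U \<longrightarrow> openin T U) \<and> S \<noteq> T"

definition minimal_topological_group :: "('a, 'b) monoid_scheme \<Rightarrow> 'a topology \<Rightarrow> bool"
  where "minimal_topological_group G T \<longleftrightarrow>
    hausdorff_topological_group G T \<and>
    \<not> (\<exists>S. hausdorff_group_topology G S \<and> strictly_coarser S T)"

definition hereditarily_minimal :: "('a, 'b) monoid_scheme \<Rightarrow> 'a topology \<Rightarrow> bool"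
  where "hereditarily_minimal G T \<longleftrightarrow>
    hausdorff_topological_group G T \<and>
    (\<forall>H. subgroup H G \<longrightarrow>
      minimal_topological_group (G\<lparr>carrier := H\<rparr>) (subtopology T H))"

(* Meaningful only for solvable G; otherwise no such n exists and LEAST is unspecified. *)
definition solvability_class :: "('a, 'b) monoid_scheme \<Rightarrow> nat"
  where "solvability_class G = (LEAST n. (derived G ^^ n) (carrier G) = {\<one>\<^bsub>G\<^esub>})"

definition metabelian :: "('a, 'b) monoid_scheme \<Rightarrow> bool"
  where "metabelian G \<longleftrightarrow> group G \<and> solvable G \<and> solvability_class G \<le> 2"

end

(* An infinite solvable group contains an infinite commuting set, and for a commuting set S the double
   centraliser is a closed abelian subgroup containing S. A locally compact abelian group A all of whose
   subgroups are minimal is compact: a dense minimal subgroup meets every non-trivial closed subgroup,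
   which forces A to be finite or torsion-free of rank one, with a linear topology; and characters to
   the circle show that a minimal group with a linear topology is precompact. If A is infinite, it is
   then a copy of the p-adic integers.

   In the given group G, the last non-trivial term of the derived series is infinite, so the
   centraliser C of its double centraliser contains a central element of infinite order. Hence C is
   torsion-free and torsion modulo its centre, so it is abelian by solvability, a copy of Z_p, and its
   own centraliser. Thus G / C acts faithfully on C by p-adic units, so G' is contained in C. A closed
   procyclic group of p-adic units is finite or open, so finitely many translates of a product of C
   and another compact abelian subgroup cover G. *)

theory Submission
  imports Defs
begin

section \<open>Hausdorff group topologies and minimality\<close>

text \<open>Minimality enters in one way only: a coarser Hausdorff group topology on an abelian
  subgroup \<open>H\<close> is described by its neighbourhoods of the identity, and must then
  coincide with the subspace topology. Three such topologies carry the abelian case: the one from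
  the quotient by a closed \<open>L\<close> meeting \<open>H\<close> trivially, the one pulled back
  along an injective power map, and the one induced by characters with open kernel. The first gives
  rank one, the second says that elements with small powers are small, the third gives
  precompactness. The obstacle between rank one and a linear topology is divisibility: a compact
  torsion-free group with a dense cyclic subgroup might be divisible, as solenoids are. A counting
  argument with power maps excludes this. The p-adic integers appear only as a group filtered by the
  images of the p^k-th power maps, and a p-adic unit only as its integer residues modulo p^k.
  Congruence levels start at 2 so that p = 2 behaves like the odd primes.\<close>

lemma (in group) inv_mult_eq_one_iff:
  assumes "a \<in> carrier G" "b \<in> carrier G"
  shows "inv a \<otimes> b = \<one> \<longleftrightarrow> a = b"
  using assms by (metis inv_closed inv_comm inv_equality l_inv inv_inv)

lemma (in group) mult_inv_eq_one_iff:
  assumes "a \<in> carrier G" "b \<in> carrier G"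
  shows "a \<otimes> inv b = \<one> \<longleftrightarrow> a = b"
  using assms inv_equality[of a "inv b"] inv_inv[of b] r_inv[of a] by auto

lemma (in group) mult_inv_mult_cancel:
  assumes "a \<in> carrier G" "b \<in> carrier G"
  shows "a \<otimes> (inv a \<otimes> b) = b" "inv a \<otimes> (a \<otimes> b) = b"
  using assms by (simp_all add: m_assoc[symmetric])

lemma finite_image_representatives:
  assumes "finite (f ` A)"
  obtains E where "finite E" "E \<subseteq> A" "\<And>a. a \<in> A \<Longrightarrow> \<exists>e\<in>E. f e = f a"
proof
  show "finite (inv_into A f ` f ` A)" using assms by simp
  show "inv_into A f ` f ` A \<subseteq> A" by (auto intro: inv_into_into)
  show "\<exists>e\<in>inv_into A f ` f ` A. f e = f a" if "a \<in> A" for a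
    using that by (auto intro!: bexI[of _ "inv_into A f (f a)"] simp: f_inv_into_f)
qed

locale hausdorff_group = group G for G (structure) +
  fixes T :: "'a topology"
  assumes hgt: "hausdorff_group_topology G T"
begin

lemma topspace_eq [simp]: "topspace T = carrier G"
  using hgt by (simp add: hausdorff_group_topology_def)

lemma Hausdorff: "Hausdorff_space T"
  using hgt by (simp add: hausdorff_group_topology_def)

lemma open_carrier: "openin T U \<Longrightarrow> x \<in> U \<Longrightarrow> x \<in> carrier G"
  using openin_subset by fastforce

lemma closed_carrier: "closedin T U \<Longrightarrow> x \<in> U \<Longrightarrow> x \<in> carrier G"
  using closedin_subset by fastforce

lemma cont_mult:
  assumes "continuous_map X T f" "continuous_map X T g"
  shows "continuous_map X T (\<lambda>x. f x \<otimes> g x)"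
proof -
  have "continuous_map (prod_topology T T) T (\<lambda>(x, y). x \<otimes> y)"
    using hgt by (simp add: hausdorff_group_topology_def)
  moreover have "continuous_map X (prod_topology T T) (\<lambda>x. (f x, g x))"
    using assms by (simp add: continuous_map_pairedI)
  ultimately have "continuous_map X T ((\<lambda>(x, y). x \<otimes> y) \<circ> (\<lambda>x. (f x, g x)))"
    by (rule continuous_map_compose[rotated])
  then show ?thesis
    by (simp add: o_def)
qed

lemma cont_inv:
  assumes "continuous_map X T f"
  shows "continuous_map X T (\<lambda>x. inv f x)"
proof -
  have "continuous_map T T (\<lambda>x. inv x)"
    using hgt by (simp add: hausdorff_group_topology_def)
  from continuous_map_compose[OF assms this] show ?thesis
    by (simp add: o_def)
qed

lemma cont_const: "a \<in> carrier G \<Longrightarrow> continuous_map X T (\<lambda>x. a)"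
  by simp

lemma cont_id: "continuous_map T T (\<lambda>x. x)"
  by simp

lemma cont_pow:
  assumes "continuous_map X T f"
  shows "continuous_map X T (\<lambda>x. f x [^] (n::nat))"
  by (induction n) (simp_all add: assms cont_mult)

lemmas cont_intros = cont_mult cont_inv cont_const cont_id cont_pow

lemma open_vimage:
  "openin T U \<Longrightarrow> continuous_map T T f \<Longrightarrow> openin T {x \<in> carrier G. f x \<in> U}"
  using openin_continuous_map_preimage[of T T f U] by simp

lemma closed_vimage:
  "closedin T U \<Longrightarrow> continuous_map T T f \<Longrightarrow> closedin T {x \<in> carrier G. f x \<in> U}"
  using closedin_continuous_map_preimage[of T T f U] by simp

lemma prod_nbhds:
  assumes "openin T U" "a \<in> carrier G" "b \<in> carrier G" "a \<otimes> inv b \<in> U"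
  obtains V W where "openin T V" "openin T W" "a \<in> V" "b \<in> W" "\<And>x y. x \<in> V \<Longrightarrow> y \<in> W \<Longrightarrow> x \<otimes> inv y \<in> U"
proof -
  have "continuous_map (prod_topology T T) T (\<lambda>z. fst z \<otimes> inv (snd z))"
    by (intro cont_intros) (simp_all add: continuous_map_fst continuous_map_snd)
  from openin_continuous_map_preimage[OF this assms(1)]
  have *: "openin (prod_topology T T) {z \<in> carrier G \<times> carrier G. fst z \<otimes> inv (snd z) \<in> U}"
    by simp
  obtain V W where "openin T V" "openin T W" "a \<in> V" "b \<in> W"
    "V \<times> W \<subseteq> {z \<in> carrier G \<times> carrier G. fst z \<otimes> inv (snd z) \<in> U}"
    using *[unfolded openin_prod_topology_alt] assms by force
  then show thesis
    by (intro that[of V W]) auto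
qed

lemma nbhd_div:
  assumes "openin T U" "\<one> \<in> U"
  obtains W where "openin T W" "\<one> \<in> W" "W \<subseteq> U" "\<And>x y. x \<in> W \<Longrightarrow> y \<in> W \<Longrightarrow> x \<otimes> inv y \<in> U"
proof -
  obtain V W where *: "openin T V" "openin T W" "\<one> \<in> V" "\<one> \<in> W" "\<And>x y. x \<in> V \<Longrightarrow> y \<in> W \<Longrightarrow> x \<otimes> inv y \<in> U"
    using prod_nbhds[OF assms(1), of \<one> \<one>] assms by auto
  show thesis
    by (rule that[of "U \<inter> (V \<inter> W)"]) (use * assms in auto)
qed

lemma nbhd_mult:
  assumes "openin T U" "\<one> \<in> U"
  obtains W where "openin T W" "\<one> \<in> W" "W \<subseteq> U" "\<And>x y. x \<in> W \<Longrightarrow> y \<in> W \<Longrightarrow> x \<otimes> y \<in> U"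
proof -
  obtain V where V: "openin T V" "\<one> \<in> V" "V \<subseteq> U" "\<And>x y. x \<in> V \<Longrightarrow> y \<in> V \<Longrightarrow> x \<otimes> inv y \<in> U"
    using nbhd_div[OF assms] by blast
  obtain W where W: "openin T W" "\<one> \<in> W" "W \<subseteq> V" "\<And>x y. x \<in> W \<Longrightarrow> y \<in> W \<Longrightarrow> x \<otimes> inv y \<in> V"
    using nbhd_div[OF V(1,2)] by blast
  show thesis
  proof (rule that[of W])
    fix x y assume xy: "x \<in> W" "y \<in> W"
    then have c: "x \<in> carrier G" "y \<in> carrier G"
      using W open_carrier by auto
    have "\<one> \<otimes> inv y \<in> V" using W(4)[of \<one> y] W(2) xy by simp
    then have "x \<otimes> inv (\<one> \<otimes> inv y) \<in> U"
      using V(4) xy W(3) by blast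
    then show "x \<otimes> y \<in> U"
      using c by simp
  qed (use W V in auto)
qed

text \<open>The last property says that \<open>U\<close> and its translate by \<open>x\<close> are
  disjoint; later contradictions write \<open>x\<close> as a quotient of two elements of
  \<open>U\<close>.\<close>

lemma separate_nbhd:
  assumes "x \<in> carrier G" "x \<noteq> \<one>"
  obtains U where "openin T U" "\<one> \<in> U" "x \<notin> U" "\<And>a b. a \<in> U \<Longrightarrow> b \<in> U \<Longrightarrow> a \<otimes> inv b \<noteq> x"
proof -
  have cl: "closedin T {x}"
    using closedin_Hausdorff_singleton[OF Hausdorff] assms by simp
  then have "openin T (carrier G - {x})"
    using closedin_def by (metis topspace_eq)
  then obtain W where W: "openin T W" "\<one> \<in> W" "W \<subseteq> carrier G - {x}" "\<And>a y. a \<in> W \<Longrightarrow> y \<in> W \<Longrightarrow> a \<otimes> inv y \<in> carrier G - {x}"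
    using nbhd_div[of "carrier G - {x}"] assms by auto
  show thesis
    by (rule that[of W]) (use W in auto)
qed

lemma open_translate:
  assumes "openin T U" "g \<in> carrier G"
  shows "openin T {x \<in> carrier G. inv g \<otimes> x \<in> U}"
  by (rule open_vimage[OF assms(1)]) (intro cont_intros, use assms in auto)

lemma in_closure_iff:
  "x \<in> T closure_of S \<longleftrightarrow> x \<in> carrier G \<and> (\<forall>U. openin T U \<and> \<one> \<in> U \<longrightarrow> (\<exists>u\<in>U. x \<otimes> u \<in> S))"
  (is "?L \<longleftrightarrow> ?R")
proof
  assume L: ?L
  then have x: "x \<in> carrier G"
    by (metis in_closure_of topspace_eq)
  have "\<exists>u\<in>U. x \<otimes> u \<in> S" if U: "openin T U" "\<one> \<in> U" for U
  proof -
    have "x \<in> {y \<in> carrier G. inv x \<otimes> y \<in> U}"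
      using x U by simp
    then have "\<exists>y. y \<in> S \<and> y \<in> {y \<in> carrier G. inv x \<otimes> y \<in> U}"
      using L[unfolded in_closure_of, THEN conjunct2, rule_format, OF conjI, OF _ open_translate[OF U(1) x]] U(2) by simp
    then obtain y where y: "y \<in> S" "y \<in> carrier G" "inv x \<otimes> y \<in> U"
      by blast
    have "x \<otimes> (inv x \<otimes> y) = y"
      using x y by (simp add: m_assoc[symmetric])
    then show ?thesis
      using y by (intro bexI[of _ "inv x \<otimes> y"]) auto
  qed
  with x show ?R by blast
next
  assume R: ?R
  show ?L
    unfolding in_closure_of
  proof (intro conjI allI impI)
    show "x \<in> topspace T" using R by simp
    fix U assume U: "x \<in> U \<and> openin T U"
    have "openin T {u \<in> carrier G. x \<otimes> u \<in> U}"
      by (rule open_vimage) (use U R in \<open>auto intro!: cont_intros\<close>)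
    with R U show "\<exists>y. y \<in> S \<and> y \<in> U"
      by (smt (verit) mem_Collect_eq one_closed r_one)
  qed
qed

lemma closedD:
  assumes "closedin T L" "x \<in> carrier G" "x \<notin> L"
  obtains U where "openin T U" "\<one> \<in> U" "\<And>u. u \<in> U \<Longrightarrow> x \<otimes> u \<notin> L"
  using assms in_closure_iff[of x L] closure_of_closedin[OF assms(1)] by blast

lemma closure_subgroup:
  assumes "subgroup H G"
  shows "subgroup (T closure_of H) G"
proof (rule subgroupI)
  have sub: "H \<subseteq> T closure_of H"
    using assms by (simp add: closure_of_subset subgroup.subset)
  show "T closure_of H \<subseteq> carrier G"
    using closure_of_subset_topspace by fastforce
  show "T closure_of H \<noteq> {}"
    using sub subgroup.one_closed[OF assms] by blast
  have *: "a \<otimes> inv b \<in> T closure_of H" if ab: "a \<in> T closure_of H" "b \<in> T closure_of H" for a b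
  proof -
    have c: "a \<in> carrier G" "b \<in> carrier G"
      using that in_closure_iff by auto
    show ?thesis
      unfolding in_closure_of
    proof (intro conjI allI impI)
      fix U assume "a \<otimes> inv b \<in> U \<and> openin T U"
      then obtain V W where VW: "openin T V" "openin T W" "a \<in> V" "b \<in> W" "\<And>x y. x \<in> V \<Longrightarrow> y \<in> W \<Longrightarrow> x \<otimes> inv y \<in> U"
        using prod_nbhds[of U a b] c by blast
      obtain x where "x \<in> H" "x \<in> V"
        using ab(1) VW(1,3) unfolding in_closure_of by meson
      moreover obtain y where "y \<in> H" "y \<in> W"
        using ab(2) VW(2,4) unfolding in_closure_of by meson
      ultimately
      show "\<exists>y. y \<in> H \<and> y \<in> U"
        using VW(5) subgroup.m_closed[OF assms] subgroup.m_inv_closed[OF assms] by blast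
    qed (use c in auto)
  qed
  fix a b assume a: "a \<in> T closure_of H" and b: "b \<in> T closure_of H"
  have o: "\<one> \<in> T closure_of H" using sub subgroup.one_closed[OF assms] by blast
  have c: "a \<in> carrier G" "b \<in> carrier G"
    using a b in_closure_iff by auto
  show i: "inv a \<in> T closure_of H" if "a \<in> T closure_of H" for a
    using *[OF o that] that in_closure_iff by auto
  show "a \<otimes> b \<in> T closure_of H"
    using *[OF a i[OF b]] c by simp
qed

lemma compact_of_translates:
  assumes K: "compactin T K" and E: "finite E" "E \<subseteq> carrier G" "\<And>a. a \<in> carrier G \<Longrightarrow> \<exists>e\<in>E. inv e \<otimes> a \<in> K"
  shows "compact_space T"
proof -
  have comp: "compactin T (\<Union>e\<in>E. (\<lambda>x. e \<otimes> x) ` K)"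
    using E by (intro compactin_Union) (auto intro!: image_compactin[OF K] cont_intros)
  have "topspace T \<subseteq> (\<Union>e\<in>E. (\<lambda>x. e \<otimes> x) ` K)"
  proof
    fix a assume "a \<in> topspace T"
    then have a: "a \<in> carrier G" by simp
    then obtain e where e: "e \<in> E" "inv e \<otimes> a \<in> K" using E(3) by blast
    then have "a = e \<otimes> (inv e \<otimes> a)" using a E(2) by (auto simp: mult_inv_mult_cancel)
    then show "a \<in> (\<Union>e\<in>E. (\<lambda>x. e \<otimes> x) ` K)" using e by blast
  qed
  then show ?thesis
    using comp compactin_subset_topspace[OF comp] unfolding compact_space_def by (metis subset_antisym)
qed

lemma closure_minimal: "S \<subseteq> F \<Longrightarrow> closedin T F \<Longrightarrow> T closure_of S \<subseteq> F"
  by (rule closure_of_minimal)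

lemma sub_hausdorff_group:
  assumes H: "subgroup H G"
  shows "hausdorff_group (G\<lparr>carrier := H\<rparr>) (subtopology T H)"
proof -
  have c: "continuous_map (subtopology T H) T (\<lambda>x. x)"
    by (simp add: continuous_map_from_subtopology)
  have HG: "H \<subseteq> carrier G" by (rule subgroup.subset[OF H])
  have ts: "topspace (subtopology T H) = H" using HG by auto
  have 1: "continuous_map (prod_topology (subtopology T H) (subtopology T H)) (subtopology T H) (\<lambda>(x, y). x \<otimes> y)"
  proof -
    have f: "continuous_map (prod_topology (subtopology T H) (subtopology T H)) T fst"
      using continuous_map_compose[OF continuous_map_fst c] by (simp add: o_def)
    have s: "continuous_map (prod_topology (subtopology T H) (subtopology T H)) T snd"
      using continuous_map_compose[OF continuous_map_snd c] by (simp add: o_def)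
    have "continuous_map (prod_topology (subtopology T H) (subtopology T H)) T (\<lambda>z. fst z \<otimes> snd z)"
      by (rule cont_mult[OF f s])
    then show ?thesis
      using subgroup.m_closed[OF H]
      by (auto simp: continuous_map_in_subtopology case_prod_unfold)
  qed
  have 2: "continuous_map (subtopology T H) (subtopology T H) (\<lambda>x. inv\<^bsub>G\<lparr>carrier := H\<rparr>\<^esub> x)"
  proof (rule continuous_map_eq)
    show "continuous_map (subtopology T H) (subtopology T H) (\<lambda>x. inv x)"
      using subgroup.m_inv_closed[OF H] cont_inv[OF c]
      by (auto simp: continuous_map_in_subtopology)
    show "inv x = inv\<^bsub>G\<lparr>carrier := H\<rparr>\<^esub> x" if "x \<in> topspace (subtopology T H)" for x
      using m_inv_consistent[OF H, of x] that by auto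
  qed
  show ?thesis
    unfolding hausdorff_group_def hausdorff_group_axioms_def hausdorff_group_topology_def
    using 1 2 ts subgroup.subgroup_is_group[OF H is_group] Hausdorff_space_subtopology[OF Hausdorff, of H]
    by auto
qed

end

section \<open>Minimality tested on neighbourhood filters of abelian subgroups\<close>

locale hm_group = hausdorff_group +
  assumes hm: "hereditarily_minimal G T"
begin

text \<open>The hypotheses on \<open>\<B>\<close> are those of a neighbourhood base at the identity of a coarser Hausdorff
  group topology on \<open>H\<close>; invariance under conjugation is missing because \<open>H\<close> is abelian.\<close>

lemma minimal_filter_base:
  assumes H: "subgroup H G" and comm: "\<And>a b. a \<in> H \<Longrightarrow> b \<in> H \<Longrightarrow> a \<otimes> b = b \<otimes> a"
    and ne: "\<B> \<noteq> {}" and sub: "\<And>V. V \<in> \<B> \<Longrightarrow> V \<subseteq> H"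
    and coarse: "\<And>V. V \<in> \<B> \<Longrightarrow> \<exists>U. openin T U \<and> \<one> \<in> U \<and> U \<inter> H \<subseteq> V"
    and dir: "\<And>V W. V \<in> \<B> \<Longrightarrow> W \<in> \<B> \<Longrightarrow> \<exists>X\<in>\<B>. X \<subseteq> V \<inter> W"
    and div: "\<And>V. V \<in> \<B> \<Longrightarrow> \<exists>W\<in>\<B>. \<forall>a\<in>W. \<forall>b\<in>W. a \<otimes> inv b \<in> V"
    and sep: "\<And>h. h \<in> H \<Longrightarrow> h \<noteq> \<one> \<Longrightarrow> \<exists>V\<in>\<B>. h \<notin> V"
    and U: "openin T U" "\<one> \<in> U"
  shows "\<exists>V\<in>\<B>. V \<subseteq> U"
proof -
  have HG: "\<And>x. x \<in> H \<Longrightarrow> x \<in> carrier G"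
    using subgroup.mem_carrier[OF H] .
  note Hc = subgroup.m_closed[OF H] subgroup.m_inv_closed[OF H] subgroup.one_closed[OF H]
  have one: "\<one> \<in> V" if "V \<in> \<B>" for V
    using coarse[OF that] Hc by blast
  have BH: "v \<in> H" if "V \<in> \<B>" "v \<in> V" for v V
    using sub that by blast
  have divinv: "\<exists>W\<in>\<B>. W \<subseteq> V \<and> (\<forall>a\<in>W. inv a \<in> V)" if V: "V \<in> \<B>" for V
  proof -
    obtain W where W: "W \<in> \<B>" "\<forall>a\<in>W. \<forall>b\<in>W. a \<otimes> inv b \<in> V"
      using div[OF V] by blast
    have "inv a \<in> V" "a \<in> V" if a: "a \<in> W" for a
      using W(2)[rule_format, of \<one> a] W(2)[rule_format, of a \<one>] one[OF W(1)] a HG[OF BH[OF W(1) a]] by simp_all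
    then show ?thesis using W(1) by blast
  qed
  have mul: "\<exists>W\<in>\<B>. \<forall>a\<in>W. \<forall>b\<in>W. a \<otimes> b \<in> V" if V: "V \<in> \<B>" for V
  proof -
    obtain W where W: "W \<in> \<B>" "\<forall>a\<in>W. \<forall>b\<in>W. a \<otimes> inv b \<in> V"
      using div[OF V] by blast
    obtain X where X: "X \<in> \<B>" "X \<subseteq> W" "\<forall>a\<in>X. inv a \<in> W"
      using divinv[OF W(1)] by blast
    have "a \<otimes> b \<in> V" if "a \<in> X" "b \<in> X" for a b
    proof -
      have "a \<otimes> inv (inv b) \<in> V"
        using W(2)[rule_format, of a "inv b"] X that by blast
      then show ?thesis using HG[OF BH[OF X(1) that(2)]] by simp
    qed
    with X(1) show ?thesis by blast
  qed
  \<comment> \<open>A set is open when around each of its points it contains a translate of some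
    member of the filter base. The members of \<open>\<B>\<close> themselves need not be
    open.\<close>
  define ops where "ops = (\<lambda>W. W \<subseteq> H \<and> (\<forall>w\<in>W. \<exists>V\<in>\<B>. \<forall>v\<in>V. w \<otimes> v \<in> W))"
  have "istopology ops"
    unfolding istopology_def
  proof (intro conjI allI impI)
    fix S S' assume S: "ops S" "ops S'"
    have "\<exists>V\<in>\<B>. \<forall>v\<in>V. w \<otimes> v \<in> S \<inter> S'" if w: "w \<in> S \<inter> S'" for w
    proof -
      obtain V where V: "V \<in> \<B>" "\<forall>v\<in>V. w \<otimes> v \<in> S"
        using S(1) w unfolding ops_def by blast
      obtain V' where V': "V' \<in> \<B>" "\<forall>v\<in>V'. w \<otimes> v \<in> S'"
        using S(2) w unfolding ops_def by blast
      obtain X where "X \<in> \<B>" "X \<subseteq> V \<inter> V'"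
        using dir[OF V(1) V'(1)] by blast
      then show ?thesis
        using V(2) V'(2) by (intro bexI[of _ X]) auto
    qed
    then show "ops (S \<inter> S')" using S unfolding ops_def by blast
  next
    fix \<K> assume K: "\<forall>K\<in>\<K>. ops K"
    show "ops (\<Union>\<K>)"
      unfolding ops_def
    proof (intro conjI ballI)
      show "\<Union>\<K> \<subseteq> H" using K unfolding ops_def by blast
      fix w assume "w \<in> \<Union>\<K>"
      then obtain S where S: "S \<in> \<K>" "w \<in> S" by blast
      then obtain V where "V \<in> \<B>" "\<forall>v\<in>V. w \<otimes> v \<in> S"
        using K unfolding ops_def by blast
      then show "\<exists>V\<in>\<B>. \<forall>v\<in>V. w \<otimes> v \<in> \<Union>\<K>" using S by blast
    qed
  qed
  then have open_iff: "openin (topology ops) W \<longleftrightarrow> ops W" for W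
    by (simp add: topology_inverse')
  define S where "S = topology ops"
  have opsH: "ops H"
    unfolding ops_def using Hc(1) ne BH by blast
  have tsS: "topspace S = H"
    unfolding topspace_def S_def open_iff using opsH unfolding ops_def by blast
  \<comment> \<open>As a member \<open>V\<close> need not be open, its translate by \<open>a\<close>
    is replaced by an interior: the points \<open>h\<close> such that some translate of a
    \<open>V'\<close> by \<open>h\<close> still lies in it.\<close>
  have interior: "\<exists>O'. ops O' \<and> a \<in> O' \<and> (\<forall>h\<in>O'. inv a \<otimes> h \<in> V)" if a: "a \<in> H" and V: "V \<in> \<B>" for a V
  proof (intro exI conjI ballI)
    let ?O = "{h \<in> H. \<exists>V'\<in>\<B>. \<forall>v\<in>V'. inv a \<otimes> (h \<otimes> v) \<in> V}"
    show "a \<in> ?O"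
    proof -
      have "inv a \<otimes> (a \<otimes> v) \<in> V" if "v \<in> V" for v
        using that HG[OF a] HG[OF BH[OF V that]] by (simp add: mult_inv_mult_cancel)
      then show ?thesis using a V by blast
    qed
    show "inv a \<otimes> h \<in> V" if h: "h \<in> ?O" for h
    proof -
      obtain V' where V': "h \<in> H" "V' \<in> \<B>" "\<forall>v\<in>V'. inv a \<otimes> (h \<otimes> v) \<in> V"
        using h by blast
      then have "inv a \<otimes> (h \<otimes> \<one>) \<in> V"
        using one Hc(3) by blast
      then show ?thesis using V' HG by simp
    qed
    show "ops ?O"
      unfolding ops_def
    proof (intro conjI ballI)
      fix h assume "h \<in> ?O"
      then obtain V' where h: "h \<in> H" and V': "V' \<in> \<B>" "\<forall>v\<in>V'. inv a \<otimes> (h \<otimes> v) \<in> V"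
        by blast
      obtain W where W: "W \<in> \<B>" "\<forall>a\<in>W. \<forall>b\<in>W. a \<otimes> b \<in> V'"
        using mul[OF V'(1)] by blast
      have "inv a \<otimes> ((h \<otimes> v) \<otimes> w) \<in> V" if "v \<in> W" "w \<in> W" for v w
      proof -
        have "inv a \<otimes> (h \<otimes> (v \<otimes> w)) \<in> V"
          using that W V' Hc by blast
        then show ?thesis using that(1,2) h HG BH[OF W(1)] by (simp add: m_assoc)
      qed
      then show "\<exists>V'\<in>\<B>. \<forall>v\<in>V'. h \<otimes> v \<in> ?O"
        using W(1) h Hc(1) BH[OF W(1)] by blast
    qed auto
  qed
  let ?H = "G\<lparr>carrier := H\<rparr>"
  have hg: "hausdorff_group_topology ?H S"
    unfolding hausdorff_group_topology_def
  proof (intro conjI)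
    show "topspace S = carrier ?H" by (simp add: tsS)
    show "continuous_map (prod_topology S S) S (\<lambda>(x, y). x \<otimes>\<^bsub>?H\<^esub> y)"
      unfolding continuous_map_def
    proof (intro conjI allI impI)
      show "(\<lambda>(x, y). x \<otimes>\<^bsub>?H\<^esub> y) \<in> topspace (prod_topology S S) \<rightarrow> topspace S"
        using Hc by (auto simp: tsS)
      fix U assume "openin S U"
      then have U: "ops U" by (simp add: S_def open_iff)
      show "openin (prod_topology S S) {x \<in> topspace (prod_topology S S). (case x of (x, y) \<Rightarrow> x \<otimes>\<^bsub>?H\<^esub> y) \<in> U}"
        unfolding openin_prod_topology_alt
      proof (intro allI impI)
        fix a b assume "(a, b) \<in> {x \<in> topspace (prod_topology S S). (case x of (x, y) \<Rightarrow> x \<otimes>\<^bsub>?H\<^esub> y) \<in> U}"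
        then have ab: "a \<in> H" "b \<in> H" "a \<otimes> b \<in> U" by (auto simp: tsS)
        then obtain V where V: "V \<in> \<B>" "\<forall>v\<in>V. a \<otimes> b \<otimes> v \<in> U"
          using U unfolding ops_def by blast
        obtain W where W: "W \<in> \<B>" "\<forall>a\<in>W. \<forall>b\<in>W. a \<otimes> b \<in> V"
          using mul[OF V(1)] by blast
        obtain A where A: "ops A" "a \<in> A" "\<forall>h\<in>A. inv a \<otimes> h \<in> W"
          using interior[OF ab(1) W(1)] by blast
        obtain B where B: "ops B" "b \<in> B" "\<forall>h\<in>B. inv b \<otimes> h \<in> W"
          using interior[OF ab(2) W(1)] by blast
        have AH: "A \<subseteq> H" "B \<subseteq> H" using A B unfolding ops_def by auto
        have "x \<otimes> y \<in> U" if "x \<in> A" "y \<in> B" for x y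
        proof -
          have xy: "x \<in> H" "y \<in> H" using that AH by auto
          have "inv a \<otimes> x \<in> W" "inv b \<otimes> y \<in> W"
            using A(3) B(3) that xy ab Hc by auto
          then have "(inv a \<otimes> x) \<otimes> (inv b \<otimes> y) \<in> V"
            using W(2) Hc by auto
          then have 1: "a \<otimes> b \<otimes> ((inv a \<otimes> x) \<otimes> (inv b \<otimes> y)) \<in> U"
            using V(2) by blast
          have "b \<otimes> (inv a \<otimes> x) = (inv a \<otimes> x) \<otimes> b"
            using comm Hc xy ab by blast
          then have "a \<otimes> b \<otimes> ((inv a \<otimes> x) \<otimes> (inv b \<otimes> y)) = a \<otimes> ((inv a \<otimes> x) \<otimes> b) \<otimes> (inv b \<otimes> y)"
            using xy ab HG by (metis inv_closed m_assoc m_closed)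
          also have "\<dots> = x \<otimes> y"
            using xy ab HG by (metis inv_closed m_assoc m_closed l_one r_inv)
          finally show ?thesis using 1 by simp
        qed
        then show "\<exists>U' V. openin S U' \<and> openin S V \<and> a \<in> U' \<and> b \<in> V \<and> U' \<times> V \<subseteq> {x \<in> topspace (prod_topology S S). (case x of (x, y) \<Rightarrow> x \<otimes>\<^bsub>?H\<^esub> y) \<in> U}"
          using A B AH by (intro exI[of _ A] exI[of _ B]) (auto simp: S_def[symmetric] tsS open_iff[folded S_def])
      qed
    qed
    show "continuous_map S S (\<lambda>x. inv\<^bsub>?H\<^esub> x)"
    proof (rule continuous_map_eq)
      show "inv x = inv\<^bsub>?H\<^esub> x" if "x \<in> topspace S" for x
        using m_inv_consistent[OF H, of x] that tsS by auto
      show "continuous_map S S (\<lambda>x. inv x)"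
        unfolding continuous_map_def
      proof (intro conjI allI impI)
        show "m_inv G \<in> topspace S \<rightarrow> topspace S" using Hc by (auto simp: tsS)
        fix U assume "openin S U"
        then have U: "ops U" by (simp add: S_def open_iff)
        have "ops {x \<in> H. inv x \<in> U}"
          unfolding ops_def
        proof (intro conjI ballI)
          fix w assume "w \<in> {x \<in> H. inv x \<in> U}"
          then have w: "w \<in> H" "inv w \<in> U" by auto
          then obtain V where V: "V \<in> \<B>" "\<forall>v\<in>V. inv w \<otimes> v \<in> U"
            using U unfolding ops_def by blast
          obtain W where W: "W \<in> \<B>" "\<forall>a\<in>W. inv a \<in> V"
            using divinv[OF V(1)] by blast
          have "inv (w \<otimes> v) \<in> U" if "v \<in> W" for v
          proof -
            have "inv w \<otimes> inv v \<in> U" using V W that Hc by blast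
            moreover have "inv (w \<otimes> v) = inv w \<otimes> inv v"
              using w HG Hc comm BH[OF W(1) that] by (simp add: inv_mult_group)
            ultimately show ?thesis by simp
          qed
          then show "\<exists>V\<in>\<B>. \<forall>v\<in>V. w \<otimes> v \<in> {x \<in> H. inv x \<in> U}"
            using W(1) w Hc(1) BH[OF W(1)] by blast
        qed auto
        then show "openin S {x \<in> topspace S. inv x \<in> U}"
          by (simp add: S_def open_iff tsS[unfolded S_def])
      qed
    qed
    show "Hausdorff_space S"
      unfolding Hausdorff_space_def
    proof (intro allI impI)
      fix a b assume "a \<in> topspace S \<and> b \<in> topspace S \<and> a \<noteq> b"
      then have ab: "a \<in> H" "b \<in> H" "a \<noteq> b" by (auto simp: tsS)
      have "inv a \<otimes> b \<noteq> \<one>"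
        using ab HG by (simp add: inv_mult_eq_one_iff)
      then obtain V where V: "V \<in> \<B>" "inv a \<otimes> b \<notin> V"
        using sep[of "inv a \<otimes> b"] ab Hc by blast
      obtain W where W: "W \<in> \<B>" "\<forall>a\<in>W. \<forall>b\<in>W. a \<otimes> inv b \<in> V"
        using div[OF V(1)] by blast
      obtain A where A: "ops A" "a \<in> A" "\<forall>h\<in>A. inv a \<otimes> h \<in> W"
        using interior[OF ab(1) W(1)] by blast
      obtain B where B: "ops B" "b \<in> B" "\<forall>h\<in>B. inv b \<otimes> h \<in> W"
        using interior[OF ab(2) W(1)] by blast
      have AH: "A \<subseteq> H" "B \<subseteq> H" using A B unfolding ops_def by auto
      have "z \<notin> B" if "z \<in> A" for z
      proof
        assume "z \<in> B"
        have z: "z \<in> H" using that AH by auto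
        have "inv a \<otimes> z \<in> W" "inv b \<otimes> z \<in> W"
          using A(3) B(3) that \<open>z \<in> B\<close> z ab Hc by auto
        then have 1: "(inv a \<otimes> z) \<otimes> inv (inv b \<otimes> z) \<in> V"
          using W(2) by blast
        have "(inv a \<otimes> z) \<otimes> inv (inv b \<otimes> z) = inv a \<otimes> b"
          using HG[OF z] HG[OF ab(1)] HG[OF ab(2)] by (simp add: inv_mult_group m_assoc) (simp add: m_assoc[symmetric])
        with 1 V(2) show False by simp
      qed
      then show "\<exists>U V. openin S U \<and> openin S V \<and> a \<in> U \<and> b \<in> V \<and> disjnt U V"
        using A B by (intro exI[of _ A] exI[of _ B]) (auto simp: open_iff[folded S_def] disjnt_def)
    qed
  qed
  have HG': "H \<subseteq> carrier G" using HG by blast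
  have tH: "topspace (subtopology T H) = H" using HG' by auto
  have fine: "openin (subtopology T H) W" if "openin S W" for W
  proof (subst openin_subopen, intro ballI)
    fix w assume w: "w \<in> W"
    have "ops W" using that by (simp add: open_iff[folded S_def])
    then obtain V where V: "W \<subseteq> H" "V \<in> \<B>" "\<forall>v\<in>V. w \<otimes> v \<in> W"
      using w unfolding ops_def by blast
    obtain U where U: "openin T U" "\<one> \<in> U" "U \<inter> H \<subseteq> V" using coarse[OF V(2)] by blast
    have wH: "w \<in> H" using w V by blast
    have "openin (subtopology T H) ({x \<in> carrier G. inv w \<otimes> x \<in> U} \<inter> H)"
      using open_translate[OF U(1), of w] HG[OF wH] by (simp add: openin_subtopology_Int)
    moreover have "w \<in> {x \<in> carrier G. inv w \<otimes> x \<in> U} \<inter> H"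
      using wH HG U by simp
    moreover have "{x \<in> carrier G. inv w \<otimes> x \<in> U} \<inter> H \<subseteq> W"
    proof
      fix x assume x: "x \<in> {x \<in> carrier G. inv w \<otimes> x \<in> U} \<inter> H"
      then have "w \<otimes> (inv w \<otimes> x) \<in> W"
        using V U wH Hc by blast
      then show "x \<in> W" using x wH HG by (simp add: m_assoc[symmetric])
    qed
    ultimately show "\<exists>X. openin (subtopology T H) X \<and> w \<in> X \<and> X \<subseteq> W" by blast
  qed
  \<comment> \<open>Equality with the subspace topology makes \<open>U \<inter> H\<close> open for
    the filter topology, so around the identity it contains a member of \<open>\<B>\<close>.\<close>
  have "S = subtopology T H"
    using hm H hg fine tH tsS
    unfolding hereditarily_minimal_def minimal_topological_group_def strictly_coarser_def by metis
  moreover have "openin (subtopology T H) (U \<inter> H)"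
    using U by (simp add: openin_subtopology_Int)
  ultimately have "ops (U \<inter> H)" using open_iff[folded S_def] by metis
  then obtain V where V: "V \<in> \<B>" "\<forall>v\<in>V. \<one> \<otimes> v \<in> U \<inter> H"
    using U Hc unfolding ops_def by blast
  then have "V \<subseteq> U" using HG BH[OF V(1)] by auto
  with V show ?thesis by blast
qed

text \<open>For filter bases indexed by the neighbourhoods \<open>U\<close> of the given topology:
  monotonicity gives directedness by intersecting indices, and refining \<open>U\<close> under
  division gives the group axiom. It serves the quotient topology and the topology pulled back along
  a power map.\<close>

lemma minimal_nbhd_family:
  assumes H: "subgroup H G" and comm: "\<And>a b. a \<in> H \<Longrightarrow> b \<in> H \<Longrightarrow> a \<otimes> b = b \<otimes> a"
    and N: "\<And>U. N U \<subseteq> H" and mono: "\<And>U V. U \<subseteq> V \<Longrightarrow> N U \<subseteq> N V"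
    and coarse: "\<And>U. openin T U \<Longrightarrow> \<one> \<in> U \<Longrightarrow> \<exists>W. openin T W \<and> \<one> \<in> W \<and> W \<inter> H \<subseteq> N U"
    and div: "\<And>U W a b. W \<subseteq> carrier G \<Longrightarrow> \<one> \<in> W \<Longrightarrow> (\<And>x y. x \<in> W \<Longrightarrow> y \<in> W \<Longrightarrow> x \<otimes> inv y \<in> U)
      \<Longrightarrow> a \<in> N W \<Longrightarrow> b \<in> N W \<Longrightarrow> a \<otimes> inv b \<in> N U"
    and sep: "\<And>h. h \<in> H \<Longrightarrow> h \<noteq> \<one> \<Longrightarrow> \<exists>U. openin T U \<and> \<one> \<in> U \<and> h \<notin> N U"
    and U: "openin T U" "\<one> \<in> U"
  obtains W where "openin T W" "\<one> \<in> W" "N W \<subseteq> U"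
proof -
  define \<B> where "\<B> = {N U | U. openin T U \<and> \<one> \<in> U}"
  have NB: "N U \<in> \<B>" if "openin T U" "\<one> \<in> U" for U
    using that by (auto simp: \<B>_def)
  have BE: "\<exists>U. V = N U \<and> openin T U \<and> \<one> \<in> U" if "V \<in> \<B>" for V
    using that by (simp add: \<B>_def)
  have "\<exists>V\<in>\<B>. V \<subseteq> U"
  proof (rule minimal_filter_base[OF H comm _ _ _ _ _ _ U])
    show "\<B> \<noteq> {}" using NB[OF U] by blast
    show "V \<subseteq> H" if "V \<in> \<B>" for V using BE[OF that] N by blast
    show "\<exists>U. openin T U \<and> \<one> \<in> U \<and> U \<inter> H \<subseteq> V" if "V \<in> \<B>" for V
      using BE[OF that] coarse by blast
    show "\<exists>X\<in>\<B>. X \<subseteq> V \<inter> W" if VW: "V \<in> \<B>" "W \<in> \<B>" for V W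
    proof -
      obtain V' W' where *: "V = N V'" "openin T V'" "\<one> \<in> V'" "W = N W'" "openin T W'" "\<one> \<in> W'"
        using BE[OF VW(1)] BE[OF VW(2)] by blast
      then have "N (V' \<inter> W') \<in> \<B>" "N (V' \<inter> W') \<subseteq> V \<inter> W" using NB mono by auto
      then show ?thesis by blast
    qed
    show "\<exists>W\<in>\<B>. \<forall>a\<in>W. \<forall>b\<in>W. a \<otimes> inv b \<in> V" if "V \<in> \<B>" for V
    proof -
      obtain V' where V': "V = N V'" "openin T V'" "\<one> \<in> V'" using BE[OF \<open>V \<in> \<B>\<close>] by blast
      obtain W where W: "openin T W" "\<one> \<in> W" "W \<subseteq> V'" "\<And>x y. x \<in> W \<Longrightarrow> y \<in> W \<Longrightarrow> x \<otimes> inv y \<in> V'"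
        using nbhd_div[OF V'(2,3)] by blast
      have "W \<subseteq> carrier G" using open_carrier[OF W(1)] by blast
      then have "\<forall>a\<in>N W. \<forall>b\<in>N W. a \<otimes> inv b \<in> V" unfolding V'(1) using div W(2,4) by blast
      then show ?thesis using NB[OF W(1,2)] by blast
    qed
    show "\<exists>V\<in>\<B>. h \<notin> V" if "h \<in> H" "h \<noteq> \<one>" for h
      using sep[OF that] NB by blast
  qed
  then show thesis using BE that by blast
qed

lemma sub_hm_group:
  assumes H: "subgroup H G"
  shows "hm_group (G\<lparr>carrier := H\<rparr>) (subtopology T H)"
proof -
  interpret H: hausdorff_group "G\<lparr>carrier := H\<rparr>" "subtopology T H"
    by (rule sub_hausdorff_group[OF H])
  have "minimal_topological_group ((G\<lparr>carrier := H\<rparr>)\<lparr>carrier := K\<rparr>) (subtopology (subtopology T H) K)"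
    if "subgroup K (G\<lparr>carrier := H\<rparr>)" for K
  proof -
    have K: "subgroup K G" using incl_subgroup[OF H that] .
    have KH: "K \<subseteq> H" using subgroup.subset[OF that] by simp
    show ?thesis
      using hm K KH unfolding hereditarily_minimal_def
      by (simp add: subtopology_subtopology inf.absorb2)
  qed
  then have "hereditarily_minimal (G\<lparr>carrier := H\<rparr>) (subtopology T H)"
    unfolding hereditarily_minimal_def hausdorff_topological_group_def
    using H.hgt H.is_group by simp
  then show ?thesis
    by (simp add: hm_group_def hm_group_axioms_def H.hausdorff_group_axioms)
qed

end

section \<open>Characters of abelian groups\<close>

text \<open>Graphs of circle-valued characters defined on subgroups.\<close>

definition (in group) partial_char :: "('a \<times> complex) set \<Rightarrow> bool"
  where "partial_char R \<longleftrightarrow> R \<subseteq> carrier G \<times> {z. norm z = 1} \<and> (\<one>, 1) \<in> R \<and>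
    (\<forall>x z y w. (x, z) \<in> R \<longrightarrow> (y, w) \<in> R \<longrightarrow> (x \<otimes> y, z * w) \<in> R) \<and>
    (\<forall>x z. (x, z) \<in> R \<longrightarrow> (inv x, inverse z) \<in> R) \<and>
    (\<forall>z. (\<one>, z) \<in> R \<longrightarrow> z = 1)"

lemma (in group) partial_char_nat_pow:
  assumes "partial_char R" "(x, z) \<in> R"
  shows "(x [^] (n::nat), z ^ n) \<in> R"
  using assms by (induction n) (simp_all add: partial_char_def power_Suc2 del: power_Suc)

lemma (in group) partial_char_int_pow:
  assumes R: "partial_char R" and xz: "(x, z) \<in> R"
  shows "(x [^] (n::int), z powi n) \<in> R"
proof (cases "n \<ge> 0")
  case True
  then obtain k where "n = int k" using nonneg_int_cases by blast
  then show ?thesis using partial_char_nat_pow[OF assms, of k] by (simp add: int_pow_int)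
next
  case False
  then obtain k where k: "n = - int k" by (metis linorder_le_cases nonpos_int_cases)
  have x: "x \<in> carrier G" using assms by (auto simp: partial_char_def)
  have "(inv (x [^] k), inverse (z ^ k)) \<in> R"
    using partial_char_nat_pow[OF assms, of k] R by (auto simp: partial_char_def)
  then show ?thesis
    using x k by (simp add: int_pow_neg int_pow_int power_int_minus)
qed

lemma cis_root:
  fixes z :: complex
  assumes "norm z = 1" "d > 0"
  obtains w where "norm w = 1" "w ^ d = z"
proof -
  have z: "z = cis (Arg z)"
    using assms(1) by (metis cis_Arg norm_zero sgn_eq zero_neq_one div_by_1 of_real_1)
  show thesis
  proof (rule that[of "cis (Arg z / d)"])
    show "cis (Arg z / d) ^ d = z"
      using assms(2) z by (simp add: Complex.DeMoivre)
  qed simp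
qed

lemma nontrivial_root_of_unity:
  assumes "d \<ge> 2"
  shows "norm (cis (2 * pi / real d)) = 1" "cis (2 * pi / real d) ^ d = 1" "cis (2 * pi / real d) \<noteq> 1"
proof -
  show "cis (2 * pi / real d) ^ d = 1"
    using assms by (simp add: Complex.DeMoivre)
  show "cis (2 * pi / real d) \<noteq> 1"
  proof
    assume "cis (2 * pi / real d) = 1"
    then have "cos (2 * pi / real d) = 1" by (simp add: complex_eq_iff)
    then obtain m :: int where "2 * pi / real d = of_int m * 2 * pi"
      using cos_one_2pi_int by blast
    then have "2 * pi * 1 = 2 * pi * (of_int m * real d)" using assms by (simp add: field_simps)
    then have "1 = of_int m * real d" using pi_neq_zero by (simp only: mult_cancel_left) simp
    then have "1 = real_of_int (m * int d)" by simp
    then have "m * int d = 1" by linarith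
    then have "int d dvd 1" by (metis dvd_triv_right)
    then show False using assms by simp
  qed
qed simp

text \<open>The circle is divisible: if \<open>d\<close> is the least positive exponent with
  \<open>b [^] d\<close> in the domain, any \<open>d\<close>-th root of the value there is a
  possible value at \<open>b\<close>. As \<open>b\<close> is outside the domain,
  \<open>d \<ge> 2\<close>, so some root differs from 1, which separation of points will use. If no
  positive power of \<open>b\<close> lies in the domain, every value is possible and -1 is
  taken.\<close>

lemma (in comm_group) partial_char_extend:
  assumes R: "partial_char R" and b: "b \<in> carrier G" "b \<notin> Domain R"
  shows "\<exists>R' w. partial_char R' \<and> R \<subseteq> R' \<and> w \<noteq> 1 \<and> (b, w) \<in> R'"
proof -
  have RD: "\<And>x z. (x, z) \<in> R \<Longrightarrow> x \<in> carrier G \<and> norm z = 1"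
    "\<And>x z y w. (x, z) \<in> R \<Longrightarrow> (y, w) \<in> R \<Longrightarrow> (x \<otimes> y, z * w) \<in> R"
    "\<And>x z. (x, z) \<in> R \<Longrightarrow> (inv x, inverse z) \<in> R" "\<And>z. (\<one>, z) \<in> R \<Longrightarrow> z = 1" "(\<one>, 1) \<in> R"
    using R by (auto simp: partial_char_def)
  have "\<exists>w. norm w = 1 \<and> w \<noteq> 1 \<and> (\<forall>n::int. \<forall>z. (b [^] n, z) \<in> R \<longrightarrow> z = w powi n)"
  proof (cases "\<exists>d::nat. d > 0 \<and> b [^] d \<in> Domain R")
    case False
    have "z = (-1) powi n" if "(b [^] n, z) \<in> R" for n :: int and z
    proof -
      have "n = 0"
      proof (rule ccontr)
        assume "n \<noteq> 0"
        show False
        proof (cases "n > 0")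
          case True
          then have "b [^] nat n \<in> Domain R" using that by (metis Domain.DomainI int_pow_int int_nat_eq order_less_imp_le)
          then show False using False True by (metis zero_less_nat_eq)
        next
          case nn: False
          have "(inv (b [^] n), inverse z) \<in> R" using RD(3) that .
          then have "(b [^] (- n), inverse z) \<in> R" using b by (simp add: int_pow_neg)
          then have "b [^] nat (- n) \<in> Domain R"
            using nn by (metis Domain.DomainI int_pow_int int_nat_eq linorder_not_less neg_0_le_iff_le)
          then show False using False nn \<open>n \<noteq> 0\<close> by (metis zero_less_nat_eq neg_0_less_iff_less linorder_neqE_linordered_idom)
        qed
      qed
      then show ?thesis using that RD(4) b by simp
    qed
    then show ?thesis by (intro exI[of _ "-1"]) auto
  next
    case True
    define d where "d = (LEAST d::nat. d > 0 \<and> b [^] d \<in> Domain R)"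
    have d: "d > 0" "b [^] d \<in> Domain R"
      using LeastI_ex[OF True] unfolding d_def by auto
    have dmin: "k = 0" if "k < d" "b [^] k \<in> Domain R" for k :: nat
      using not_less_Least[of k "\<lambda>d. d > 0 \<and> b [^] d \<in> Domain R"] that unfolding d_def by auto
    have "d \<noteq> 1" using d b by auto
    then have d2: "d \<ge> 2" using d by linarith
    obtain z0 where z0: "(b [^] d, z0) \<in> R" using d by blast
    have "\<exists>w. norm w = 1 \<and> w \<noteq> 1 \<and> w ^ d = z0"
    proof (cases "z0 = 1")
      case True
      then show ?thesis using nontrivial_root_of_unity[OF d2] by blast
    next
      case False
      obtain w where "norm w = 1" "w ^ d = z0" using cis_root[of z0 d] RD(1)[OF z0] d by blast
      then show ?thesis using False by (intro exI[of _ w]) auto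
    qed
    then obtain w where w: "norm w = 1" "w \<noteq> 1" "w ^ d = z0" by blast
    have w0: "w \<noteq> 0" using w by auto
    have "z = w powi n" if nz: "(b [^] n, z) \<in> R" for n :: int and z
    proof -
      \<comment> \<open>Dividing out the \<open>q\<close>-th power of \<open>b [^] d\<close> leaves
        a value at \<open>b [^] r\<close> with \<open>r < d\<close>; minimality of \<open>d\<close>
        gives \<open>r = 0\<close>, and then that value is 1.\<close>
      define q where "q = n div int d"
      define r where "r = n mod int d"
      have n: "n = int d * q + r" by (simp add: q_def r_def)
      have r: "0 \<le> r" "r < int d" using d by (auto simp: r_def)
      have "((b [^] d) [^] (- q), z0 powi (- q)) \<in> R"
        by (rule partial_char_int_pow[OF R z0])
      from RD(2)[OF nz this] have "(b [^] n \<otimes> (b [^] d) [^] (- q), z * z0 powi (- q)) \<in> R" .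
      moreover have "b [^] n \<otimes> (b [^] d) [^] (- q) = b [^] (n + int d * (- q))"
        using b int_pow_pow[of b "int d" "- q"] int_pow_mult[of b n "int d * (- q)"]
        by (simp only: int_pow_int)
      ultimately have *: "(b [^] r, z * z0 powi (- q)) \<in> R" by (simp add: n)
      then have "b [^] nat r \<in> Domain R" using r by (metis Domain.DomainI int_pow_int int_nat_eq)
      then have "nat r = 0" using dmin[of "nat r"] r by auto
      then have r0: "r = 0" using r by auto
      then have "z * z0 powi (- q) = 1" using * RD(4) b by simp
      then have "z = z0 powi q"
        using w0 w by (auto simp: power_int_minus field_simps)
      also have "\<dots> = w powi n"
        using n r0 w(3)[symmetric] by (simp add: power_int_mult)
      finally show ?thesis .
    qed
    then show ?thesis using w by blast
  qed
  then obtain w where w: "norm w = 1" "w \<noteq> 1" "\<And>n::int. \<And>z. (b [^] n, z) \<in> R \<Longrightarrow> z = w powi n" by blast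
  have w0: "w \<noteq> 0" using w by auto
  define R' where "R' = {(x \<otimes> b [^] n, z * w powi n) | x z n. (x, z) \<in> R \<and> n \<in> (UNIV :: int set)}"
  have "partial_char R'"
    unfolding partial_char_def
  proof (intro conjI allI impI)
    show "R' \<subseteq> carrier G \<times> {z. norm z = 1}"
      using RD(1) b w by (auto simp: R'_def norm_mult norm_power_int)
    show "(\<one>, 1) \<in> R'"
      unfolding R'_def by (rule CollectI, rule exI[of _ \<one>], rule exI[of _ 1], rule exI[of _ 0]) (use RD(5) in auto)
    fix x z assume "(x, z) \<in> R'"
    then obtain x1 z1 n where x: "x = x1 \<otimes> b [^] n" "z = z1 * w powi n" "(x1, z1) \<in> R" and "n \<in> (UNIV :: int set)"
      by (auto simp: R'_def)
    have x1: "x1 \<in> carrier G" using x RD(1) by blast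
    have "inv x = inv x1 \<otimes> b [^] (- n)"
      using x x1 b by (simp add: inv_mult_group int_pow_neg m_comm)
    moreover have "inverse z = inverse z1 * w powi (- n)"
      using x by (simp add: power_int_minus)
    ultimately show "(inv x, inverse z) \<in> R'"
      unfolding R'_def using RD(3)[OF x(3)] by blast
    fix y v assume "(y, v) \<in> R'"
    then obtain y1 v1 m where y: "y = y1 \<otimes> b [^] m" "v = v1 * w powi m" "(y1, v1) \<in> R" and "m \<in> (UNIV :: int set)"
      by (auto simp: R'_def)
    have y1: "y1 \<in> carrier G" using y RD(1) by blast
    have "x \<otimes> y = (x1 \<otimes> y1) \<otimes> b [^] (n + m)"
      using x y x1 y1 b by (simp add: int_pow_mult m_ac)
    moreover have "z * v = (z1 * v1) * w powi (n + m)"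
      using x y w0 by (simp add: power_int_add)
    ultimately show "(x \<otimes> y, z * v) \<in> R'"
      unfolding R'_def using RD(2)[OF x(3) y(3)] by blast
  next
    fix z assume "(\<one>, z) \<in> R'"
    then obtain x1 z1 n where x: "\<one> = x1 \<otimes> b [^] n" "z = z1 * w powi n" "(x1, z1) \<in> R" and "n \<in> (UNIV :: int set)"
      by (auto simp: R'_def)
    have x1: "x1 \<in> carrier G" using x RD(1) by blast
    have "x1 = b [^] (- n)"
      using x(1) x1 b by (metis int_pow_closed int_pow_neg inv_equality)
    then have "z1 = w powi (- n)" using w(3) x(3) by blast
    then show "z = 1" using x(2) w0 by (simp add: power_int_minus)
  qed
  moreover have "R \<subseteq> R'"
  proof (rule subrelI)
    fix x z assume xz: "(x, z) \<in> R"
    then have "(x, z) = (x \<otimes> b [^] (0::int), z * w powi 0)" using RD(1) by simp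
    then show "(x, z) \<in> R'" unfolding R'_def using xz by blast
  qed
  moreover have "(b, w) \<in> R'"
  proof -
    have "(b, w) = (\<one> \<otimes> b [^] (1::int), 1 * w powi 1)" using b by simp
    then show ?thesis unfolding R'_def using RD(5) by blast
  qed
  ultimately show ?thesis using w(2) by blast
qed

definition (in group) is_character :: "('a \<Rightarrow> complex) \<Rightarrow> bool"
  where "is_character \<psi> \<longleftrightarrow> (\<forall>x\<in>carrier G. norm (\<psi> x) = 1) \<and>
    (\<forall>x\<in>carrier G. \<forall>y\<in>carrier G. \<psi> (x \<otimes> y) = \<psi> x * \<psi> y)"

lemma (in group) character_diff:
  assumes "is_character \<psi>" "a \<in> carrier G" "b \<in> carrier G"
  shows "norm (\<psi> (a \<otimes> inv b) - 1) = norm (\<psi> a - \<psi> b)"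
proof -
  have nb: "norm (\<psi> b) = 1" using assms by (simp add: is_character_def)
  have "\<psi> (a \<otimes> inv b) * \<psi> b = \<psi> (a \<otimes> inv b \<otimes> b)"
    using assms by (simp add: is_character_def)
  also have "a \<otimes> inv b \<otimes> b = a" using assms by (simp add: m_assoc)
  finally have "\<psi> a - \<psi> b = (\<psi> (a \<otimes> inv b) - 1) * \<psi> b" by (simp add: algebra_simps)
  then show ?thesis using nb by (simp add: norm_mult)
qed

text \<open>The trivial character of \<open>U\<close> is extended to \<open>a\<close> with a value
  other than 1 before Zorn's lemma is applied. A maximal extension is defined everywhere, since any
  missing element could still be added.\<close>

lemma (in comm_group) character_separates:
  assumes U: "subgroup U G" and a: "a \<in> carrier G" "a \<notin> U"
  obtains \<psi> where "is_character \<psi>" "\<And>u. u \<in> U \<Longrightarrow> \<psi> u = 1" "\<psi> a \<noteq> 1"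
proof -
  have UG: "\<And>u. u \<in> U \<Longrightarrow> u \<in> carrier G" using subgroup.mem_carrier[OF U] .
  have "partial_char (U \<times> {1})"
    using UG subgroup.m_closed[OF U] subgroup.m_inv_closed[OF U] subgroup.one_closed[OF U]
    by (auto simp: partial_char_def)
  from partial_char_extend[OF this a(1)] a(2)
  obtain R1 w where R1: "partial_char R1" "U \<times> {1} \<subseteq> R1" "w \<noteq> 1" "(a, w) \<in> R1" by auto
  let ?A = "{R. partial_char R \<and> R1 \<subseteq> R}"
  have "\<exists>M\<in>?A. \<forall>X\<in>?A. M \<subseteq> X \<longrightarrow> X = M"
  proof (rule subset_Zorn_nonempty)
    show "?A \<noteq> {}" using R1 by blast
    fix \<C> assume ne: "\<C> \<noteq> {}" and ch: "subset.chain ?A \<C>"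
    have C: "\<And>R. R \<in> \<C> \<Longrightarrow> partial_char R \<and> R1 \<subseteq> R" "\<And>R S. R \<in> \<C> \<Longrightarrow> S \<in> \<C> \<Longrightarrow> R \<subseteq> S \<or> S \<subseteq> R"
      using ch by (auto simp: subset_chain_def)
    have "partial_char (\<Union>\<C>)"
      unfolding partial_char_def
    proof (intro conjI allI impI)
      show "\<Union>\<C> \<subseteq> carrier G \<times> {z. norm z = 1}"
        using C(1) unfolding partial_char_def by blast
      show "(\<one>, 1) \<in> \<Union>\<C>"
        using C(1) ne by (auto simp: partial_char_def)
      fix x z assume xz: "(x, z) \<in> \<Union>\<C>"
      then obtain R where "R \<in> \<C>" "(x, z) \<in> R" by blast
      with C(1)[of R] show "(inv x, inverse z) \<in> \<Union>\<C>"
        by (auto simp: partial_char_def intro!: bexI[of _ R])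
      fix y v assume yv: "(y, v) \<in> \<Union>\<C>"
      obtain R S where RS: "R \<in> \<C>" "S \<in> \<C>" "(x, z) \<in> R" "(y, v) \<in> S" using xz yv by blast
      then obtain Q where Q: "Q \<in> \<C>" "(x, z) \<in> Q" "(y, v) \<in> Q" using C(2)[of R S] by blast
      then have "(x \<otimes> y, z * v) \<in> Q" using C(1)[of Q] unfolding partial_char_def by simp
      then show "(x \<otimes> y, z * v) \<in> \<Union>\<C>" using Q by blast
    next
      fix z assume "(\<one>, z) \<in> \<Union>\<C>"
      then obtain R where "R \<in> \<C>" "(\<one>, z) \<in> R" by blast
      with C(1)[of R] show "z = 1" by (simp add: partial_char_def)
    qed
    moreover have "R1 \<subseteq> \<Union>\<C>" using C(1) ne by fast
    ultimately show "\<Union>\<C> \<in> ?A" by simp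
  qed
  then obtain M where "M \<in> ?A" and max: "\<forall>X\<in>?A. M \<subseteq> X \<longrightarrow> X = M" ..
  then have M: "partial_char M" "R1 \<subseteq> M" by simp_all
  have dom: "x \<in> Domain M" if "x \<in> carrier G" for x
  proof (rule ccontr)
    assume "x \<notin> Domain M"
    from partial_char_extend[OF M(1) that this] obtain R' v where R': "partial_char R'" "M \<subseteq> R'" "(x, v) \<in> R'"
      by auto
    then have "R' = M" using max M(2) by simp
    with R'(3) \<open>x \<notin> Domain M\<close> show False by (simp add: Domain.DomainI)
  qed
  have unique: "z = v" if xz: "(x, z) \<in> M" "(x, v) \<in> M" for x z v
  proof -
    have x: "x \<in> carrier G" "norm v = 1" using M(1) xz unfolding partial_char_def by auto
    have "(inv x, inverse v) \<in> M" using M(1) xz(2) unfolding partial_char_def by simp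
    then have "(x \<otimes> inv x, z * inverse v) \<in> M" using M(1) xz(1) unfolding partial_char_def by simp
    then have "z * inverse v = 1" using M(1) x unfolding partial_char_def by simp
    then show ?thesis by (metis inverse_unique mult.commute inverse_inverse_eq)
  qed
  define \<psi> where "\<psi> = (\<lambda>x. THE z. (x, z) \<in> M)"
  have chi: "\<psi> x = z" if "(x, z) \<in> M" for x z
    unfolding \<psi>_def using that unique by blast
  show thesis
  proof (rule that)
    show "is_character \<psi>"
      unfolding is_character_def
    proof (intro conjI ballI)
      fix x assume x: "x \<in> carrier G"
      then obtain z where z: "(x, z) \<in> M" using dom by blast
      then show "norm (\<psi> x) = 1" using chi[OF z] M(1) unfolding partial_char_def by auto
      fix y assume y: "y \<in> carrier G"
      then obtain v where v: "(y, v) \<in> M" using dom by blast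
      then have "(x \<otimes> y, z * v) \<in> M" using z M(1) unfolding partial_char_def by simp
      then show "\<psi> (x \<otimes> y) = \<psi> x * \<psi> y" using chi z v by simp
    qed
    show "\<psi> u = 1" if "u \<in> U" for u using chi[of u 1] R1 M that by blast
    show "\<psi> a \<noteq> 1" using chi[of a w] R1 M by blast
  qed
qed

lemma (in group) countable_generate:
  assumes "countable S" and S: "S \<subseteq> carrier G"
  shows "countable (generate G S)"
proof -
  define f where "f = (\<lambda>l :: ('a \<times> bool) list. foldr (\<lambda>p r. (if snd p then fst p else inv (fst p)) \<otimes> r) l \<one>)"
  \<comment> \<open>Intersecting with the carrier hands the induction over \<open>generate\<close>
    the membership of the generators in the group, which the evaluation of words relies on.\<close>
  have S1: "x \<in> f ` lists ((S \<inter> carrier G) \<times> UNIV) \<and> x \<in> carrier G" if "x \<in> generate G (S \<inter> carrier G)" for x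
    using that
  proof (induction rule: generate.induct)
    case one
    have "f [] = \<one>" by (simp add: f_def)
    then show ?case by (intro conjI image_eqI[of _ _ "[]"]) auto
  next
    case (incl h)
    then have "f [(h, True)] = h" by (simp add: f_def)
    then show ?case using incl by (intro conjI image_eqI[of _ _ "[(h, True)]"]) auto
  next
    case (inv h)
    then have "f [(h, False)] = inv h" by (simp add: f_def)
    then show ?case using inv by (intro conjI image_eqI[of _ _ "[(h, False)]"]) auto
  next
    case (eng h1 h2)
    then obtain l1 l2 where l: "h1 = f l1" "h2 = f l2" "l1 \<in> lists ((S \<inter> carrier G) \<times> UNIV)" "l2 \<in> lists ((S \<inter> carrier G) \<times> UNIV)"
      by blast
    have fc: "f l \<in> carrier G" if "l \<in> lists ((S \<inter> carrier G) \<times> UNIV)" for l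
      using that by (induction l) (auto simp: f_def)
    have "f (l @ l2) = f l \<otimes> f l2" if "l \<in> lists ((S \<inter> carrier G) \<times> UNIV)" for l
      using that
    proof (induction l)
      case Nil
      then show ?case using fc[OF l(4)] by (simp add: f_def)
    next
      case (Cons p l)
      then have "f l \<in> carrier G" "fst p \<in> carrier G" using fc by auto
      moreover have "f ((p # l) @ l2) = (if snd p then fst p else inv (fst p)) \<otimes> f (l @ l2)"
        "f (p # l) = (if snd p then fst p else inv (fst p)) \<otimes> f l" by (simp_all add: f_def)
      ultimately show ?case using Cons fc[OF l(4)] by (auto simp: m_assoc)
    qed
    then have "h1 \<otimes> h2 = f (l1 @ l2)" using l by simp
    moreover have "h1 \<otimes> h2 \<in> carrier G" using eng by blast
    ultimately show ?case using l by (intro conjI image_eqI[of _ _ "l1 @ l2"]) auto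
  qed
  have "generate G S \<subseteq> f ` lists (S \<times> UNIV)"
    using S1 S by (auto simp: inf.absorb1)
  moreover have "countable (f ` lists (S \<times> UNIV))" using assms by auto
  ultimately show ?thesis by (rule countable_subset)
qed

section \<open>Locally compact abelian groups with linear topologies\<close>

locale hm_comm_group = hm_group G T + comm_group G for G (structure) and T
begin

lemma pow_mult: "a \<in> carrier G \<Longrightarrow> b \<in> carrier G \<Longrightarrow> (a \<otimes> b) [^] (n::nat) = a [^] n \<otimes> b [^] n"
  by (rule nat_pow_distrib)

text \<open>If \<open>H \<inter> L\<close> is trivial then \<open>H\<close> also carries the coarser topology of the quotient by \<open>L\<close>.\<close>

lemma essential:
  assumes H: "subgroup H G" and L: "subgroup L G" "closedin T L" "L \<subseteq> T closure_of H"
    and triv: "H \<inter> L \<subseteq> {\<one>}"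
  shows "L = {\<one>}"
proof -
  have HG: "\<And>x. x \<in> H \<Longrightarrow> x \<in> carrier G" and LG: "\<And>x. x \<in> L \<Longrightarrow> x \<in> carrier G"
    using subgroup.mem_carrier H L by fast+
  have oneL: "\<one> \<in> L" using subgroup.one_closed[OF L(1)] .
  define N where "N = (\<lambda>U. {h \<in> H. \<exists>u\<in>U. \<exists>l\<in>L. h = u \<otimes> l})"
  note LH = subgroup.m_closed[OF L(1)] subgroup.m_inv_closed[OF L(1)] subgroup.m_closed[OF H] subgroup.m_inv_closed[OF H]
  have base: "\<exists>W. openin T W \<and> \<one> \<in> W \<and> N W \<subseteq> U" if U: "openin T U" "\<one> \<in> U" for U
  proof (rule minimal_nbhd_family[OF H _ _ _ _ _ _ U, where N = N])
    show "a \<otimes> b = b \<otimes> a" if "a \<in> H" "b \<in> H" for a b using that HG by (simp add: m_comm)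
    show "N U \<subseteq> H" "U \<subseteq> V \<Longrightarrow> N U \<subseteq> N V" for U V by (auto simp: N_def)
    show "\<exists>W. openin T W \<and> \<one> \<in> W \<and> W \<inter> H \<subseteq> N U" if U: "openin T U" "\<one> \<in> U" for U
    proof (intro exI conjI subsetI)
      fix h assume "h \<in> U \<inter> H"
      moreover from this have "h = h \<otimes> \<one>" using HG by simp
      ultimately show "h \<in> N U" unfolding N_def using oneL by blast
    qed (rule U)+
    fix U W a b assume W: "W \<subseteq> carrier G" "\<And>x y. x \<in> W \<Longrightarrow> y \<in> W \<Longrightarrow> x \<otimes> inv y \<in> U" and ab: "a \<in> N W" "b \<in> N W"
    obtain u l where a: "a \<in> H" "u \<in> W" "l \<in> L" "a = u \<otimes> l" using ab unfolding N_def by blast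
    obtain v m where b: "b \<in> H" "v \<in> W" "m \<in> L" "b = v \<otimes> m" using ab unfolding N_def by blast
    have c: "u \<in> carrier G" "v \<in> carrier G" "l \<in> carrier G" "m \<in> carrier G" using a b LG W(1) by auto
    have "a \<otimes> inv b = (u \<otimes> inv v) \<otimes> (l \<otimes> inv m)" using c a b by (simp add: inv_mult m_ac)
    moreover have "u \<otimes> inv v \<in> U" "l \<otimes> inv m \<in> L" "a \<otimes> inv b \<in> H" using W(2) a b LH by simp_all
    ultimately show "a \<otimes> inv b \<in> N U" unfolding N_def by blast
  next
    fix h assume h: "h \<in> H" "h \<noteq> \<one>"
    then have hL: "h \<notin> L" "h \<in> carrier G" using triv HG by auto
    obtain U where U: "openin T U" "\<one> \<in> U" "\<And>u. u \<in> U \<Longrightarrow> h \<otimes> u \<notin> L"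
      using closedD[OF L(2) hL(2,1)] by blast
    define W where "W = {u \<in> carrier G. inv u \<in> U}"
    have W: "openin T W" "\<one> \<in> W" unfolding W_def using U by (auto intro!: open_vimage cont_intros)
    have "h \<notin> N W"
    proof
      assume "h \<in> N W"
      then obtain u l where a: "u \<in> W" "l \<in> L" "h = u \<otimes> l" unfolding N_def by blast
      then have "h \<otimes> inv u = l" using LG[OF a(2)] by (simp add: W_def m_ac)
      then show False using U(3)[of "inv u"] a by (simp add: W_def)
    qed
    then show "\<exists>U. openin T U \<and> \<one> \<in> U \<and> h \<notin> N U" using W by blast
  qed blast
  \<comment> \<open>By density some \<open>l \<otimes> u\<close> with \<open>u\<close> small lies in
    \<open>H\<close>. Modulo \<open>L\<close> it equals \<open>u\<close>, so it is small in the
    quotient topology and hence in the given one; then \<open>l\<close> is small too.\<close>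
  have "l = \<one>" if l: "l \<in> L" for l
  proof (rule ccontr)
    assume "l \<noteq> \<one>"
    then obtain U where U: "openin T U" "\<one> \<in> U" "\<And>a b. a \<in> U \<Longrightarrow> b \<in> U \<Longrightarrow> a \<otimes> inv b \<noteq> l"
      using separate_nbhd[OF LG[OF l]] by metis
    obtain W where W: "openin T W" "\<one> \<in> W" "N W \<subseteq> U" using base[OF U(1,2)] by blast
    have "openin T (W \<inter> U)" "\<one> \<in> W \<inter> U" using W U by auto
    then obtain u where u: "u \<in> W \<inter> U" "l \<otimes> u \<in> H"
      using L(3) l in_closure_iff by blast
    have uc: "u \<in> carrier G" using u open_carrier[OF U(1)] by auto
    have "l \<otimes> u = u \<otimes> l" using uc LG[OF l] by (simp add: m_comm)
    then have "l \<otimes> u \<in> N W" using u l unfolding N_def by auto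
    then have "l \<otimes> u \<in> U" using W by blast
    moreover have "(l \<otimes> u) \<otimes> inv u = l" using uc LG[OF l] by (simp add: m_assoc)
    ultimately show False using U(3)[of "l \<otimes> u" u] u by auto
  qed
  then show ?thesis using oneL by blast
qed

text \<open>The topology pulled back along the injective \<open>n\<close>-th power map is Hausdorff,
  and coarser because the map is continuous. By minimality it is the original one, so elements of
  \<open>H\<close> with small \<open>n\<close>-th power are small.\<close>

lemma pow_embedding:
  assumes H: "subgroup H G" and inj: "\<And>h. h \<in> H \<Longrightarrow> h [^] (n::nat) = \<one> \<Longrightarrow> h = \<one>"
    and U: "openin T U" "\<one> \<in> U"
  shows "\<exists>W. openin T W \<and> \<one> \<in> W \<and> (\<forall>h\<in>H. h [^] n \<in> W \<longrightarrow> h \<in> U)"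
proof -
  have HG: "\<And>x. x \<in> H \<Longrightarrow> x \<in> carrier G" using subgroup.mem_carrier[OF H] .
  define N where "N = (\<lambda>W. {h \<in> H. h [^] n \<in> W})"
  obtain W where "openin T W" "\<one> \<in> W" "N W \<subseteq> U"
  proof (rule minimal_nbhd_family[OF H _ _ _ _ _ _ U, where N = N])
    show "a \<otimes> b = b \<otimes> a" if "a \<in> H" "b \<in> H" for a b using that HG by (simp add: m_comm)
    show "N U \<subseteq> H" "U \<subseteq> V \<Longrightarrow> N U \<subseteq> N V" for U V by (auto simp: N_def)
    show "\<exists>W. openin T W \<and> \<one> \<in> W \<and> W \<inter> H \<subseteq> N U" if U: "openin T U" "\<one> \<in> U" for U
    proof (intro exI conjI)
      show "openin T {x \<in> carrier G. x [^] n \<in> U}" by (rule open_vimage[OF U(1)]) (intro cont_intros)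
    qed (use U in \<open>auto simp: N_def\<close>)
    show "a \<otimes> inv b \<in> N U"
      if "\<And>x y. x \<in> W \<Longrightarrow> y \<in> W \<Longrightarrow> x \<otimes> inv y \<in> U" "a \<in> N W" "b \<in> N W" for U W a b
      using that HG subgroup.m_closed[OF H] subgroup.m_inv_closed[OF H]
      by (auto simp: N_def pow_mult nat_pow_inv)
    show "\<exists>U. openin T U \<and> \<one> \<in> U \<and> h \<notin> N U" if h: "h \<in> H" "h \<noteq> \<one>" for h
    proof -
      have "h [^] n \<in> carrier G" "h [^] n \<noteq> \<one>" using inj h HG by auto
      then obtain W where W: "openin T W" "\<one> \<in> W" "h [^] n \<notin> W" by (rule separate_nbhd)
      then show ?thesis by (intro exI[of _ W]) (simp add: N_def)
    qed
  qed
  then show ?thesis unfolding N_def by blast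
qed

end

locale hm_lca_group = hm_comm_group +
  assumes lc: "locally_compact_space T"

lemma (in hm_group) sub_hm_lca_group:
  assumes H: "subgroup H G" and comm: "\<And>a b. a \<in> H \<Longrightarrow> b \<in> H \<Longrightarrow> a \<otimes> b = b \<otimes> a"
    and cl: "closedin T H" and lc: "locally_compact_space T"
  shows "hm_lca_group (G\<lparr>carrier := H\<rparr>) (subtopology T H)"
proof -
  interpret H: hm_group "G\<lparr>carrier := H\<rparr>" "subtopology T H" by (rule sub_hm_group[OF H])
  have "comm_group (G\<lparr>carrier := H\<rparr>)"
    by (rule H.group_comm_groupI) (use comm in simp)
  then show ?thesis
    using locally_compact_space_closed_subset[OF lc cl]
    by (simp add: hm_lca_group_def hm_lca_group_axioms_def hm_comm_group_def H.hm_group_axioms)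
qed

context hm_lca_group
begin

lemma compact_nbhd:
  obtains U K where "openin T U" "\<one> \<in> U" "U \<subseteq> K" "compactin T K"
  using lc unfolding locally_compact_space_def by (metis one_closed topspace_eq)

text \<open>Characters with open kernel separate points, because every nontrivial point is missed by
  an open subgroup. The topology they induce is coarser, hence equal to the given one, and it is
  precompact since finitely many characters take values in a compact torus.\<close>

lemma linear_imp_precompact:
  assumes lin: "\<And>U. openin T U \<Longrightarrow> \<one> \<in> U \<Longrightarrow> \<exists>O'. subgroup O' G \<and> openin T O' \<and> O' \<subseteq> U"
    and U: "openin T U" "\<one> \<in> U"
  shows "\<exists>E. finite E \<and> E \<subseteq> carrier G \<and> (\<forall>a\<in>carrier G. \<exists>e\<in>E. inv e \<otimes> a \<in> U)"
proof -
  define X where "X = {\<psi>. is_character \<psi> \<and> (\<exists>O'. openin T O' \<and> \<one> \<in> O' \<and> (\<forall>u\<in>O'. \<psi> u = 1))}"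
  define N where "N = (\<lambda>(F :: ('a \<Rightarrow> complex) set) e. {a \<in> carrier G. \<forall>\<psi>\<in>F. norm (\<psi> a - 1) < (e::real)})"
  define \<B> where "\<B> = {N F e | F e. finite F \<and> F \<subseteq> X \<and> e > 0}"
  have NB: "N F e \<in> \<B>" if "finite F" "F \<subseteq> X" "e > 0" for F e
    unfolding \<B>_def using that by blast
  have ker: "\<exists>O'. openin T O' \<and> \<one> \<in> O' \<and> (\<forall>\<psi>\<in>F. \<forall>u\<in>O'. \<psi> u = 1)" if "finite F" "F \<subseteq> X" for F
    using that
  proof (induction F)
    case empty
    show ?case using openin_topspace[of T] by (intro exI[of _ "carrier G"]) auto
  next
    case (insert c F)
    then obtain O1 where O1: "openin T O1" "\<one> \<in> O1" "\<forall>\<psi>\<in>F. \<forall>u\<in>O1. \<psi> u = 1" by auto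
    obtain O2 where O2: "openin T O2" "\<one> \<in> O2" "\<forall>u\<in>O2. c u = 1" using insert unfolding X_def by blast
    show ?case by (intro exI[of _ "O1 \<inter> O2"]) (use O1 O2 in auto)
  qed
  have ch: "is_character \<psi>" if "\<psi> \<in> X" for \<psi> using that by (simp add: X_def)
  have "\<exists>V\<in>\<B>. V \<subseteq> U"
  proof (rule minimal_filter_base[OF subgroup_self _ _ _ _ _ _ _ U])
    show "a \<otimes> b = b \<otimes> a" if "a \<in> carrier G" "b \<in> carrier G" for a b using that by (simp add: m_comm)
    show "\<B> \<noteq> {}" unfolding \<B>_def using zero_less_one by blast
    show "V \<subseteq> carrier G" if "V \<in> \<B>" for V using that by (auto simp: \<B>_def N_def)
    show "\<exists>U. openin T U \<and> \<one> \<in> U \<and> U \<inter> carrier G \<subseteq> V" if V: "V \<in> \<B>" for V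
    proof -
      obtain F e where V: "V = N F e" "finite F" "F \<subseteq> X" "e > 0" using V unfolding \<B>_def by blast
      obtain O' where O': "openin T O'" "\<one> \<in> O'" "\<forall>\<psi>\<in>F. \<forall>u\<in>O'. \<psi> u = 1" using ker[OF V(2,3)] by blast
      then have "O' \<inter> carrier G \<subseteq> V" unfolding V(1) N_def using V(4) by auto
      then show ?thesis using O' by blast
    qed
    show "\<exists>Y\<in>\<B>. Y \<subseteq> V \<inter> W" if VW: "V \<in> \<B>" "W \<in> \<B>" for V W
    proof -
      obtain F e where V: "V = N F e" "finite F" "F \<subseteq> X" "e > 0" using VW unfolding \<B>_def by blast
      obtain F' e' where W: "W = N F' e'" "finite F'" "F' \<subseteq> X" "e' > 0" using VW unfolding \<B>_def by blast
      have "N (F \<union> F') (min e e') \<in> \<B>" by (rule NB) (use V W in auto)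
      moreover have "N (F \<union> F') (min e e') \<subseteq> V \<inter> W" unfolding V W N_def by auto
      ultimately show ?thesis by blast
    qed
    show "\<exists>W\<in>\<B>. \<forall>a\<in>W. \<forall>b\<in>W. a \<otimes> inv b \<in> V" if V: "V \<in> \<B>" for V
    proof -
      obtain F e where V: "V = N F e" "finite F" "F \<subseteq> X" "e > 0" using V unfolding \<B>_def by blast
      have "a \<otimes> inv b \<in> V" if ab: "a \<in> N F (e/2)" "b \<in> N F (e/2)" for a b
      proof -
        have c: "a \<in> carrier G" "b \<in> carrier G" using ab by (auto simp: N_def)
        have "norm (\<psi> (a \<otimes> inv b) - 1) < e" if p: "\<psi> \<in> F" for \<psi>
        proof -
          have "norm (\<psi> (a \<otimes> inv b) - 1) = norm (\<psi> a - \<psi> b)"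
            using character_diff c ch p V by blast
          also have "\<dots> = norm ((\<psi> a - 1) - (\<psi> b - 1))" by simp
          also have "\<dots> \<le> norm (\<psi> a - 1) + norm (\<psi> b - 1)" by (rule norm_triangle_ineq4)
          also have "\<dots> < e / 2 + e / 2" using ab p unfolding N_def by (intro add_strict_mono) auto
          finally show ?thesis by simp
        qed
        then show ?thesis unfolding V N_def using c by simp
      qed
      moreover have "N F (e/2) \<in> \<B>" by (rule NB) (use V in auto)
      ultimately show ?thesis by blast
    qed
    show "\<exists>V\<in>\<B>. h \<notin> V" if h: "h \<in> carrier G" "h \<noteq> \<one>" for h
    proof -
      obtain U where U: "openin T U" "\<one> \<in> U" "h \<notin> U" using separate_nbhd[OF h] by metis
      obtain O' where O': "subgroup O' G" "openin T O'" "O' \<subseteq> U" using lin[OF U(1,2)] by blast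
      obtain \<psi> where p: "is_character \<psi>" "\<And>u. u \<in> O' \<Longrightarrow> \<psi> u = 1" "\<psi> h \<noteq> 1"
        using character_separates[OF O'(1) h(1)] O'(3) U(3) by blast
      have "\<psi> \<in> X" unfolding X_def using p O' subgroup.one_closed[OF O'(1)] by blast
      then have "N {\<psi>} (norm (\<psi> h - 1)) \<in> \<B>" by (intro NB) (use p in auto)
      moreover have "h \<notin> N {\<psi>} (norm (\<psi> h - 1))" unfolding N_def by simp
      ultimately show ?thesis by blast
    qed
  qed
  then obtain F \<epsilon> where V: "N F \<epsilon> \<subseteq> U" "finite F" "F \<subseteq> X" "\<epsilon> > 0"
    unfolding \<B>_def N_def by blast
  define d where "d = \<epsilon> / 2"
  have d: "d > 0" using V by (simp add: d_def)
  \<comment> \<open>The values of the finitely many characters are sorted into squares of side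
    \<open>\<epsilon> / 2\<close>. Values in the same square differ by less than
    \<open>\<epsilon>\<close>, and \<open>M\<close> bounds the indices of the squares that meet the
    unit circle.\<close>
  define \<phi> where "\<phi> = (\<lambda>a. \<lambda>\<psi>\<in>F. (\<lfloor>Re (\<psi> a) / d\<rfloor>, \<lfloor>Im (\<psi> a) / d\<rfloor>))"
  define M where "M = \<lceil>1 / d\<rceil> + 1"
  have bd: "\<lfloor>t / d\<rfloor> \<in> {-M..M}" if t: "\<bar>t\<bar> \<le> 1" for t
  proof -
    have "t / d \<le> 1 / d" "-(1 / d) \<le> t / d" using t d by (auto simp: field_simps abs_le_iff)
    then show ?thesis unfolding M_def by (simp; linarith)
  qed
  have "\<phi> ` carrier G \<subseteq> F \<rightarrow>\<^sub>E ({-M..M} \<times> {-M..M})"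
  proof
    fix f assume "f \<in> \<phi> ` carrier G"
    then obtain a where a: "a \<in> carrier G" "f = \<phi> a" by blast
    have "(\<lfloor>Re (\<psi> a) / d\<rfloor>, \<lfloor>Im (\<psi> a) / d\<rfloor>) \<in> {-M..M} \<times> {-M..M}" if p: "\<psi> \<in> F" for \<psi>
    proof -
      have "norm (\<psi> a) = 1" using ch p V a unfolding is_character_def by blast
      then have "\<bar>Re (\<psi> a)\<bar> \<le> 1" "\<bar>Im (\<psi> a)\<bar> \<le> 1"
        using abs_Re_le_cmod[of "\<psi> a"] abs_Im_le_cmod[of "\<psi> a"] by auto
      then show ?thesis using bd by blast
    qed
    then show "f \<in> F \<rightarrow>\<^sub>E ({-M..M} \<times> {-M..M})" unfolding a \<phi>_def by auto
  qed
  then have fin: "finite (\<phi> ` carrier G)"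
    using V(2) by (meson finite_PiE finite_SigmaI finite_atLeastAtMost_int finite_subset)
  have fl: "\<bar>s - t\<bar> < d" if "\<lfloor>s / d\<rfloor> = \<lfloor>t / d\<rfloor>" for s t
  proof -
    have "\<bar>s / d - t / d\<bar> < 1" using that by linarith
    then show ?thesis using d by (simp add: field_simps abs_less_iff)
  qed
  obtain E where E: "finite E" "E \<subseteq> carrier G" "\<And>a. a \<in> carrier G \<Longrightarrow> \<exists>e\<in>E. \<phi> e = \<phi> a"
    using finite_image_representatives[OF fin] by blast
  have "inv e \<otimes> a \<in> U" if ae: "a \<in> carrier G" "e \<in> carrier G" "\<phi> e = \<phi> a" for a e
  proof -
    have "norm (\<psi> (a \<otimes> inv e) - 1) < \<epsilon>" if p: "\<psi> \<in> F" for \<psi>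
    proof -
      have "\<phi> e \<psi> = \<phi> a \<psi>" using ae by simp
      then have "\<bar>Re (\<psi> a) - Re (\<psi> e)\<bar> < d" "\<bar>Im (\<psi> a) - Im (\<psi> e)\<bar> < d"
        using p fl unfolding \<phi>_def by auto
      then have "norm (\<psi> a - \<psi> e) < \<epsilon>"
        using cmod_le[of "\<psi> a - \<psi> e"] unfolding d_def by simp
      then show ?thesis using character_diff[of \<psi> a e] ch p V ae by auto
    qed
    then have "a \<otimes> inv e \<in> N F \<epsilon>" unfolding N_def using ae by simp
    then show ?thesis using V ae by (auto simp: m_comm)
  qed
  then show ?thesis using E by (metis subsetD)
qed

lemma linear_imp_compact:
  assumes "\<And>U. openin T U \<Longrightarrow> \<one> \<in> U \<Longrightarrow> \<exists>O'. subgroup O' G \<and> openin T O' \<and> O' \<subseteq> U"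
  shows "compact_space T"
proof -
  obtain U K where UK: "openin T U" "\<one> \<in> U" "U \<subseteq> K" "compactin T K" using compact_nbhd by blast
  obtain E where E: "finite E" "E \<subseteq> carrier G" "\<forall>a\<in>carrier G. \<exists>e\<in>E. inv e \<otimes> a \<in> U"
    using linear_imp_precompact[OF assms UK(1,2)] by blast
  then show ?thesis using compact_of_translates[OF UK(4) E(1,2)] UK(3) by blast
qed

text \<open>The trivial subgroup is open, so the topology is linear and therefore compact.\<close>

lemma discrete_imp_finite:
  assumes "openin T {\<one>}"
  shows "finite (carrier G)"
proof -
  have "compact_space T"
    by (rule linear_imp_compact) (use assms in \<open>auto intro!: exI[of _ "{\<one>}"] simp: triv_subgroup\<close>)
  moreover have "openin T {x}" if x: "x \<in> carrier G" for x
  proof -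
    have "{y \<in> carrier G. inv x \<otimes> y \<in> {\<one>}} = {x}"
      using x by (auto simp: inv_mult_eq_one_iff)
    then show ?thesis using open_translate[OF assms x] by simp
  qed
  then have "discrete_topology (carrier G) = T" by (simp add: discrete_topology_unique)
  ultimately show ?thesis using compact_space_discrete_topology by metis
qed

text \<open>By Baire's theorem one of the countably many points is open, and translation makes the
  topology discrete.\<close>

lemma countable_imp_finite:
  assumes "countable (carrier G)"
  shows "finite (carrier G)"
proof -
  have "regular_space T"
    using lc Hausdorff locally_compact_Hausdorff_imp_regular_space by blast
  have "\<exists>x\<in>carrier G. T interior_of {x} \<noteq> {}"
  proof (rule ccontr)
    assume "\<not> ?thesis"
    then have "T interior_of \<Union>((\<lambda>x. {x}) ` carrier G) = {}"
      using assms lc \<open>regular_space T\<close> closedin_Hausdorff_singleton[OF Hausdorff]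
      by (intro Baire_category_alt) auto
    then have "T interior_of topspace T = {}" by simp
    then show False by (metis interior_of_topspace one_closed empty_iff topspace_eq)
  qed
  then obtain x where x: "x \<in> carrier G" "T interior_of {x} \<noteq> {}" by blast
  then have "T interior_of {x} = {x}" using interior_of_subset[of T "{x}"] by blast
  then have "openin T {x}" by (metis openin_interior_of)
  from open_translate[OF this, of "inv x"] x have "openin T {y \<in> carrier G. x \<otimes> y = x}" by simp
  moreover have "{y \<in> carrier G. x \<otimes> y = x} = {\<one>}" using x by auto
  ultimately show ?thesis using discrete_imp_finite by simp
qed

end

section \<open>Cyclic subgroups and torsion\<close>

context group
begin

definition inf_order :: "'a \<Rightarrow> bool"
  where "inf_order x \<longleftrightarrow> x \<in> carrier G \<and> (\<forall>n>0. x [^] (n::nat) \<noteq> \<one>)"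

lemma in_generate_iff:
  "x \<in> carrier G \<Longrightarrow> y \<in> generate G {x} \<longleftrightarrow> (\<exists>k::int. y = x [^] k)"
  by (auto simp: generate_pow)

lemma cyclic_subgroup: "x \<in> carrier G \<Longrightarrow> subgroup (generate G {x}) G"
  by (rule generate_is_subgroup) simp

lemma subgroup_nat_pow_closed: "subgroup H G \<Longrightarrow> x \<in> H \<Longrightarrow> x [^] (n::nat) \<in> H"
  using subgroup_int_pow_closed[of H x "int n"] by (simp add: int_pow_int)

lemma nat_abs_pow_cases:
  assumes "x \<in> carrier G"
  shows "x [^] nat \<bar>k\<bar> = x [^] (k::int) \<or> x [^] nat \<bar>k\<bar> = inv (x [^] k)"
proof (cases "k \<ge> 0")
  case True
  then have "x [^] int (nat \<bar>k\<bar>) = x [^] k" by simp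
  then show ?thesis unfolding int_pow_int ..
next
  case False
  then have "x [^] int (nat \<bar>k\<bar>) = inv (x [^] k)" using assms by (simp add: int_pow_neg)
  then show ?thesis unfolding int_pow_int ..
qed

lemma nat_pow_abs_in_subgroup:
  assumes "subgroup H G" "x \<in> carrier G" "x [^] (k::int) \<in> H"
  shows "x [^] nat \<bar>k\<bar> \<in> H"
  using nat_abs_pow_cases[OF assms(2), of k] assms(3) subgroup.m_inv_closed[OF assms(1,3)] by auto

lemma inf_order_int_pow:
  assumes "inf_order x" "x [^] (k::int) = \<one>"
  shows "k = 0"
proof (rule ccontr)
  assume "k \<noteq> 0"
  have "x [^] nat \<bar>k\<bar> \<in> {\<one>}"
    by (rule nat_pow_abs_in_subgroup[OF triv_subgroup]) (use assms in \<open>auto simp: inf_order_def\<close>)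
  moreover have "nat \<bar>k\<bar> > 0" using \<open>k \<noteq> 0\<close> by simp
  ultimately show False using assms(1) unfolding inf_order_def by blast
qed

lemma inf_order_inj:
  assumes "inf_order x"
  shows "inj (\<lambda>k::int. x [^] k)"
proof (rule injI)
  fix i j :: int assume *: "x [^] i = x [^] j"
  have x: "x \<in> carrier G" using assms by (simp add: inf_order_def)
  have "x [^] (i - j) = x [^] i \<otimes> inv (x [^] j)"
    using x by (simp add: int_pow_diff)
  then have "x [^] (i - j) = \<one>" using * x by simp
  then show "i = j" using inf_order_int_pow[OF assms] by fastforce
qed

lemma inf_order_infinite_generate:
  assumes "inf_order x" shows "infinite (generate G {x})"
proof
  assume fin: "finite (generate G {x})"
  have "range (\<lambda>k::int. x [^] k) \<subseteq> generate G {x}"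
    using assms in_generate_iff by (auto simp: inf_order_def)
  then show False
    using fin inf_order_inj[OF assms] by (meson finite_imageD finite_subset infinite_UNIV_int)
qed

end

context hausdorff_group
begin

definition cyclic_closure :: "'a \<Rightarrow> 'a set"
  where "cyclic_closure x = T closure_of (generate G {x})"

lemma generate_subset_cyclic_closure: "x \<in> carrier G \<Longrightarrow> generate G {x} \<subseteq> cyclic_closure x"
  unfolding cyclic_closure_def by (simp add: closure_of_subset generate_incl)

lemma in_cyclic_closure: "x \<in> carrier G \<Longrightarrow> x \<in> cyclic_closure x"
  using generate_subset_cyclic_closure generate.incl[of x "{x}" G] by blast

lemma cyclic_closure_subgroup: "x \<in> carrier G \<Longrightarrow> subgroup (cyclic_closure x) G"
  unfolding cyclic_closure_def by (intro closure_subgroup cyclic_subgroup)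

lemma cyclic_closure_closed: "closedin T (cyclic_closure x)"
  by (simp add: cyclic_closure_def)

lemma cyclic_closure_minimal:
  "subgroup L G \<Longrightarrow> closedin T L \<Longrightarrow> x \<in> L \<Longrightarrow> cyclic_closure x \<subseteq> L"
  unfolding cyclic_closure_def by (intro closure_minimal generate_subgroup_incl) auto

end

section \<open>Torsion in closures of subgroups\<close>

context hm_comm_group
begin

text \<open>If \<open>y [^] n = \<one>\<close>, an approximation \<open>y \<otimes> u\<close> of
  \<open>y\<close> inside \<open>H\<close> has the small \<open>n\<close>-th power
  \<open>u [^] n\<close>. By \<open>pow_embedding\<close> it is small itself, and so is
  \<open>y\<close>.\<close>

lemma closure_torsion_free:
  assumes H: "subgroup H G" and inj: "\<And>h. h \<in> H \<Longrightarrow> h [^] (n::nat) = \<one> \<Longrightarrow> h = \<one>"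
    and y: "y \<in> T closure_of H" "y [^] n = \<one>"
  shows "y = \<one>"
proof (rule ccontr)
  assume "y \<noteq> \<one>"
  have yc: "y \<in> carrier G" using y in_closure_iff by blast
  obtain U where U: "openin T U" "\<one> \<in> U" "\<And>a b. a \<in> U \<Longrightarrow> b \<in> U \<Longrightarrow> a \<otimes> inv b \<noteq> y"
    using separate_nbhd[OF yc \<open>y \<noteq> \<one>\<close>] by metis
  obtain W where W: "openin T W" "\<one> \<in> W" "\<forall>h\<in>H. h [^] n \<in> W \<longrightarrow> h \<in> U"
    using pow_embedding[OF H inj U(1,2)] by blast
  have "openin T {u \<in> carrier G. u [^] n \<in> W}"
    by (rule open_vimage[OF W(1)]) (intro cont_intros)
  then have "openin T (U \<inter> {u \<in> carrier G. u [^] n \<in> W})" using U by auto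
  moreover have "\<one> \<in> U \<inter> {u \<in> carrier G. u [^] n \<in> W}" using U W by simp
  ultimately obtain u where u: "u \<in> U" "u \<in> carrier G" "u [^] n \<in> W" "y \<otimes> u \<in> H"
    using y(1) unfolding in_closure_iff by blast
  have "(y \<otimes> u) [^] n = u [^] n" using u yc y(2) by (simp add: pow_mult)
  then have "y \<otimes> u \<in> U" using W(3) u by auto
  moreover have "(y \<otimes> u) \<otimes> inv u = y" using u yc by (simp add: m_assoc)
  ultimately show False using U(3) u(1) by blast
qed

lemma subgroup_products:
  assumes "a \<in> carrier G" "b \<in> carrier G"
  shows "subgroup {a [^] i \<otimes> b [^] j | (i::int) (j::int). True} G"
proof (rule subgroupI)
  show "{a [^] i \<otimes> b [^] j | (i::int) (j::int). True} \<subseteq> carrier G" using assms by auto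
  show "{a [^] i \<otimes> b [^] j | (i::int) (j::int). True} \<noteq> {}" by blast
  fix x assume "x \<in> {a [^] i \<otimes> b [^] j | (i::int) (j::int). True}"
  then obtain i :: int and j :: int where x: "x = a [^] i \<otimes> b [^] j" by blast
  have "inv x = a [^] (- i) \<otimes> b [^] (- j)"
    using x assms by (simp add: int_pow_neg inv_mult)
  then show "inv x \<in> {a [^] i \<otimes> b [^] j | (i::int) (j::int). True}" by blast
  fix y assume "y \<in> {a [^] i \<otimes> b [^] j | (i::int) (j::int). True}"
  then obtain k :: int and l :: int where y: "y = a [^] k \<otimes> b [^] l" by blast
  have "x \<otimes> y = a [^] (i + k) \<otimes> b [^] (j + l)"
    using x y assms by (simp add: int_pow_mult m_ac)
  then show "x \<otimes> y \<in> {a [^] i \<otimes> b [^] j | (i::int) (j::int). True}" by blast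
qed

lemma inf_order_closure_torsion_free:
  assumes x: "inf_order x" and y: "y \<in> cyclic_closure x" "y [^] n = \<one>" "n > (0::nat)"
  shows "y = \<one>"
proof (rule closure_torsion_free)
  have xc: "x \<in> carrier G" using x by (simp add: inf_order_def)
  show "subgroup (generate G {x}) G" by (rule cyclic_subgroup[OF xc])
  show "y \<in> T closure_of generate G {x}" using y by (simp add: cyclic_closure_def)
  show "y [^] n = \<one>" by fact
  fix h assume h: "h \<in> generate G {x}" "h [^] n = \<one>"
  then obtain k :: int where k: "h = x [^] k" using in_generate_iff xc by blast
  have "x [^] (k * int n) = (x [^] k) [^] int n" using xc by (simp add: int_pow_pow)
  then have "x [^] (k * int n) = \<one>" using h k by (simp add: int_pow_int)
  then have "k = 0" using inf_order_int_pow[OF x] y(3) by fastforce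
  then show "h = \<one>" using k by simp
qed

end

section \<open>Rank one, and finiteness of torsion groups\<close>

context hm_lca_group
begin

text \<open>The closure of the cyclic group is infinite and locally compact, so it is uncountable.
  It is torsion-free, so each of the countably many equations \<open>\<xi> [^] a = x [^] k\<close>
  with \<open>a > 0\<close> has at most one solution in it, and some \<open>\<xi>\<close> escapes
  them all.\<close>

lemma independent_element:
  assumes x: "inf_order x"
  obtains \<xi> where "\<xi> \<in> cyclic_closure x" "\<And>j::int. \<xi> [^] j \<in> generate G {x} \<Longrightarrow> j = 0"
proof -
  have xc: "x \<in> carrier G" using x by (simp add: inf_order_def)
  define K where "K = cyclic_closure x"
  have K: "subgroup K G" "closedin T K" unfolding K_def by (rule cyclic_closure_subgroup[OF xc] cyclic_closure_closed)+
  have KG: "\<And>k. k \<in> K \<Longrightarrow> k \<in> carrier G" using subgroup.mem_carrier[OF K(1)] .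
  interpret K: hm_lca_group "G\<lparr>carrier := K\<rparr>" "subtopology T K"
    by (rule sub_hm_lca_group[OF K(1) _ K(2) lc]) (use KG in \<open>simp add: m_comm\<close>)
  have "infinite K"
    using inf_order_infinite_generate[OF x] generate_subset_cyclic_closure[OF xc] unfolding K_def
    by (meson finite_subset)
  then have unc: "uncountable K" using K.countable_imp_finite by auto
  define B where "B = (\<Union>a\<in>{0<..}. \<Union>k\<in>(UNIV::int set). {\<xi> \<in> K. \<xi> [^] (a::nat) = x [^] k})"
  have "countable {\<xi> \<in> K. \<xi> [^] a = x [^] k}" if a: "a > 0" for a :: nat and k :: int
  proof -
    have eq: "\<xi> = \<eta>" if "\<xi> \<in> K" "\<eta> \<in> K" "\<xi> [^] a = \<eta> [^] a" for \<xi> \<eta>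
    proof -
      have "(\<xi> \<otimes> inv \<eta>) [^] a = \<one>"
        using that KG by (simp add: pow_mult nat_pow_inv)
      moreover have "\<xi> \<otimes> inv \<eta> \<in> K"
        using that subgroup.m_closed[OF K(1)] subgroup.m_inv_closed[OF K(1)] by blast
      ultimately have "\<xi> \<otimes> inv \<eta> = \<one>"
        using inf_order_closure_torsion_free[OF x _ _ a] unfolding K_def by blast
      then show ?thesis using that KG by (simp add: mult_inv_eq_one_iff)
    qed
    have "{\<xi> \<in> K. \<xi> [^] a = x [^] k} \<subseteq> {SOME \<xi>. \<xi> \<in> K \<and> \<xi> [^] a = x [^] k}"
    proof
      fix \<eta> assume \<eta>: "\<eta> \<in> {\<xi> \<in> K. \<xi> [^] a = x [^] k}"
      then have "(SOME \<xi>. \<xi> \<in> K \<and> \<xi> [^] a = x [^] k) \<in> K \<and> (SOME \<xi>. \<xi> \<in> K \<and> \<xi> [^] a = x [^] k) [^] a = x [^] k"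
        by (intro someI) auto
      with \<eta> eq show "\<eta> \<in> {SOME \<xi>. \<xi> \<in> K \<and> \<xi> [^] a = x [^] k}" by simp
    qed
    then show ?thesis by (meson countable_empty countable_insert countable_subset)
  qed
  then have "countable B" unfolding B_def by (intro countable_UN) auto
  then obtain \<xi> where \<xi>: "\<xi> \<in> K" "\<xi> \<notin> B" using unc by (metis countable_subset subsetI)
  show thesis
  proof (rule that)
    show "\<xi> \<in> cyclic_closure x" using \<xi> by (simp add: K_def)
    fix j :: int assume j: "\<xi> [^] j \<in> generate G {x}"
    show "j = 0"
    proof (rule ccontr)
      assume "j \<noteq> 0"
      have "\<xi> [^] nat \<bar>j\<bar> \<in> generate G {x}"
        by (rule nat_pow_abs_in_subgroup[OF cyclic_subgroup[OF xc] KG[OF \<xi>(1)] j])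
      then obtain k :: int where "\<xi> [^] nat \<bar>j\<bar> = x [^] k" using in_generate_iff[OF xc] by blast
      then have "\<xi> \<in> B" unfolding B_def using \<xi>(1) \<open>j \<noteq> 0\<close> by (intro UN_I[of "nat \<bar>j\<bar>"] UN_I[of k]) auto
      with \<xi>(2) show False by simp
    qed
  qed
qed

text \<open>A given \<open>l\<close> in \<open>L\<close> is twisted by an independent
  \<open>\<xi>\<close>: the closure of the subgroup generated by \<open>x\<close> and
  \<open>\<xi> \<otimes> l\<close> contains \<open>\<xi>\<close>, hence \<open>l\<close>. If
  \<open>x [^] i \<otimes> (\<xi> \<otimes> l) [^] j\<close> lies in \<open>L\<close>, so does
  \<open>x [^] i \<otimes> \<xi> [^] j\<close>, which is then trivial, and \<open>i = j = 0\<close>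
  by independence. Now \<open>essential\<close> gives \<open>l = \<one>\<close>.\<close>

lemma meets_cyclic_closure:
  assumes x: "inf_order x" and L: "subgroup L G" "closedin T L" and triv: "L \<inter> cyclic_closure x \<subseteq> {\<one>}"
  shows "L = {\<one>}"
proof -
  have xc: "x \<in> carrier G" using x by (simp add: inf_order_def)
  have K: "subgroup (cyclic_closure x) G" by (rule cyclic_closure_subgroup[OF xc])
  have KG: "\<And>k. k \<in> cyclic_closure x \<Longrightarrow> k \<in> carrier G" using subgroup.mem_carrier[OF K] .
  have LG: "\<And>k. k \<in> L \<Longrightarrow> k \<in> carrier G" using subgroup.mem_carrier[OF L(1)] .
  obtain \<xi> where \<xi>: "\<xi> \<in> cyclic_closure x" "\<And>j::int. \<xi> [^] j \<in> generate G {x} \<Longrightarrow> j = 0"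
    using independent_element[OF x] by blast
  have "l = \<one>" if l: "l \<in> L" for l
  proof -
    have lc: "l \<in> carrier G" and \<xi>c: "\<xi> \<in> carrier G" using LG KG l \<xi> by auto
    define H where "H = {x [^] i \<otimes> (\<xi> \<otimes> l) [^] j | (i::int) (j::int). True}"
    have H: "subgroup H G" unfolding H_def by (rule subgroup_products) (use xc lc \<xi>c in auto)
    define M where "M = T closure_of H"
    have M: "subgroup M G" "closedin T M" unfolding M_def using closure_subgroup[OF H] by auto
    have HM: "H \<subseteq> M" unfolding M_def using subgroup.subset[OF H] by (simp add: closure_of_subset)
    have "x = x [^] (1::int) \<otimes> (\<xi> \<otimes> l) [^] (0::int)" "\<xi> \<otimes> l = x [^] (0::int) \<otimes> (\<xi> \<otimes> l) [^] (1::int)"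
      using xc lc \<xi>c by auto
    then have "x \<in> H" "\<xi> \<otimes> l \<in> H" unfolding H_def by blast+
    then have xM: "x \<in> M" "\<xi> \<otimes> l \<in> M" using HM by auto
    then have "\<xi> \<in> M" using cyclic_closure_minimal[OF M xM(1)] \<xi> by blast
    then have "inv \<xi> \<otimes> (\<xi> \<otimes> l) \<in> M"
      using xM subgroup.m_closed[OF M(1)] subgroup.m_inv_closed[OF M(1)] by blast
    then have lM: "l \<in> M" using lc \<xi>c by (simp add: m_assoc[symmetric])
    have "H \<inter> (L \<inter> M) \<subseteq> {\<one>}"
    proof
      fix h assume h: "h \<in> H \<inter> (L \<inter> M)"
      then obtain i :: int and j :: int where ij: "h = x [^] i \<otimes> (\<xi> \<otimes> l) [^] j" unfolding H_def by blast
      have "x [^] i \<otimes> \<xi> [^] j = h \<otimes> inv (l [^] j)"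
        unfolding ij using xc lc \<xi>c by (simp add: int_pow_distrib m_assoc)
      moreover have "h \<otimes> inv (l [^] j) \<in> L"
        using h l subgroup.m_closed[OF L(1)] subgroup.m_inv_closed[OF L(1)] subgroup_int_pow_closed[OF L(1)] by blast
      moreover have "x [^] i \<otimes> \<xi> [^] j \<in> cyclic_closure x"
        using in_cyclic_closure[OF xc] \<xi>(1) subgroup.m_closed[OF K] subgroup_int_pow_closed[OF K] by blast
      ultimately have 1: "x [^] i \<otimes> \<xi> [^] j = \<one>" using triv by auto
      then have "\<xi> [^] j = inv (x [^] i)"
        using xc \<xi>c by (metis int_pow_closed inv_equality m_comm)
      then have "\<xi> [^] j = x [^] (- i)" using xc by (simp add: int_pow_neg)
      then have "j = 0" using \<xi>(2) in_generate_iff[OF xc] by blast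
      then have "i = 0" using 1 inf_order_int_pow[OF x] xc by simp
      then show "h \<in> {\<one>}" using ij \<open>j = 0\<close> by simp
    qed
    from essential[OF H subgroups_Inter_pair[OF L(1) M(1)] _ _ this]
    have "L \<inter> M = {\<one>}" using L(2) M(2) unfolding M_def by blast
    then show ?thesis using l lM by blast
  qed
  then show ?thesis using subgroup.one_closed[OF L(1)] by blast
qed

text \<open>This is rank one: \<open>meets_cyclic_closure\<close> makes the two cyclic closures
  intersect nontrivially, and \<open>essential\<close> moves a nontrivial common element into the
  dense subgroup of powers of \<open>y\<close>.\<close>

lemma power_in_cyclic_closure:
  assumes x: "inf_order x" and y: "y \<in> carrier G" "y \<noteq> \<one>"
  shows "\<exists>m::nat. m > 0 \<and> y [^] m \<in> cyclic_closure x \<and> y [^] m \<noteq> \<one>"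
proof -
  have xc: "x \<in> carrier G" using x by (simp add: inf_order_def)
  have K: "subgroup (cyclic_closure x) G" by (rule cyclic_closure_subgroup[OF xc])
  have L: "subgroup (cyclic_closure y) G" by (rule cyclic_closure_subgroup[OF y(1)])
  let ?L = "cyclic_closure y \<inter> cyclic_closure x"
  have "cyclic_closure y \<noteq> {\<one>}" using in_cyclic_closure[OF y(1)] y by blast
  then have "\<not> ?L \<subseteq> {\<one>}" using meets_cyclic_closure[OF x L cyclic_closure_closed] by blast
  then have ne: "?L \<noteq> {\<one>}" by blast
  have "\<not> generate G {y} \<inter> ?L \<subseteq> {\<one>}"
  proof
    assume "generate G {y} \<inter> ?L \<subseteq> {\<one>}"
    from essential[OF cyclic_subgroup[OF y(1)] subgroups_Inter_pair[OF L K] _ _ this]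
    show False using ne cyclic_closure_closed unfolding cyclic_closure_def by blast
  qed
  then obtain z where z: "z \<in> generate G {y}" "z \<in> cyclic_closure x" "z \<noteq> \<one>" by blast
  then obtain k :: int where "z = y [^] k" using in_generate_iff[OF y(1)] by blast
  with z have k: "y [^] k \<in> cyclic_closure x" "y [^] k \<noteq> \<one>" by simp_all
  have "y [^] nat \<bar>k\<bar> \<noteq> \<one>" using nat_abs_pow_cases[OF y(1), of k] y(1) k(2) by auto
  moreover have "k \<noteq> 0" using k by auto
  ultimately show ?thesis
    using nat_pow_abs_in_subgroup[OF K y(1) k(1)] by (intro exI[of _ "nat \<bar>k\<bar>"]) auto
qed

lemma torsion_free:
  assumes x: "inf_order x" and y: "y \<in> carrier G" "y [^] n = \<one>" "n > (0::nat)"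
  shows "y = \<one>"
proof (rule ccontr)
  assume "y \<noteq> \<one>"
  then obtain m :: nat where m: "y [^] m \<in> cyclic_closure x" "y [^] m \<noteq> \<one>"
    using power_in_cyclic_closure[OF x y(1)] by blast
  have "(y [^] m) [^] n = (y [^] n) [^] m" using y(1) by (simp add: nat_pow_pow mult.commute)
  then have "(y [^] m) [^] n = \<one>" using y by simp
  then show False using inf_order_closure_torsion_free[OF x m(1) _ y(3)] m(2) by blast
qed

lemma inf_order_of_ne_one:
  "inf_order x \<Longrightarrow> y \<in> carrier G \<Longrightarrow> y \<noteq> \<one> \<Longrightarrow> inf_order y"
  using torsion_free unfolding inf_order_def by metis

lemma power_inj:
  assumes x: "inf_order x" and yz: "y \<in> carrier G" "z \<in> carrier G" "y [^] n = z [^] n" "n > (0::nat)"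
  shows "y = z"
proof -
  have "(y \<otimes> inv z) [^] n = \<one>" using yz by (simp add: pow_mult nat_pow_inv)
  then have "y \<otimes> inv z = \<one>" using torsion_free[OF x _ _ yz(4)] yz by simp
  then show ?thesis using yz by (simp add: mult_inv_eq_one_iff)
qed

lemma power_in_closed_subgroup:
  assumes "inf_order x" "subgroup L G" "closedin T L" "x \<in> L" "y \<in> carrier G"
  shows "\<exists>m::nat. m > 0 \<and> y [^] m \<in> L"
proof (cases "y = \<one>")
  case True
  then show ?thesis using subgroup.one_closed[OF assms(2)] by (intro exI[of _ 1]) auto
next
  case False
  then show ?thesis
    using power_in_cyclic_closure[OF assms(1,5)] cyclic_closure_minimal[OF assms(2-4)] by blast
qed

text \<open>The cyclic group of \<open>y\<close> is finite, hence closed, so by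
  \<open>essential\<close> it meets \<open>H\<close> nontrivially; having prime order, it is then
  contained in \<open>H\<close>.\<close>

lemma prime_order_in_dense:
  assumes H: "subgroup H G" and y: "y \<in> T closure_of H" "y [^] p = \<one>" "prime (p::nat)"
  shows "y \<in> H"
proof (cases "y = \<one>")
  case True
  then show ?thesis using subgroup.one_closed[OF H] by simp
next
  case False
  have yc: "y \<in> carrier G" using y in_closure_iff by blast
  have p0: "p > 0" using y(3) prime_gt_0_nat by blast
  have red: "y [^] (k::int) = y [^] nat (k mod int p)" for k
  proof -
    have "y [^] k = y [^] (int p * (k div int p) + k mod int p)" by simp
    also have "\<dots> = (y [^] int p) [^] (k div int p) \<otimes> y [^] (k mod int p)"
      using yc by (simp only: int_pow_mult int_pow_pow)
    also have "\<dots> = y [^] int (nat (k mod int p))"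
      using y(2) yc p0 by (simp add: int_pow_int)
    finally show ?thesis unfolding int_pow_int .
  qed
  have "generate G {y} \<subseteq> (\<lambda>k. y [^] k) ` {..<p}"
  proof
    fix z assume "z \<in> generate G {y}"
    then obtain k :: int where "z = y [^] k" using in_generate_iff[OF yc] by blast
    then have "z = y [^] nat (k mod int p)" using red by simp
    moreover have "nat (k mod int p) < p" using p0 by (simp add: nat_less_iff)
    ultimately show "z \<in> (\<lambda>k. y [^] k) ` {..<p}" by blast
  qed
  then have fin: "finite (generate G {y})" by (meson finite_imageI finite_lessThan finite_subset)
  have sub: "generate G {y} \<subseteq> T closure_of H"
    using y(1) by (intro generate_subgroup_incl closure_subgroup H) simp
  have cl: "closedin T (generate G {y})"
    using fin Hausdorff yc generate_incl[of "{y}"] by (intro closedin_Hausdorff_finite) auto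
  have "generate G {y} \<noteq> {\<one>}" using generate.incl[of y "{y}" G] False by blast
  then have "\<not> H \<inter> generate G {y} \<subseteq> {\<one>}"
    using essential[OF H cyclic_subgroup[OF yc] cl sub] by blast
  then obtain z where z: "z \<in> generate G {y}" "z \<in> H" "z \<noteq> \<one>" by blast
  then obtain k :: int where "z = y [^] k" using in_generate_iff[OF yc] by blast
  with z have k: "y [^] k \<in> H" "y [^] k \<noteq> \<one>" by simp_all
  have "\<not> int p dvd k"
  proof
    assume "int p dvd k"
    then have "y [^] k = y [^] nat 0" using red[of k] by simp
    then show False using k by simp
  qed
  then have "coprime k (int p)"
    using y(3) by (metis coprime_commute prime_imp_coprime prime_int_nat_transfer prime_nat_int_transfer)
  then obtain u v where uv: "u * k + v * int p = 1" using bezout_int[of k "int p"] by (auto simp: coprime_iff_gcd_eq_1)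
  have "(y [^] k) [^] u = y [^] (k * u)" using yc by (simp add: int_pow_pow)
  also have "k * u = 1 + int p * (- v)" using uv by (simp add: eq_diff_eq mult.commute)
  also have "y [^] (1 + int p * (- v)) = y [^] (1::int) \<otimes> (y [^] int p) [^] (- v)"
    using yc by (simp only: int_pow_mult int_pow_pow)
  also have "\<dots> = y" using yc y(2) by (simp add: int_pow_int)
  finally show ?thesis using subgroup_int_pow_closed[OF H k(1), of u] by simp
qed

text \<open>The closure of a countable subgroup \<open>B\<close> of a torsion group has all its elements of prime order
  in \<open>B\<close>, hence is itself countable, hence finite by Baire's theorem.\<close>

lemma torsion_imp_finite:
  assumes tors: "\<And>y. y \<in> carrier G \<Longrightarrow> \<not> inf_order y"
  shows "finite (carrier G)"
proof (rule ccontr)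
  assume "infinite (carrier G)"
  then obtain S where S: "S \<subseteq> carrier G" "countable S" "infinite S"
    by (metis infinite_countable_subset')
  define B where "B = generate G S"
  have B: "subgroup B G" "countable B" "S \<subseteq> B"
    unfolding B_def using S by (auto intro: generate_is_subgroup countable_generate generate.incl)
  define L where "L = T closure_of B"
  have L: "subgroup L G" "closedin T L" unfolding L_def using closure_subgroup[OF B(1)] by auto
  have LG: "\<And>k. k \<in> L \<Longrightarrow> k \<in> carrier G" using subgroup.mem_carrier[OF L(1)] .
  interpret L: hm_lca_group "G\<lparr>carrier := L\<rparr>" "subtopology T L"
    by (rule sub_hm_lca_group[OF L(1) _ L(2) lc]) (use LG in \<open>simp add: m_comm\<close>)
  have prime_count: "countable {y \<in> L. y [^] p = \<one>}" if "prime p" for p :: nat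
  proof -
    have "{y \<in> L. y [^] p = \<one>} \<subseteq> B" using prime_order_in_dense[OF B(1) _ _ that] unfolding L_def by blast
    then show ?thesis using B(2) countable_subset by blast
  qed
  have count: "countable {y \<in> L. y [^] n = \<one>}" if "n > 0" for n :: nat
    using that
  proof (induction n rule: less_induct)
    case (less n)
    show ?case
    proof (cases "n = 1")
      case True
      then have "{y \<in> L. y [^] n = \<one>} \<subseteq> {\<one>}" using LG by auto
      then show ?thesis by (meson countable_empty countable_insert countable_subset)
    next
      case False
      then obtain p where p: "prime p" "p dvd n" using prime_factor_nat by blast
      then obtain m where m: "n = p * m" by blast
      have "m > 0" "m < n" using m less.prems prime_gt_1_nat[OF p(1)] by auto
      then have cm: "countable {y \<in> L. y [^] m = \<one>}" using less.IH by blast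
      \<comment> \<open>The map \<open>y \<mapsto> y [^] p\<close> takes the
        \<open>n\<close>-torsion into the \<open>m\<close>-torsion, and its fibres are cosets of the
        \<open>p\<close>-torsion; \<open>g\<close> picks a point of each fibre.\<close>
      define g where "g = (\<lambda>z. SOME y. y \<in> L \<and> y [^] p = z)"
      have "{y \<in> L. y [^] n = \<one>} \<subseteq> (\<lambda>(z, w). g z \<otimes> w) ` ({y \<in> L. y [^] m = \<one>} \<times> {y \<in> L. y [^] p = \<one>})"
      proof
        fix y assume "y \<in> {y \<in> L. y [^] n = \<one>}"
        then have y: "y \<in> L" "y [^] n = \<one>" by auto
        have g: "g (y [^] p) \<in> L" "g (y [^] p) [^] p = y [^] p"
          unfolding g_def using someI[of "\<lambda>z. z \<in> L \<and> z [^] p = y [^] p" y] y by auto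
        have "(inv (g (y [^] p)) \<otimes> y) [^] p = \<one>"
          using g y LG by (simp add: pow_mult nat_pow_inv)
        moreover have "inv (g (y [^] p)) \<otimes> y \<in> L"
          using g y subgroup.m_closed[OF L(1)] subgroup.m_inv_closed[OF L(1)] by blast
        moreover have "y [^] p \<in> L" using subgroup_nat_pow_closed[OF L(1) y(1)] .
        moreover have "(y [^] p) [^] m = \<one>" using y LG m by (simp add: nat_pow_pow)
        moreover have "y = g (y [^] p) \<otimes> (inv (g (y [^] p)) \<otimes> y)"
          using g y LG by (simp add: m_assoc[symmetric])
        ultimately show "y \<in> (\<lambda>(z, w). g z \<otimes> w) ` ({y \<in> L. y [^] m = \<one>} \<times> {y \<in> L. y [^] p = \<one>})"
          by (intro image_eqI[of _ _ "(y [^] p, inv (g (y [^] p)) \<otimes> y)"]) auto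
      qed
      moreover have "countable ((\<lambda>(z, w). g z \<otimes> w) ` ({y \<in> L. y [^] m = \<one>} \<times> {y \<in> L. y [^] p = \<one>}))"
        using cm prime_count[OF p(1)] by (intro countable_image countable_SIGMA) auto
      ultimately show ?thesis by (rule countable_subset)
    qed
  qed
  have "L \<subseteq> (\<Union>n\<in>{0<..}. {y \<in> L. y [^] (n::nat) = \<one>})"
  proof
    fix y assume y: "y \<in> L"
    then obtain n :: nat where "n > 0" "y [^] n = \<one>" using tors[OF LG[OF y]] LG[OF y] unfolding inf_order_def by blast
    then show "y \<in> (\<Union>n\<in>{0<..}. {y \<in> L. y [^] (n::nat) = \<one>})" using y by blast
  qed
  moreover have "countable (\<Union>n\<in>{0<..}. {y \<in> L. y [^] (n::nat) = \<one>})"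
    using count by (intro countable_UN) auto
  ultimately have "countable L" by (rule countable_subset)
  then have "finite L" using L.countable_imp_finite by simp
  moreover have "S \<subseteq> L" using B subgroup.subset[OF B(1)] unfolding L_def
    by (metis closure_of_subset order_trans topspace_eq)
  ultimately show False using S(3) finite_subset by blast
qed

end

section \<open>Compactness of monothetic groups\<close>

lemma compact_nested_subset:
  assumes "compact_space X" "\<And>n. closedin X (F n)" "decseq F" "openin X U" "(\<Inter>n. F n) \<subseteq> U"
  shows "\<exists>n::nat. F n \<subseteq> U"
proof (rule ccontr)
  assume neg: "\<not> ?thesis"
  have "(\<Inter>n. F n - U) \<noteq> {}"
  proof (rule compact_space_imp_nest[OF assms(1)])
    show "closedin X (F n - U)" for n using assms by (simp add: closedin_diff)
    show "F n - U \<noteq> {}" for n using neg by blast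
    show "decseq (\<lambda>n. F n - U)" using assms(3) by (auto simp: decseq_def)
  qed
  then show False using assms(5) by blast
qed

lemma closure_meets:
  assumes "y \<in> X closure_of S" "openin X U" "y \<in> U"
  obtains w where "w \<in> S" "w \<in> U"
  using assms by (auto simp: in_closure_of)

lemma (in group) power_image_subgroup:
  assumes K: "subgroup K G" and comm: "\<And>a b. a \<in> K \<Longrightarrow> b \<in> K \<Longrightarrow> a \<otimes> b = b \<otimes> a"
  shows "subgroup ((\<lambda>k. k [^] (n::nat)) ` K) G"
proof (rule subgroupI)
  have KG: "\<And>k. k \<in> K \<Longrightarrow> k \<in> carrier G" using subgroup.mem_carrier[OF K] .
  show "(\<lambda>k. k [^] n) ` K \<subseteq> carrier G" "(\<lambda>k. k [^] n) ` K \<noteq> {}"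
    using KG subgroup.one_closed[OF K] by auto
  fix a assume "a \<in> (\<lambda>k. k [^] n) ` K"
  then obtain k where k: "k \<in> K" "a = k [^] n" by blast
  then have "inv a = (inv k) [^] n" using KG by (simp add: nat_pow_inv)
  then show "inv a \<in> (\<lambda>k. k [^] n) ` K" using subgroup.m_inv_closed[OF K k(1)] by blast
  fix b assume "b \<in> (\<lambda>k. k [^] n) ` K"
  then obtain l where l: "l \<in> K" "b = l [^] n" by blast
  then have "a \<otimes> b = (k \<otimes> l) [^] n" using k KG comm by (simp add: pow_mult_distrib)
  then show "a \<otimes> b \<in> (\<lambda>k. k [^] n) ` K" using subgroup.m_closed[OF K k(1) l(1)] by blast
qed

lemma (in group) mult_inv_cancel:
  assumes "a \<in> carrier G" "b \<in> carrier G" "c \<in> carrier G"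
  shows "(a \<otimes> inv c) \<otimes> inv (b \<otimes> inv c) = a \<otimes> inv b"
proof -
  have "(a \<otimes> inv c) \<otimes> inv (b \<otimes> inv c) = a \<otimes> (inv c \<otimes> c) \<otimes> inv b"
    using assms by (simp only: inv_mult_group inv_closed inv_inv m_assoc m_closed)
  then show ?thesis using assms by simp
qed

context hausdorff_group
begin

lemma open_subgroupI:
  assumes H: "subgroup H G" and U: "openin T U" "\<one> \<in> U" "U \<subseteq> H"
  shows "openin T H"
proof (subst openin_subopen, intro ballI)
  fix h assume h: "h \<in> H"
  have hc: "h \<in> carrier G" using subgroup.mem_carrier[OF H h] .
  have "{y \<in> carrier G. inv h \<otimes> y \<in> U} \<subseteq> H"
  proof
    fix y assume y: "y \<in> {y \<in> carrier G. inv h \<otimes> y \<in> U}"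
    then have "h \<otimes> (inv h \<otimes> y) \<in> H" using h U(3) subgroup.m_closed[OF H] by blast
    then show "y \<in> H" using y hc by (simp add: m_assoc[symmetric])
  qed
  moreover have "h \<in> {y \<in> carrier G. inv h \<otimes> y \<in> U}" using hc U(2) by simp
  ultimately show "\<exists>V. openin T V \<and> h \<in> V \<and> V \<subseteq> H" using open_translate[OF U(1) hc] by blast
qed

lemma compact_precompact:
  assumes "compact_space T" "openin T U" "\<one> \<in> U"
  shows "\<exists>E. finite E \<and> E \<subseteq> carrier G \<and> (\<forall>a\<in>carrier G. \<exists>e\<in>E. inv e \<otimes> a \<in> U)"
proof -
  define f where "f = (\<lambda>e. {a \<in> carrier G. inv e \<otimes> a \<in> U})"
  have "\<exists>\<F>. finite \<F> \<and> \<F> \<subseteq> f ` carrier G \<and> topspace T \<subseteq> \<Union>\<F>"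
  proof (rule compactinD)
    show "compactin T (topspace T)" using assms(1) by (simp add: compact_space_def)
    show "openin T V" if "V \<in> f ` carrier G" for V using that open_translate[OF assms(2)] by (auto simp: f_def)
    show "topspace T \<subseteq> \<Union>(f ` carrier G)"
    proof
      fix a assume "a \<in> topspace T"
      then have "a \<in> f a" "a \<in> carrier G" using assms(3) by (auto simp: f_def)
      then show "a \<in> \<Union>(f ` carrier G)" by blast
    qed
  qed
  then obtain \<F> where F: "finite \<F>" "\<F> \<subseteq> f ` carrier G" "topspace T \<subseteq> \<Union>\<F>" by blast
  obtain E where E: "E \<subseteq> carrier G" "finite E" "\<F> = f ` E"
    using F(1,2) by (meson finite_subset_image)
  have "\<exists>e\<in>E. inv e \<otimes> a \<in> U" if "a \<in> carrier G" for a
  proof -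
    have "a \<in> \<Union>(f ` E)" using F(3) E(3) that by auto
    then show ?thesis by (auto simp: f_def)
  qed
  then show ?thesis using E by blast
qed

lemma power_image_closed:
  assumes "compactin T K" shows "closedin T ((\<lambda>k. k [^] (n::nat)) ` K)"
  by (intro compactin_imp_closedin[OF Hausdorff] image_compactin[OF assms] cont_intros)

lemma closed_translate:
  assumes "closedin T F" "g \<in> carrier G"
  shows "closedin T ((\<lambda>x. g \<otimes> x) ` F)"
proof -
  have "x \<in> (\<lambda>x. g \<otimes> x) ` F" if "x \<in> carrier G" "inv g \<otimes> x \<in> F" for x
    using that assms(2) by (intro image_eqI[of _ _ "inv g \<otimes> x"]) (simp_all add: mult_inv_mult_cancel)
  then have "(\<lambda>x. g \<otimes> x) ` F = {x \<in> carrier G. inv g \<otimes> x \<in> F}"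
    using closed_carrier[OF assms(1)] assms(2) by (auto simp: mult_inv_mult_cancel)
  moreover have "continuous_map T T (\<lambda>x. inv g \<otimes> x)" by (intro cont_intros) (use assms(2) in auto)
  ultimately show ?thesis using closed_vimage[OF assms(1)] by simp
qed

end

context hm_lca_group
begin

text \<open>Remove from a symmetric neighbourhood the finitely many nontrivial powers with exponents
  in \<open>{- int N..int N}\<close>, and then the identity, which is not isolated. The nonempty
  open rest contains a power of \<open>x\<close>, whose exponent may be taken positive by
  symmetry.\<close>

lemma dense_cyclic_recurrent:
  assumes x: "x \<in> carrier G" "cyclic_closure x = carrier G" and nd: "\<not> openin T {\<one>}"
    and W: "openin T W" "\<one> \<in> W"
  shows "\<exists>m>N. x [^] (m::nat) \<in> W"
proof -
  define V where "V = W \<inter> {v \<in> carrier G. inv v \<in> W}"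
  have V: "openin T V" "\<one> \<in> V"
    unfolding V_def using W by (auto intro!: openin_Int open_vimage cont_intros)
  define S where "S = (\<lambda>k. x [^] k) ` {- int N..int N} - {\<one>}"
  have S: "finite S" "S \<subseteq> carrier G" unfolding S_def using x by auto
  have "closedin T S" using closedin_Hausdorff_finite[OF Hausdorff] S by simp
  then have VS: "openin T (V - S)" using V by (simp add: openin_diff)
  have "closedin T {\<one>}" using closedin_Hausdorff_singleton[OF Hausdorff] by simp
  then have O1: "openin T (V - S - {\<one>})" using VS by (simp add: openin_diff)
  have "\<one> \<in> V - S" using V by (simp add: S_def)
  have "V - S - {\<one>} \<noteq> {}"
  proof
    assume "V - S - {\<one>} = {}"
    then have "V - S = {\<one>}" using \<open>\<one> \<in> V - S\<close> by blast
    then show False using nd VS by simp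
  qed
  then obtain z where z: "z \<in> V - S - {\<one>}" by blast
  then have "z \<in> T closure_of generate G {x}"
    using x(2) open_carrier[OF V(1)] unfolding cyclic_closure_def by blast
  then obtain w where w: "w \<in> generate G {x}" "w \<in> V - S - {\<one>}"
    by (rule closure_meets[OF _ O1 z])
  then obtain k :: int where k: "w = x [^] k" using in_generate_iff[OF x(1)] by blast
  have "k \<notin> {- int N..int N}" using w k unfolding S_def by blast
  then have kN: "nat \<bar>k\<bar> > N" by auto
  have "x [^] nat \<bar>k\<bar> \<in> W" using nat_abs_pow_cases[OF x(1), of k] w k by (auto simp: V_def)
  then show ?thesis using kN by blast
qed

text \<open>Weil's lemma on monothetic groups.\<close>

lemma dense_cyclic_compact:
  assumes x: "x \<in> carrier G" "cyclic_closure x = carrier G" and nd: "\<not> openin T {\<one>}"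
  shows "compact_space T"
proof -
  obtain U C where U: "openin T U" "\<one> \<in> U" "U \<subseteq> C" "compactin T C" using compact_nbhd by blast
  define V where "V = U \<inter> {v \<in> carrier G. inv v \<in> U}"
  have V: "openin T V" "\<one> \<in> V" "V \<subseteq> C"
    unfolding V_def using U by (auto intro!: openin_Int open_vimage cont_intros)
  have Vi: "inv v \<in> V" if "v \<in> V" for v
    using that open_carrier[OF U(1)] by (auto simp: V_def)
  \<comment> \<open>Density gives some integer exponent \<open>k\<close>; multiplying by a power
    \<open>x [^] m\<close> close to the identity with \<open>m > nat \<bar>k\<bar>\<close> makes the
    exponent positive.\<close>
  have hit: "\<exists>n>0. inv y \<otimes> x [^] (n::nat) \<in> V" if y: "y \<in> carrier G" for y
  proof -
    have "y \<in> {z \<in> carrier G. inv y \<otimes> z \<in> V}" using y V by simp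
    moreover have "y \<in> T closure_of generate G {x}" using y x(2) by (simp add: cyclic_closure_def)
    ultimately obtain w where w: "w \<in> generate G {x}" "w \<in> {z \<in> carrier G. inv y \<otimes> z \<in> V}"
      using closure_meets[OF _ open_translate[OF V(1) y]] by blast
    then have w: "w \<in> generate G {x}" "inv y \<otimes> w \<in> V" by simp_all
    then obtain k :: int where k: "w = x [^] k" using in_generate_iff[OF x(1)] by blast
    have "openin T {u \<in> carrier G. inv y \<otimes> (x [^] k \<otimes> u) \<in> V}"
      by (rule open_vimage[OF V(1)]) (intro cont_intros, use x y in auto)
    moreover have "\<one> \<in> {u \<in> carrier G. inv y \<otimes> (x [^] k \<otimes> u) \<in> V}" using w k x by simp
    ultimately have "\<exists>m>nat \<bar>k\<bar>. x [^] m \<in> {u \<in> carrier G. inv y \<otimes> (x [^] k \<otimes> u) \<in> V}"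
      by (rule dense_cyclic_recurrent[OF x nd])
    then obtain m :: nat where m: "m > nat \<bar>k\<bar>" "inv y \<otimes> (x [^] k \<otimes> x [^] m) \<in> V" by blast
    have km: "k + int m > 0" using m(1) by linarith
    have "x [^] k \<otimes> x [^] m = x [^] (k + int m)" using x(1) by (simp add: int_pow_mult int_pow_int)
    also have "\<dots> = x [^] int (nat (k + int m))" using km by simp
    also have "\<dots> = x [^] nat (k + int m)" by (rule int_pow_int)
    finally have "inv y \<otimes> x [^] nat (k + int m) \<in> V" using m by simp
    moreover have "nat (k + int m) > 0" using km by simp
    ultimately show ?thesis by blast
  qed
  define f where "f = (\<lambda>n::nat. {y \<in> carrier G. inv y \<otimes> x [^] n \<in> V})"
  have "\<exists>\<F>. finite \<F> \<and> \<F> \<subseteq> f ` {0<..} \<and> C \<subseteq> \<Union>\<F>"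
  proof (rule compactinD[OF U(4)])
    show "openin T W" if W: "W \<in> f ` {0<..}" for W
    proof -
      obtain n where "W = f n" using W by blast
      then show ?thesis unfolding f_def
        using open_vimage[OF V(1), of "\<lambda>y. inv y \<otimes> x [^] n"] x(1) by (simp add: cont_intros)
    qed
    show "C \<subseteq> \<Union>(f ` {0<..})"
    proof
      fix y assume "y \<in> C"
      then have y: "y \<in> carrier G" using compactin_subset_topspace[OF U(4)] by auto
      then show "y \<in> \<Union>(f ` {0<..})" using hit[OF y] by (auto simp: f_def)
    qed
  qed
  then obtain \<F> where F: "finite \<F>" "\<F> \<subseteq> f ` {0<..}" "C \<subseteq> \<Union>\<F>" by blast
  obtain I where I: "I \<subseteq> {0<..}" "finite I" "\<F> = f ` I"
    using finite_subset_image[OF F(1,2)] by blast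
  have "\<exists>e\<in>(\<lambda>n. x [^] n) ` {..Max I}. inv e \<otimes> y \<in> C" if y: "y \<in> carrier G" for y
  proof -
    \<comment> \<open>At the first positive time \<open>n\<close> that nearly reaches
      \<open>y\<close>, the error \<open>inv y \<otimes> x [^] n\<close> lies in one of the finitely
      many sets covering \<open>C\<close>, say \<open>f k\<close>. If \<open>n > k\<close>, the
      earlier time \<open>n - k\<close> would also reach \<open>y\<close>; hence
      \<open>n \<le> k\<close>, which bounds \<open>n\<close> independently of
      \<open>y\<close>.\<close>
    define n where "n = (LEAST n::nat. n > 0 \<and> inv y \<otimes> x [^] n \<in> V)"
    have n: "n > 0" "inv y \<otimes> x [^] n \<in> V"
      unfolding n_def using LeastI_ex[OF hit[OF y]] by auto
    have "inv y \<otimes> x [^] n \<in> \<Union>(f ` I)" using n(2) V(3) F(3) I(3) by blast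
    then obtain k where k: "k \<in> I" "inv (inv y \<otimes> x [^] n) \<otimes> x [^] k \<in> V" by (auto simp: f_def)
    have "n \<le> k"
    proof (rule ccontr)
      assume "\<not> n \<le> k"
      then have nk: "n = (n - k) + k" "n - k > 0" by auto
      have pn: "x [^] n = x [^] (n - k) \<otimes> x [^] k" using x(1) nk by (metis nat_pow_mult)
      have "inv (inv y \<otimes> x [^] n) \<otimes> x [^] k = y \<otimes> inv (x [^] (n - k))"
        unfolding pn using x(1) y by (simp add: inv_mult m_assoc)
      then have "inv (y \<otimes> inv (x [^] (n - k))) \<in> V" using k(2) Vi by metis
      then have "inv y \<otimes> x [^] (n - k) \<in> V" using x(1) y by (simp add: inv_mult)
      then have "n \<le> n - k"
        using Least_le[of "\<lambda>n. n > 0 \<and> inv y \<otimes> x [^] n \<in> V" "n - k"] nk(2) by (simp flip: n_def)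
      then show False using nk k(1) I(1) n by auto
    qed
    then have "n \<le> Max I" using k(1) I(2) by (meson Max_ge order_trans)
    moreover have "inv (inv y \<otimes> x [^] n) = inv (x [^] n) \<otimes> y"
      using x(1) y by (simp add: inv_mult_group)
    then have "inv (x [^] n) \<otimes> y \<in> C" using Vi[OF n(2)] V(3) by auto
    ultimately show ?thesis by blast
  qed
  then show ?thesis
    by (intro compact_of_translates[OF U(4), of "(\<lambda>n. x [^] n) ` {..Max I}"]) (use x(1) in auto)
qed

lemma avoid_finite:
  assumes "finite Z" "Z \<subseteq> carrier G - {\<one>}"
  shows "\<exists>O'. openin T O' \<and> \<one> \<in> O' \<and> (\<forall>u\<in>O'. \<forall>v\<in>O'. u \<otimes> inv v \<notin> Z)"
  using assms
proof (induction Z)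
  case empty
  show ?case using openin_topspace[of T] by (intro exI[of _ "carrier G"]) auto
next
  case (insert z Z)
  then obtain O1 where O1: "openin T O1" "\<one> \<in> O1" "\<forall>u\<in>O1. \<forall>v\<in>O1. u \<otimes> inv v \<notin> Z" by auto
  obtain O2 where O2: "openin T O2" "\<one> \<in> O2" "\<And>u v. u \<in> O2 \<Longrightarrow> v \<in> O2 \<Longrightarrow> u \<otimes> inv v \<noteq> z"
    using separate_nbhd[of z] insert.prems by (metis DiffD1 DiffD2 insert_subset singletonI)
  show ?case by (intro exI[of _ "O1 \<inter> O2"]) (use O1 O2 in auto)
qed

text \<open>In a divisible torsion-free compact group without small subgroups some power map would be
  uniformly expanding near the identity, while it maps the group onto itself: a cover by translates
  of one neighbourhood pulls back to covers of the same size by arbitrarily small translates.\<close>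

lemma divisible_no_small_subgroups_imp_finite:
  assumes comp: "compact_space T" and x: "inf_order x"
    and divi: "\<And>y n. y \<in> carrier G \<Longrightarrow> n > 0 \<Longrightarrow> \<exists>z\<in>carrier G. z [^] (n::nat) = y"
    and Q: "closedin T Q" "openin T Q0" "\<one> \<in> Q0" "Q0 \<subseteq> Q"
    and nss: "\<And>y. y \<in> carrier G \<Longrightarrow> (\<And>k::nat. y [^] k \<in> Q) \<Longrightarrow> y = \<one>"
  shows "finite (carrier G)"
proof -
  \<comment> \<open>The points whose powers stay in \<open>S\<close> up to exponent
    \<open>n\<close>. For \<open>S = Q\<close> these sets shrink to the identity: they are closed
    and decreasing in a compact space, and \<open>nss\<close> leaves only the identity in their
    intersection.\<close>
  define W where "W = (\<lambda>S (n::nat). {y \<in> carrier G. \<forall>k\<le>n. y [^] k \<in> S})"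
  have Wmono: "W S n \<subseteq> W S' m" if "S \<subseteq> S'" "m \<le> n" for S S' n m
    using that by (auto simp: W_def)
  have small: "\<exists>n. W Q n \<subseteq> O'" if O': "openin T O'" "\<one> \<in> O'" for O'
  proof (rule compact_nested_subset[OF comp _ _ O'(1)])
    show "closedin T (W Q n)" for n
    proof -
      have "W Q n = (\<Inter>k\<in>{..n}. {y \<in> carrier G. y [^] k \<in> Q})" by (auto simp: W_def)
      also have "closedin T \<dots>"
        by (intro closedin_Inter) (auto intro!: closed_vimage[OF Q(1)] cont_intros)
      finally show ?thesis .
    qed
    show "decseq (W Q)" using Wmono by (simp add: decseq_def)
    show "\<Inter>(range (W Q)) \<subseteq> O'"
    proof
      fix y assume y: "y \<in> \<Inter>(range (W Q))"
      have yW: "y \<in> W Q k" for k :: nat using y by blast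
      have "y \<in> carrier G" "y [^] k \<in> Q" for k :: nat using yW[of k] by (auto simp: W_def)
      then have "y = \<one>" using nss by blast
      then show "y \<in> O'" using O' by simp
    qed
  qed
  have Wopen: "openin T (W S n)" "\<one> \<in> W S n" if S: "openin T S" "\<one> \<in> S" for S n
  proof -
    have "W S n = (\<Inter>k\<in>{..n}. {y \<in> carrier G. y [^] k \<in> S})" by (auto simp: W_def)
    also have "openin T \<dots>"
      by (intro openin_Inter) (auto intro!: open_vimage[OF S(1)] cont_intros)
    finally show "openin T (W S n)" .
    show "\<one> \<in> W S n" using S by (simp add: W_def)
  qed
  obtain V where V: "openin T V" "\<one> \<in> V" "V \<subseteq> Q0" "\<And>a b. a \<in> V \<Longrightarrow> b \<in> V \<Longrightarrow> a \<otimes> b \<in> Q0"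
    using nbhd_mult[OF Q(2,3)] by blast
  obtain m0 where m0: "W Q m0 \<subseteq> V" using small[OF V(1,2)] by blast
  define m where "m = Suc m0"
  have m: "W Q m \<subseteq> V" "m > 0" using m0 Wmono[of Q Q m0 m] by (auto simp: m_def)
  \<comment> \<open>The factor 2 becomes the expansion rate: exponents \<open>k * j\<close> with
    \<open>k \<le> 2 * N\<close> and \<open>j \<le> m\<close> are at most \<open>q * N\<close>. So
    for \<open>n \<le> N\<close>, if the powers of \<open>y [^] q\<close> stay in \<open>V\<close>
    up to \<open>N\<close>, those of \<open>y\<close> stay in \<open>V\<close> up to
    \<open>2 * N\<close>.\<close>
  define q where "q = 2 * m"
  have q: "q > 0" "q \<ge> 2" using m by (auto simp: q_def)
  obtain O1 where O1: "openin T O1" "\<one> \<in> O1" "\<forall>h\<in>carrier G. h [^] q \<in> O1 \<longrightarrow> h \<in> W V q"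
    using pow_embedding[OF subgroup_self _ Wopen[OF V(1,2)], of q q] torsion_free[OF x _ _ q(1)] by blast
  obtain n0 where n0: "W Q n0 \<subseteq> O1" using small[OF O1(1,2)] by blast
  define n where "n = Suc n0"
  have n: "W Q n \<subseteq> O1" "n > 0" using n0 Wmono[of Q Q n0 n] by (auto simp: n_def)
  have contract: "y \<in> W V (2 * N)" if y: "y \<in> carrier G" "n \<le> N" "y [^] q \<in> W V N" for y N
  proof -
    have "y [^] q \<in> W Q n" using y(3) Wmono[of V Q n N] V(3) Q(4) y(2) by blast
    then have yq: "y \<in> W V q" using O1(3) n(1) y(1) by blast
    \<comment> \<open>Division of \<open>k\<close> by \<open>q\<close> splits the power into two
      factors in \<open>V\<close>: one from the hypothesis on \<open>y [^] q\<close>, the other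
      because \<open>y\<close> itself is small by the choice of \<open>O1\<close>.\<close>
    have yQ: "y [^] k \<in> Q" if k: "k \<le> q * N" for k
    proof -
      have "k div q \<le> N" using k q(1) by (metis div_le_mono nonzero_mult_div_cancel_left less_not_refl2)
      then have "(y [^] q) [^] (k div q) \<in> V" using y(3) by (auto simp: W_def)
      moreover have "y [^] (k mod q) \<in> V" using yq q(1) by (auto simp: W_def)
      moreover have "y [^] k = (y [^] q) [^] (k div q) \<otimes> y [^] (k mod q)"
        using y(1) by (simp add: nat_pow_pow nat_pow_mult)
      ultimately show ?thesis using V(4) Q(4) by auto
    qed
    have "y [^] k \<in> V" if k: "k \<le> 2 * N" for k
    proof -
      have "(y [^] k) [^] j \<in> Q" if j: "j \<le> m" for j
      proof -
        have "k * j \<le> (2 * N) * m" using k j by (rule mult_le_mono)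
        then have "k * j \<le> q * N" by (simp add: q_def mult.commute mult.left_commute)
        then show ?thesis using yQ y(1) by (simp add: nat_pow_pow)
      qed
      then have "y [^] k \<in> W Q m" using y(1) by (simp add: W_def)
      then show ?thesis using m(1) by blast
    qed
    then show ?thesis using y(1) by (simp add: W_def)
  qed
  have contract': "y \<in> W V (2 ^ j * n)" if "y \<in> carrier G" "y [^] (q ^ j) \<in> W V n" for y j
    using that
  proof (induction j arbitrary: y)
    case 0
    then show ?case by simp
  next
    case (Suc j)
    have "(y [^] q) [^] (q ^ j) \<in> W V n" using Suc.prems by (simp add: nat_pow_pow)
    then have "y [^] q \<in> W V (2 ^ j * n)" using Suc.IH[of "y [^] q"] Suc.prems by simp
    then have "y \<in> W V (2 * (2 ^ j * n))" using contract[of y "2 ^ j * n"] Suc.prems by simp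
    then show ?case by (simp add: mult.assoc)
  qed
  obtain E where E: "finite E" "E \<subseteq> carrier G" "\<forall>a\<in>carrier G. \<exists>e\<in>E. inv e \<otimes> a \<in> W V n"
    using compact_precompact[OF comp Wopen[OF V(1,2)], of n] by blast
  show ?thesis
  proof (rule ccontr)
    assume "infinite (carrier G)"
    \<comment> \<open>One point more than the cover has translates. As roots are unique and exist,
      pulling the cover back along the \<open>q ^ N\<close>-th power map gives at most
      \<open>card E\<close> translates of a set inside \<open>O'\<close>; two points of
      \<open>S\<close> then share one, although \<open>O'\<close> is chosen to separate
      them.\<close>
    then obtain S where S: "S \<subseteq> carrier G" "finite S" "card S = Suc (card E)"
      by (metis infinite_arbitrarily_large)
    define Z where "Z = (\<lambda>(s, t). s \<otimes> inv t) ` (S \<times> S) - {\<one>}"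
    have "finite Z" "Z \<subseteq> carrier G - {\<one>}" unfolding Z_def using S by auto
    then obtain O' where O': "openin T O'" "\<one> \<in> O'" "\<forall>u\<in>O'. \<forall>v\<in>O'. u \<otimes> inv v \<notin> Z"
      using avoid_finite by blast
    obtain N where N: "W Q N \<subseteq> O'" using small[OF O'(1,2)] by blast
    have "N < 2 ^ N" by simp
    also have "(2::nat) ^ N \<le> 2 ^ N * n" using n(2) by simp
    finally have "W V (2 ^ N * n) \<subseteq> O'" using N Wmono[of V Q N "2 ^ N * n"] V(3) Q(4) by auto
    then have to_O: "y \<in> O'" if "y \<in> carrier G" "y [^] (q ^ N) \<in> W V n" for y
      using contract'[OF that] by blast
    have qN: "q ^ N > 0" using q by simp
    have "\<exists>e. e \<in> E \<and> (\<exists>f\<in>carrier G. f [^] (q ^ N) = e \<and> s \<otimes> inv f \<in> O')" if s: "s \<in> S" for s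
    proof -
      have sc: "s \<in> carrier G" using s S by blast
      then obtain e where e: "e \<in> E" "inv e \<otimes> s [^] (q ^ N) \<in> W V n" using E(3) by (meson nat_pow_closed)
      then obtain f where f: "f \<in> carrier G" "f [^] (q ^ N) = e" using divi[OF _ qN, of e] E(2) by blast
      have "(s \<otimes> inv f) [^] (q ^ N) = inv e \<otimes> s [^] (q ^ N)"
        using sc f e(1) E(2) by (auto simp: pow_mult nat_pow_inv intro: m_comm)
      then have "s \<otimes> inv f \<in> O'" using to_O[of "s \<otimes> inv f"] sc f e by simp
      then show ?thesis using e f by blast
    qed
    then obtain g where g: "\<And>s. s \<in> S \<Longrightarrow> g s \<in> E \<and> (\<exists>f\<in>carrier G. f [^] (q ^ N) = g s \<and> s \<otimes> inv f \<in> O')"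
      by metis
    have "\<not> inj_on g S"
    proof
      assume "inj_on g S"
      then have "card S \<le> card E" using g E(1) by (intro card_inj_on_le[of g]) auto
      then show False using S(3) by simp
    qed
    then obtain s t where st: "s \<in> S" "t \<in> S" "s \<noteq> t" "g s = g t" by (auto simp: inj_on_def)
    obtain f where f: "f \<in> carrier G" "f [^] (q ^ N) = g s" "s \<otimes> inv f \<in> O'" using g[OF st(1)] by blast
    obtain f' where f': "f' \<in> carrier G" "f' [^] (q ^ N) = g t" "t \<otimes> inv f' \<in> O'" using g[OF st(2)] by blast
    have "f = f'" using power_inj[OF x f(1) f'(1) _ qN] f f' st by simp
    have c: "s \<in> carrier G" "t \<in> carrier G" using st S by auto
    have "(s \<otimes> inv f) \<otimes> inv (t \<otimes> inv f) = s \<otimes> inv t"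
      using c f(1) by (simp add: mult_inv_cancel)
    moreover have "s \<otimes> inv t \<noteq> \<one>" using c st by (simp add: mult_inv_eq_one_iff)
    moreover have "s \<otimes> inv t \<in> (\<lambda>(s, t). s \<otimes> inv t) ` (S \<times> S)" using st by force
    ultimately show False using O'(3) f(3) f'(3) \<open>f = f'\<close> unfolding Z_def by auto
  qed
qed

section \<open>Subgroups of n-th powers\<close>

definition powers :: "nat \<Rightarrow> 'a set"
  where "powers n = (\<lambda>k. k [^] n) ` carrier G"

lemma powers_subgroup: "subgroup (powers n) G"
  unfolding powers_def by (rule power_image_subgroup[OF subgroup_self m_comm])

lemma powers_closed: "compact_space T \<Longrightarrow> closedin T (powers n)"
  unfolding powers_def by (rule power_image_closed) (simp add: compact_space_def)

lemma powers_dvd: "m dvd n \<Longrightarrow> powers n \<subseteq> powers m"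
proof
  fix y assume "m dvd n" "y \<in> powers n"
  then obtain k l where "k \<in> carrier G" "y = k [^] n" "n = m * l" unfolding powers_def by blast
  then have "y = (k [^] l) [^] m" by (simp add: nat_pow_pow mult.commute)
  then show "y \<in> powers m" using \<open>k \<in> carrier G\<close> by (auto simp: powers_def)
qed

lemma dense_cyclic_power:
  assumes x: "x \<in> carrier G" "cyclic_closure x = carrier G"
    and D: "subgroup D G" "closedin T D" "x [^] (m::nat) \<in> D" and k: "k \<in> carrier G"
  shows "k [^] m \<in> D"
proof -
  have "closedin T {k \<in> carrier G. k [^] m \<in> D}" by (rule closed_vimage[OF D(2)]) (intro cont_intros)
  moreover have "generate G {x} \<subseteq> {k \<in> carrier G. k [^] m \<in> D}"
  proof
    fix z assume "z \<in> generate G {x}"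
    then obtain i :: int where z: "z = x [^] i" using in_generate_iff[OF x(1)] by blast
    have "z [^] m = (x [^] m) [^] i"
      using x(1) z by (simp add: int_pow_pow mult.commute flip: int_pow_int)
    then show "z \<in> {k \<in> carrier G. k [^] m \<in> D}"
      using D subgroup_int_pow_closed[OF D(1)] z x(1) by simp
  qed
  ultimately have "cyclic_closure x \<subseteq> {k \<in> carrier G. k [^] m \<in> D}"
    unfolding cyclic_closure_def by (intro closure_minimal)
  then show ?thesis using k x(2) by blast
qed

text \<open>A nontrivial \<open>d\<close> would make the group divisible: by rank one some
  \<open>x [^] m\<close> lies in the intersection \<open>D\<close> of all \<open>powers n\<close>,
  so all \<open>m\<close>-th powers do, and the exponent \<open>m\<close> cancels by
  torsion-freeness. Every nontrivial closed subgroup is then the whole group, so a neighbourhood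
  whose closure misses \<open>x\<close> contains no nontrivial subgroup, and
  \<open>divisible_no_small_subgroups_imp_finite\<close> gives a contradiction.\<close>

lemma dense_cyclic_Inter_powers:
  assumes comp: "compact_space T" and x: "inf_order x" "cyclic_closure x = carrier G"
    and d: "\<And>n. n > 0 \<Longrightarrow> d \<in> powers n"
  shows "d = \<one>"
proof (rule ccontr)
  assume ne: "d \<noteq> \<one>"
  have xc: "x \<in> carrier G" using x by (simp add: inf_order_def)
  have dc: "d \<in> carrier G" using d[of 1] by (auto simp: powers_def)
  have dinf: "inf_order d" using inf_order_of_ne_one[OF x(1) dc ne] .
  define D where "D = (\<Inter>n\<in>{0<..}. powers n)"
  have D: "subgroup D G" "closedin T D" "d \<in> D"
  proof -
    show "subgroup D G" unfolding D_def by (intro subgroups_Inter) (auto intro: powers_subgroup)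
    show "closedin T D" unfolding D_def by (intro closedin_Inter) (auto intro: powers_closed[OF comp])
    show "d \<in> D" unfolding D_def using d by auto
  qed
  obtain m :: nat where m: "m > 0" "x [^] m \<in> D"
    using power_in_closed_subgroup[OF dinf D xc] by blast
  have divi: "\<exists>z\<in>carrier G. z [^] n = y" if y: "y \<in> carrier G" "n > 0" for y and n :: nat
  proof -
    have "y [^] m \<in> D" by (rule dense_cyclic_power[OF xc x(2) D(1,2) m(2) y(1)])
    then have "y [^] m \<in> powers (n * m)" unfolding D_def using m(1) y(2) by auto
    then obtain z where z: "z \<in> carrier G" "y [^] m = (z [^] n) [^] m"
      by (auto simp: powers_def nat_pow_pow)
    then have "y = z [^] n" using power_inj[OF x(1) y(1) _ _ m(1)] by simp
    then show ?thesis using z by blast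
  qed
  have full: "L = carrier G" if L: "subgroup L G" "closedin T L" "l \<in> L" "l \<noteq> \<one>" for L l
  proof -
    have "inf_order l" using inf_order_of_ne_one[OF x(1)] L subgroup.mem_carrier by metis
    then obtain i :: nat where i: "i > 0" "x [^] i \<in> L" using power_in_closed_subgroup L xc by blast
    have "y \<in> L" if y: "y \<in> carrier G" for y
    proof -
      obtain z where "z \<in> carrier G" "z [^] i = y" using divi[OF y i(1)] by blast
      then show ?thesis using dense_cyclic_power[OF xc x(2) L(1,2) i(2)] by blast
    qed
    then show ?thesis using subgroup.subset[OF L(1)] by blast
  qed
  have x1: "x \<noteq> \<one>" using x(1) by (auto simp: inf_order_def)
  obtain U where U: "openin T U" "\<one> \<in> U" "\<And>a b. a \<in> U \<Longrightarrow> b \<in> U \<Longrightarrow> a \<otimes> inv b \<noteq> x"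
    using separate_nbhd[OF xc x1] by metis
  have xU: "x \<notin> T closure_of U"
  proof
    assume "x \<in> T closure_of U"
    then obtain u where u: "u \<in> U" "x \<otimes> u \<in> U" using U(1,2) unfolding in_closure_iff by blast
    have "(x \<otimes> u) \<otimes> inv u = x" using xc open_carrier[OF U(1) u(1)] by (simp add: m_assoc)
    then show False using U(3)[OF u(2,1)] by simp
  qed
  \<comment> \<open>Intersecting with the set of inverses lets the condition on natural powers
    control the negative ones too.\<close>
  define Q where "Q = T closure_of U \<inter> {v \<in> carrier G. inv v \<in> T closure_of U}"
  define Q0 where "Q0 = U \<inter> {v \<in> carrier G. inv v \<in> U}"
  have "finite (carrier G)"
  proof (rule divisible_no_small_subgroups_imp_finite[OF comp x(1) divi])
    show "closedin T Q" unfolding Q_def by (intro closedin_Int closed_vimage cont_intros) auto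
    show "openin T Q0" unfolding Q0_def using U by (intro openin_Int open_vimage cont_intros) auto
    show "\<one> \<in> Q0" unfolding Q0_def using U by simp
    show "Q0 \<subseteq> Q" unfolding Q0_def Q_def using closure_of_subset[of U T] openin_subset[OF U(1)] by auto
    fix y assume y: "y \<in> carrier G" "\<And>k::nat. y [^] k \<in> Q"
    show "y = \<one>"
    proof (rule ccontr)
      assume y1: "y \<noteq> \<one>"
      have "generate G {y} \<subseteq> T closure_of U"
      proof
        fix z assume "z \<in> generate G {y}"
        then obtain i :: int where z: "z = y [^] i" using in_generate_iff[OF y(1)] by blast
        have "z = y [^] nat \<bar>i\<bar> \<or> z = inv (y [^] nat \<bar>i\<bar>)"
          using nat_abs_pow_cases[OF y(1), of i] y(1) z by auto
        then show "z \<in> T closure_of U" using y(2)[of "nat \<bar>i\<bar>"] by (auto simp: Q_def)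
      qed
      then have "cyclic_closure y \<subseteq> T closure_of U" unfolding cyclic_closure_def by (intro closure_minimal) auto
      moreover have "cyclic_closure y = carrier G"
        using full[OF cyclic_closure_subgroup[OF y(1)] cyclic_closure_closed in_cyclic_closure[OF y(1)] y1] .
      ultimately show False using xU xc by blast
    qed
  qed
  then show False
    using inf_order_infinite_generate[OF x(1)] generate_incl[of "{x}"] xc by (meson finite_subset empty_subsetI insert_subset)
qed

text \<open>Factorial exponents make the family decreasing while every positive \<open>n\<close>
  divides one of them; compactness then turns a trivial intersection into a neighbourhood
  base.\<close>

lemma powers_basis:
  assumes comp: "compact_space T" and triv: "\<And>d. (\<And>n. n > 0 \<Longrightarrow> d \<in> powers n) \<Longrightarrow> d = \<one>"
    and U: "openin T U" "\<one> \<in> U"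
  shows "\<exists>n>0. powers n \<subseteq> U"
proof -
  have "\<exists>n. powers (fact n) \<subseteq> U"
  proof (rule compact_nested_subset[OF comp _ _ U(1)])
    show "closedin T (powers (fact n))" for n using powers_closed[OF comp] .
    show "decseq (\<lambda>n. powers (fact n))"
      unfolding decseq_def using powers_dvd fact_dvd by blast
    show "(\<Inter>n. powers (fact n)) \<subseteq> U"
    proof
      fix d assume d: "d \<in> (\<Inter>n. powers (fact n))"
      have "d \<in> powers n" if "n > 0" for n
        using d powers_dvd[of n "fact n"] dvd_fact[of n n] that by fastforce
      then have "d = \<one>" using triv by blast
      then show "d \<in> U" using U by simp
    qed
  qed
  then show ?thesis using fact_gt_zero by blast
qed

end

section \<open>Compactness and the \<open>p\<close>-adic structure\<close>

lemma (in comm_group) coprime_powers_in_subgroup: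
  assumes L: "subgroup L G" and x: "x \<in> carrier G" "x [^] (i::nat) \<in> L" "x [^] (j::nat) \<in> L" and "coprime i j"
  shows "x \<in> L"
proof -
  have "coprime (int i) (int j)" using assms(5) by simp
  then obtain u v where "u * int i + v * int j = 1"
    using bezout_int[of "int i" "int j"] by (auto simp: coprime_iff_gcd_eq_1)
  then have "int i * u + int j * v = 1" by (simp add: mult.commute)
  then have "x = x [^] (int i * u + int j * v)" using x(1) by simp
  also have "\<dots> = (x [^] i) [^] u \<otimes> (x [^] j) [^] v"
    using x(1) int_pow_pow[OF x(1), of "int i" u] int_pow_pow[OF x(1), of "int j" v]
    by (simp add: int_pow_mult int_pow_int)
  finally show ?thesis
    using subgroup_int_pow_closed[OF L x(2), of u] subgroup_int_pow_closed[OF L x(3), of v] subgroup.m_closed[OF L]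
    by metis
qed

context hm_lca_group
begin

text \<open>Finitely many cosets of \<open>L\<close> form a closed set; it contains all powers of
  \<open>x\<close>, hence also their closure.\<close>

lemma cyclic_closure_cosets:
  assumes x: "x \<in> carrier G" and L: "subgroup L G" "closedin T L" "x [^] (n::nat) \<in> L" and n: "n > 0"
    and y: "y \<in> cyclic_closure x"
  shows "\<exists>i<n. \<exists>l\<in>L. y = x [^] i \<otimes> l"
proof -
  define F where "F = (\<Union>i\<in>{..<n}. (\<lambda>l. x [^] i \<otimes> l) ` L)"
  have "closedin T F" unfolding F_def
    using x L by (intro closedin_Union) (auto intro!: closed_translate)
  moreover have "generate G {x} \<subseteq> F"
  proof
    fix z assume "z \<in> generate G {x}"
    then obtain k :: int where z: "z = x [^] k" using in_generate_iff[OF x] by blast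
    define i where "i = nat (k mod int n)"
    have i: "i < n" using n by (simp add: i_def nat_less_iff)
    have "z = x [^] (k mod int n + int n * (k div int n))" unfolding z by simp
    also have "\<dots> = x [^] (k mod int n) \<otimes> x [^] (int n * (k div int n))" using x by (simp only: int_pow_mult)
    also have "x [^] (k mod int n) = x [^] i" unfolding i_def using n by (simp flip: int_pow_int)
    also have "x [^] (int n * (k div int n)) = (x [^] n) [^] (k div int n)"
      using x by (simp add: int_pow_int flip: int_pow_pow)
    finally have "z = x [^] i \<otimes> (x [^] n) [^] (k div int n)" .
    moreover have "(x [^] n) [^] (k div int n) \<in> L" using subgroup_int_pow_closed[OF L(1,3)] .
    ultimately show "z \<in> F" unfolding F_def using i by blast
  qed
  ultimately have "cyclic_closure x \<subseteq> F" unfolding cyclic_closure_def by (intro closure_minimal)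
  then show ?thesis using y unfolding F_def by blast
qed

lemma cyclic_closure_sub:
  assumes x: "inf_order x"
  shows "hm_lca_group (G\<lparr>carrier := cyclic_closure x\<rparr>) (subtopology T (cyclic_closure x))"
    "group.inf_order (G\<lparr>carrier := cyclic_closure x\<rparr>) x"
    "hausdorff_group.cyclic_closure (G\<lparr>carrier := cyclic_closure x\<rparr>) (subtopology T (cyclic_closure x)) x
      = cyclic_closure x"
proof -
  have xc: "x \<in> carrier G" using x by (simp add: inf_order_def)
  have K: "subgroup (cyclic_closure x) G" by (rule cyclic_closure_subgroup[OF xc])
  show 1: "hm_lca_group (G\<lparr>carrier := cyclic_closure x\<rparr>) (subtopology T (cyclic_closure x))"
    by (rule sub_hm_lca_group[OF K _ cyclic_closure_closed lc]) (use subgroup.mem_carrier[OF K] in \<open>simp add: m_comm\<close>)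
  interpret K: hm_lca_group "G\<lparr>carrier := cyclic_closure x\<rparr>" "subtopology T (cyclic_closure x)" by (rule 1)
  show "K.inf_order x"
    unfolding K.inf_order_def using x in_cyclic_closure[OF xc]
    by (simp add: inf_order_def flip: nat_pow_consistent)
  show "K.cyclic_closure x = cyclic_closure x"
    unfolding K.cyclic_closure_def
    using generate_subset_cyclic_closure[OF xc] in_cyclic_closure[OF xc] generate_consistent[OF _ K, of "{x}"]
    by (simp add: closure_of_subtopology inf.absorb2) (simp add: cyclic_closure_def)
qed

lemma cyclic_closure_compact:
  assumes x: "inf_order x"
  shows "compactin T (cyclic_closure x)"
proof -
  interpret K: hm_lca_group "G\<lparr>carrier := cyclic_closure x\<rparr>" "subtopology T (cyclic_closure x)"
    by (rule cyclic_closure_sub[OF x])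
  have xc: "x \<in> carrier G" using x by (simp add: inf_order_def)
  have "infinite (cyclic_closure x)"
    using inf_order_infinite_generate[OF x] generate_subset_cyclic_closure[OF xc] finite_subset by blast
  then have "\<not> openin (subtopology T (cyclic_closure x)) {\<one>}"
    using K.discrete_imp_finite by auto
  then have "compact_space (subtopology T (cyclic_closure x))"
    using K.dense_cyclic_compact[of x] in_cyclic_closure[OF xc] cyclic_closure_sub(3)[OF x] by simp
  then show ?thesis
    using subgroup.subset[OF cyclic_closure_subgroup[OF xc]] by (simp add: compactin_subspace)
qed

lemma cyclic_closure_powers_small:
  assumes x: "inf_order x" and U: "openin T U" "\<one> \<in> U"
  shows "\<exists>n>0. \<forall>k\<in>cyclic_closure x. k [^] (n::nat) \<in> U"
proof -
  interpret K: hm_lca_group "G\<lparr>carrier := cyclic_closure x\<rparr>" "subtopology T (cyclic_closure x)"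
    by (rule cyclic_closure_sub[OF x])
  have c: "compact_space (subtopology T (cyclic_closure x))"
    using cyclic_closure_compact[OF x] by (rule compact_space_subtopology)
  have "\<exists>n>0. K.powers n \<subseteq> U \<inter> cyclic_closure x"
  proof (rule K.powers_basis[OF c])
    show "d = \<one>\<^bsub>G\<lparr>carrier := cyclic_closure x\<rparr>\<^esub>" if "\<And>n. n > 0 \<Longrightarrow> d \<in> K.powers n" for d
      using K.dense_cyclic_Inter_powers[OF c cyclic_closure_sub(2)[OF x] _ that] cyclic_closure_sub(3)[OF x] by simp
    show "openin (subtopology T (cyclic_closure x)) (U \<inter> cyclic_closure x)"
      using U by (simp add: openin_subtopology_Int)
    show "\<one>\<^bsub>G\<lparr>carrier := cyclic_closure x\<rparr>\<^esub> \<in> U \<inter> cyclic_closure x"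
      using U K.one_closed by simp
  qed
  then show ?thesis by (auto simp: K.powers_def image_subset_iff simp flip: nat_pow_consistent)
qed

text \<open>By rank one every element has a positive power in \<open>K\<close>, so by Baire's
  theorem a single exponent \<open>m\<close> works near the identity. The open subgroup is
  \<open>{y \<in> carrier G. y [^] m \<in> P}\<close>, where \<open>P\<close> consists of the
  \<open>n\<close>-th powers in \<open>K\<close>: it is small by \<open>pow_embedding\<close>
  because \<open>P\<close> is small, and open because \<open>P\<close> has finite index in
  \<open>K\<close>.\<close>

lemma inf_order_linear:
  assumes x: "inf_order x" and U: "openin T U" "\<one> \<in> U"
  shows "\<exists>O'. subgroup O' G \<and> openin T O' \<and> O' \<subseteq> U"
proof -
  have xc: "x \<in> carrier G" using x by (simp add: inf_order_def)
  define K where "K = cyclic_closure x"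
  have K: "subgroup K G" "closedin T K" "compactin T K" "x \<in> K" unfolding K_def
    using cyclic_closure_subgroup[OF xc] cyclic_closure_closed cyclic_closure_compact[OF x] in_cyclic_closure[OF xc] by auto
  have KG: "\<And>k. k \<in> K \<Longrightarrow> k \<in> carrier G" using subgroup.mem_carrier[OF K(1)] .
  define A where "A = (\<lambda>m::nat. {y \<in> carrier G. y [^] m \<in> K})"
  have Acl: "closedin T (A m)" for m unfolding A_def by (rule closed_vimage[OF K(2)]) (intro cont_intros)
  have "\<exists>m>0. T interior_of (A m) \<noteq> {}"
  proof (rule ccontr)
    assume neg: "\<not> ?thesis"
    have "T interior_of \<Union>(A ` {0<..}) = {}"
    proof (rule Baire_category_alt)
      show "completely_metrizable_space T \<or> locally_compact_space T \<and> regular_space T"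
        using lc Hausdorff locally_compact_Hausdorff_imp_regular_space by blast
      show "closedin T B \<and> T interior_of B = {}" if "B \<in> A ` {0<..}" for B
        using that neg Acl by blast
    qed simp
    moreover have "\<Union>(A ` {0<..}) = topspace T"
    proof
      show "topspace T \<subseteq> \<Union>(A ` {0<..})"
      proof
        fix y assume "y \<in> topspace T"
        then obtain m :: nat where "m > 0" "y [^] m \<in> K" "y \<in> carrier G"
          using power_in_closed_subgroup[OF x K(1,2,4)] by auto
        then show "y \<in> \<Union>(A ` {0<..})" by (auto simp: A_def)
      qed
    qed (auto simp: A_def)
    ultimately show False by (metis interior_of_topspace one_closed empty_iff topspace_eq)
  qed
  then obtain m where m: "m > 0" "T interior_of (A m) \<noteq> {}" by blast
  then obtain a where a: "a \<in> T interior_of (A m)" by blast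
  then have aA: "a \<in> A m" using interior_of_subset[of T "A m"] by blast
  then have ac: "a \<in> carrier G" "a [^] m \<in> K" by (auto simp: A_def)
  define U1 where "U1 = {w \<in> carrier G. a \<otimes> w \<in> T interior_of (A m)}"
  have U1: "openin T U1" "\<one> \<in> U1"
    unfolding U1_def using a ac by (auto intro!: open_vimage cont_intros)
  have U1K: "w [^] m \<in> K" if w: "w \<in> U1" for w
  proof -
    have wc: "w \<in> carrier G" "a \<otimes> w \<in> A m" using w interior_of_subset[of T "A m"] by (auto simp: U1_def)
    then have "a [^] m \<otimes> w [^] m \<in> K" using ac by (simp add: A_def pow_mult)
    then have "inv (a [^] m) \<otimes> (a [^] m \<otimes> w [^] m) \<in> K"
      using ac(2) subgroup.m_closed[OF K(1)] subgroup.m_inv_closed[OF K(1)] by blast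
    then show ?thesis using ac wc by (simp add: m_assoc[symmetric])
  qed
  obtain W where W: "openin T W" "\<one> \<in> W" "\<forall>h\<in>carrier G. h [^] m \<in> W \<longrightarrow> h \<in> U"
    using pow_embedding[OF subgroup_self _ U, of m] torsion_free[OF x _ _ m(1)] by blast
  obtain n :: nat where n: "n > 0" "\<forall>k\<in>K. k [^] n \<in> W"
    using cyclic_closure_powers_small[OF x W(1,2)] unfolding K_def by blast
  define P where "P = (\<lambda>k. k [^] n) ` K"
  have P: "subgroup P G" "closedin T P" "x [^] n \<in> P" "P \<subseteq> K"
    unfolding P_def using power_image_subgroup[OF K(1) m_comm[OF KG KG]] power_image_closed[OF K(3)] K(4) subgroup_nat_pow_closed[OF K(1)] by auto
  have PG: "\<And>k. k \<in> P \<Longrightarrow> k \<in> carrier G" using subgroup.mem_carrier[OF P(1)] .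
  \<comment> \<open>The cosets of \<open>P\<close> in \<open>K\<close> other than \<open>P\<close>.
    They form a closed set without the identity, so near the identity \<open>y [^] m\<close> is
    forced into \<open>P\<close>.\<close>
  define F where "F = (\<Union>i\<in>{i \<in> {..<n}. x [^] i \<notin> P}. (\<lambda>l. x [^] i \<otimes> l) ` P)"
  have F: "closedin T F" unfolding F_def
    using xc P(2) by (intro closedin_Union) (auto intro!: closed_translate)
  have F1: "\<one> \<notin> F"
  proof
    assume "\<one> \<in> F"
    then obtain i l where i: "x [^] i \<notin> P" "l \<in> P" "\<one> = x [^] (i::nat) \<otimes> l" unfolding F_def by blast
    then have "x [^] i = inv l" using xc PG by (metis inv_equality nat_pow_closed)
    then show False using i subgroup.m_inv_closed[OF P(1)] by metis
  qed
  have KF: "k \<in> P" if k: "k \<in> K" "k \<notin> F" for k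
  proof -
    obtain i l where i: "i < n" "l \<in> P" "k = x [^] i \<otimes> l"
      using cyclic_closure_cosets[OF xc P(1-3) n(1)] k(1) unfolding K_def by blast
    then have "x [^] i \<in> P" using k(2) unfolding F_def by blast
    then show ?thesis using i subgroup.m_closed[OF P(1)] by blast
  qed
  define O' where "O' = {y \<in> carrier G. y [^] m \<in> P}"
  have O': "subgroup O' G"
  proof (rule subgroupI)
    show "O' \<subseteq> carrier G" "O' \<noteq> {}" unfolding O'_def using subgroup.one_closed[OF P(1)] by auto
    fix y assume y: "y \<in> O'"
    then show "inv y \<in> O'" unfolding O'_def using subgroup.m_inv_closed[OF P(1)] by (auto simp: nat_pow_inv)
    fix z assume "z \<in> O'"
    then show "y \<otimes> z \<in> O'" using y unfolding O'_def using subgroup.m_closed[OF P(1)] by (auto simp: pow_mult)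
  qed
  define U2 where "U2 = U1 \<inter> {y \<in> carrier G. y [^] m \<in> topspace T - F}"
  have U2: "openin T U2"
    unfolding U2_def using F[unfolded closedin_def] by (intro openin_Int open_vimage cont_intros U1) blast
  have "\<one> \<in> U2" unfolding U2_def using U1 F1 by simp
  moreover have "U2 \<subseteq> O'" unfolding U2_def O'_def using KF U1K by auto
  ultimately have "openin T O'" using open_subgroupI[OF O' U2] by blast
  moreover have "O' \<subseteq> U"
    using W(3) n(2) unfolding O'_def P_def by auto
  ultimately show ?thesis using O' by blast
qed

theorem compact: "compact_space T"
proof (cases "\<exists>x. inf_order x")
  case True
  then show ?thesis using linear_imp_compact inf_order_linear by blast
next
  case False
  then have "finite (carrier G)" using torsion_imp_finite by blast
  then show ?thesis by (simp add: compact_space_def finite_imp_compactin)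
qed

section \<open>Recognising the p-adic integers\<close>

lemma powers_small:
  assumes x: "inf_order x" and U: "openin T U" "\<one> \<in> U"
  shows "\<exists>n>0. powers n \<subseteq> U"
proof -
  obtain O' where O': "subgroup O' G" "openin T O'" "O' \<subseteq> U" using inf_order_linear[OF x U] by blast
  obtain E where E: "finite E" "E \<subseteq> carrier G" "\<forall>a\<in>carrier G. \<exists>e\<in>E. inv e \<otimes> a \<in> O'"
    using compact_precompact[OF compact O'(2) subgroup.one_closed[OF O'(1)]] by blast
  have "a [^] (fact (card E) :: nat) \<in> O'" if a: "a \<in> carrier G" for a
  proof -
    have "\<forall>i. \<exists>e. e \<in> E \<and> inv e \<otimes> a [^] (i::nat) \<in> O'" using E(3) a by (meson nat_pow_closed)
    then obtain g where g: "\<And>i. g i \<in> E \<and> inv (g i) \<otimes> a [^] (i::nat) \<in> O'" by metis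
    have "\<not> inj_on g {..card E}"
    proof
      assume "inj_on g {..card E}"
      then have "card {..card E} \<le> card E" using g E(1) by (intro card_inj_on_le[of g]) auto
      then show False by simp
    qed
    then obtain i j where ij: "i \<le> card E" "j \<le> card E" "i < j" "g i = g j"
      unfolding inj_on_def by (metis atMost_iff linorder_neqE_nat)
    define e where "e = g i"
    have ec: "e \<in> carrier G" using g E(2) unfolding e_def by blast
    have "inv (inv e \<otimes> a [^] i) \<otimes> (inv e \<otimes> a [^] j) \<in> O'"
      using g[of i] g[of j] ij(4) subgroup.m_closed[OF O'(1)] subgroup.m_inv_closed[OF O'(1)] unfolding e_def by metis
    moreover have "a [^] j = a [^] i \<otimes> a [^] (j - i)" using a ij(3) by (simp add: nat_pow_mult)
    then have "inv (inv e \<otimes> a [^] i) \<otimes> (inv e \<otimes> a [^] j) = a [^] (j - i)"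
      using a ec by (simp add: inv_mult_group m_assoc) (simp add: m_assoc[symmetric])
    ultimately have "a [^] (j - i) \<in> O'" by simp
    moreover have "j - i dvd (fact (card E) :: nat)" by (rule dvd_fact) (use ij in auto)
    then obtain c where "(fact (card E) :: nat) = (j - i) * c" by blast
    ultimately show ?thesis using subgroup_nat_pow_closed[OF O'(1), of "a [^] (j - i)" c] a by (simp add: nat_pow_pow)
  qed
  then have "powers (fact (card E)) \<subseteq> U" using O'(3) by (auto simp: powers_def)
  then show ?thesis using fact_gt_zero by blast
qed

text \<open>If all power maps of prime exponent were onto, all power maps of positive exponent would
  be, but by \<open>powers_small\<close> one of them has its image in a neighbourhood that misses
  \<open>x\<close>.\<close>

lemma exists_prime_powers_proper:
  assumes x: "inf_order x"
  shows "\<exists>p. prime p \<and> powers p \<noteq> carrier G"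
proof (rule ccontr)
  assume "\<not> ?thesis"
  then have pp: "powers p = carrier G" if "prime p" for p using that by blast
  have all: "powers n = carrier G" if "n > 0" for n
    using that
  proof (induction n rule: less_induct)
    case (less n)
    show ?case
    proof (cases "n = 1")
      case True
      then show ?thesis by (auto simp: powers_def image_iff)
    next
      case False
      then obtain p where p: "prime p" "p dvd n" using prime_factor_nat by blast
      then obtain m where m: "n = p * m" by blast
      have "m > 0" "m < n" using m less.prems prime_gt_1_nat[OF p(1)] by auto
      then have pm: "powers m = carrier G" using less.IH by blast
      have "y \<in> powers n" if y: "y \<in> carrier G" for y
      proof -
        obtain z where z: "z \<in> carrier G" "y = z [^] m" using y pm by (auto simp: powers_def)
        obtain w where w: "w \<in> carrier G" "z = w [^] p" using z pp[OF p(1)] by (auto simp: powers_def)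
        have "y = w [^] n" using z w m by (simp add: nat_pow_pow)
        then show ?thesis using w by (auto simp: powers_def)
      qed
      moreover have "powers n \<subseteq> carrier G" by (auto simp: powers_def)
      ultimately show ?thesis by blast
    qed
  qed
  have "x \<in> carrier G" "x \<noteq> \<one>" using x by (auto simp: inf_order_def)
  then obtain U where U: "openin T U" "\<one> \<in> U" "x \<notin> U" using separate_nbhd by metis
  obtain n where "n > 0" "powers n \<subseteq> U" using powers_small[OF x U(1,2)] by blast
  then show False using all U(3) \<open>x \<in> carrier G\<close> by blast
qed

text \<open>Abstract characterisation of the \<open>p\<close>-adic integers with topological generator \<open>x\<close>.\<close>

definition padic_generator :: "nat \<Rightarrow> 'a \<Rightarrow> bool"
  where "padic_generator p x \<longleftrightarrow> prime p \<and> inf_order x \<and> cyclic_closure x = carrier G \<and> x \<notin> powers p \<and>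
    (\<forall>U. openin T U \<longrightarrow> \<one> \<in> U \<longrightarrow> (\<exists>k. powers (p ^ k) \<subseteq> U))"

text \<open>Any \<open>x\<close> outside \<open>powers p\<close> works. Rank one and cancellation of
  exponents show that the \<open>powers (p ^ k)\<close> intersect trivially, so they form a base by
  compactness. Every element has a power in the closure \<open>K\<close> of the powers of
  \<open>x\<close>; it is brought into \<open>K\<close> itself by removing first the
  prime-to-\<open>p\<close> part of the exponent and then the factors \<open>p\<close>.\<close>

lemma exists_padic_generator:
  assumes x0: "inf_order x0"
  shows "\<exists>p x. padic_generator p x"
proof -
  obtain p where p: "prime p" "powers p \<noteq> carrier G" using exists_prime_powers_proper[OF x0] by blast
  then obtain x where x: "x \<in> carrier G" "x \<notin> powers p" by (auto simp: powers_def)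
  have "x \<noteq> \<one>" using x subgroup.one_closed[OF powers_subgroup] by blast
  then have xi: "inf_order x" using inf_order_of_ne_one[OF x0 x(1)] by blast
  have xp: "x [^] p \<in> powers p" using x by (auto simp: powers_def)
  have xcop: "x [^] i \<notin> powers p" if i: "\<not> p dvd i" for i
  proof
    assume "x [^] i \<in> powers p"
    moreover have "coprime i p" using i p(1) prime_imp_coprime by (metis coprime_commute)
    ultimately show False using coprime_powers_in_subgroup[OF powers_subgroup x(1) _ xp] x(2) by blast
  qed
  have p1: "p > 0" using prime_gt_0_nat[OF p(1)] .
  have small: "\<exists>k. powers (p ^ k) \<subseteq> U" if U: "openin T U" "\<one> \<in> U" for U
  proof (rule compact_nested_subset[OF compact _ _ U(1)])
    show "closedin T (powers (p ^ k))" for k using powers_closed[OF compact] .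
    show "decseq (\<lambda>k. powers (p ^ k))" unfolding decseq_def using powers_dvd le_imp_power_dvd by blast
    show "(\<Inter>k. powers (p ^ k)) \<subseteq> U"
    proof
      fix d assume d: "d \<in> (\<Inter>k. powers (p ^ k))"
      have "d = \<one>"
      proof (rule ccontr)
        assume "d \<noteq> \<one>"
        have "d \<in> powers (p ^ 0)" using d by blast
        then have dc: "d \<in> carrier G" by (auto simp: powers_def)
        have di: "inf_order d" using inf_order_of_ne_one[OF x0 dc \<open>d \<noteq> \<one>\<close>] .
        have D: "subgroup (\<Inter>k. powers (p ^ k)) G" "closedin T (\<Inter>k. powers (p ^ k))"
          by (intro subgroups_Inter closedin_Inter; auto intro: powers_subgroup powers_closed[OF compact])+
        obtain m :: nat where m: "m > 0" "x [^] m \<in> (\<Inter>k. powers (p ^ k))"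
          using power_in_closed_subgroup[OF di D d x(1)] by blast
        obtain a m' where am: "m = p ^ a * m'" "\<not> p dvd m'"
          using m(1) prime_power_canonical[OF p(1) m(1)] by (metis mult.commute)
        \<comment> \<open>One level above the exact power \<open>p ^ a\<close> dividing
          \<open>m\<close>: after cancelling \<open>p ^ a\<close>, the prime-to-\<open>p\<close>
          power \<open>x [^] m'\<close> is a \<open>p\<close>-th power, which \<open>xcop\<close>
          forbids.\<close>
        have "x [^] m \<in> powers (p ^ Suc a)" using m(2) by blast
        then obtain z where z: "z \<in> carrier G" "x [^] m = z [^] (p ^ Suc a)" by (auto simp: powers_def)
        have "(x [^] m') [^] (p ^ a) = (z [^] p) [^] (p ^ a)"
          using z x(1) am(1) by (simp add: nat_pow_pow mult.commute)
        then have "x [^] m' = z [^] p" using power_inj[OF x0, of "x [^] m'" "z [^] p" "p ^ a"] x(1) z(1) p1 by simp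
        then show False using xcop[OF am(2)] z(1) by (auto simp: powers_def)
      qed
      then show "d \<in> U" using U by simp
    qed
  qed
  define K where "K = cyclic_closure x"
  have K: "subgroup K G" "closedin T K" "compactin T K" "x \<in> K" unfolding K_def
    using cyclic_closure_subgroup[OF x(1)] cyclic_closure_closed cyclic_closure_compact[OF xi] in_cyclic_closure[OF x(1)] by auto
  have KG: "\<And>k. k \<in> K \<Longrightarrow> k \<in> carrier G" using subgroup.mem_carrier[OF K(1)] .
  \<comment> \<open>Bezout modulo \<open>p ^ j\<close> gives an \<open>m\<close>-th power of an
    element of \<open>K\<close> that agrees with \<open>k\<close> up to an element of
    \<open>powers (p ^ j)\<close>. The \<open>m\<close>-th powers of \<open>K\<close> form a closed
    set, so \<open>k\<close> is one of them.\<close>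
  have root: "\<exists>z\<in>K. z [^] m = k" if k: "k \<in> K" and m: "\<not> p dvd m" for k m
  proof -
    have "k \<in> T closure_of ((\<lambda>k. k [^] m) ` K)"
      unfolding in_closure_iff
    proof (intro conjI allI impI)
      show "k \<in> carrier G" using KG k .
      fix U assume "openin T U \<and> \<one> \<in> U"
      then obtain j where j: "powers (p ^ j) \<subseteq> U" using small by blast
      have "coprime (int m) (int (p ^ j))"
        using m p(1) prime_imp_coprime by (metis coprime_commute coprime_int_iff coprime_power_right_iff)
      then obtain u v where "u * int m + v * int (p ^ j) = 1"
        using bezout_int[of "int m" "int (p ^ j)"] by (auto simp: coprime_iff_gcd_eq_1)
      then have uv: "u * int m = 1 + (- v) * int (p ^ j)" by simp
      have "(k [^] u) [^] m = k [^] (u * int m)" using KG[OF k] by (simp add: int_pow_pow flip: int_pow_int)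
      also have "\<dots> = k [^] (1::int) \<otimes> (k [^] (- v)) [^] int (p ^ j)"
        unfolding uv using KG[OF k] by (simp only: int_pow_mult int_pow_pow)
      also have "\<dots> = k \<otimes> (k [^] (- v)) [^] (p ^ j)"
        using KG[OF k] unfolding int_pow_int by simp
      finally have "k \<otimes> (k [^] (- v)) [^] (p ^ j) \<in> (\<lambda>k. k [^] m) ` K"
        using subgroup_int_pow_closed[OF K(1) k, of u] by (metis imageI)
      moreover have "(k [^] (- v)) [^] (p ^ j) \<in> U" using j KG[OF k] by (auto simp: powers_def)
      ultimately show "\<exists>u\<in>U. k \<otimes> u \<in> (\<lambda>k. k [^] m) ` K" by blast
    qed
    then show ?thesis using closure_of_closedin[OF power_image_closed[OF K(3)]] by force
  qed
  have "y \<in> K" if y: "y \<in> carrier G" for y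
  proof -
    obtain m :: nat where m: "m > 0" "y [^] m \<in> K" using power_in_closed_subgroup[OF xi K(1,2,4) y] by blast
    obtain a m' where am: "m = p ^ a * m'" "\<not> p dvd m'"
      using m(1) prime_power_canonical[OF p(1) m(1)] by (metis mult.commute)
    have m'0: "m' > 0" using m(1) am(1) by (cases m') auto
    obtain z where z: "z \<in> K" "z [^] m' = y [^] m" using root[OF m(2) am(2)] by blast
    have "(y [^] (p ^ a)) [^] m' = z [^] m'" using z am(1) y by (simp add: nat_pow_pow)
    then have "y [^] (p ^ a) = z" using power_inj[OF x0 _ KG[OF z(1)] _ m'0] y by simp
    then have ex: "y [^] (p ^ a) \<in> K" using z by simp
    define b where "b = (LEAST a. y [^] (p ^ a) \<in> K)"
    have b: "y [^] (p ^ b) \<in> K" unfolding b_def using ex by (rule LeastI)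
    show ?thesis
    proof (cases b)
      case 0
      then show ?thesis using b y by simp
    next
      case (Suc c)
      have nc: "y [^] (p ^ c) \<notin> K"
      proof
        assume "y [^] (p ^ c) \<in> K"
        then have "b \<le> c" unfolding b_def by (rule Least_le)
        then show False using Suc by simp
      qed
      \<comment> \<open>Modulo the \<open>p\<close>-th powers of \<open>K\<close> the element
        \<open>y [^] (p ^ b)\<close> is some \<open>x [^] i\<close> with \<open>i < p\<close>, so
        \<open>x [^] i\<close> is a \<open>p\<close>-th power in the whole group. Hence
        \<open>i = 0\<close>, and cancelling \<open>p\<close> puts \<open>y [^] (p ^ c)\<close> into
        \<open>K\<close>, against the minimality of \<open>b\<close>.\<close>
      have "x [^] p \<in> (\<lambda>k. k [^] p) ` K" using K(4) by blast
      from cyclic_closure_cosets[OF x(1) power_image_subgroup[OF K(1) m_comm[OF KG KG]] power_image_closed[OF K(3)] this p1]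
      obtain i w where iw: "i < p" "w \<in> K" "y [^] (p ^ b) = x [^] i \<otimes> w [^] p"
        using b unfolding K_def by blast
      have wc: "w \<in> carrier G" using KG iw by blast
      have "(y [^] (p ^ c) \<otimes> inv w) [^] p = y [^] (p ^ b) \<otimes> inv (w [^] p)"
        using y wc Suc by (simp add: pow_mult nat_pow_inv nat_pow_pow mult.commute)
      also have "\<dots> = x [^] i" using iw(3) x(1) wc by (simp add: m_assoc)
      finally have eq: "(y [^] (p ^ c) \<otimes> inv w) [^] p = x [^] i" .
      show ?thesis
      proof (cases "i = 0")
        case True
        then have "y [^] (p ^ c) \<otimes> inv w = \<one>" using torsion_free[OF x0 _ _ p1] eq y wc by simp
        then have "y [^] (p ^ c) = w" using y wc by (simp add: mult_inv_eq_one_iff)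
        then show ?thesis using nc iw(2) by simp
      next
        case False
        then have "\<not> p dvd i" using iw(1) by (simp add: nat_dvd_not_less)
        moreover have "x [^] i \<in> powers p" unfolding powers_def using eq[symmetric] y wc by auto
        ultimately show ?thesis using xcop by blast
      qed
    qed
  qed
  then have "cyclic_closure x = carrier G" using KG unfolding K_def by blast
  then show ?thesis unfolding padic_generator_def using p(1) xi x(2) small by blast
qed

end

section \<open>Congruences, commuting sets and solvable groups\<close>

lemma one_plus_power_approx:
  fixes a :: int
  shows "a\<^sup>2 dvd (1 + a) ^ n - (1 + int n * a)"
proof (induction n)
  case (Suc n)
  have "(1 + a) ^ Suc n - (1 + int (Suc n) * a) = (1 + a) * ((1 + a) ^ n - (1 + int n * a)) + int n * a\<^sup>2"
    by (simp add: algebra_simps power2_eq_square)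
  then show ?case using Suc by simp
qed simp

text \<open>Each \<open>p\<close>-th power raises the level by exactly one. At a level
  \<open>m \<ge> 2\<close> the quadratic remainder is divisible by \<open>p ^ (m + 2)\<close>, so it
  leaves the new leading coefficient unchanged modulo \<open>p\<close>, also for
  \<open>p = 2\<close>.\<close>

lemma one_plus_prime_power:
  fixes t :: int
  assumes p: "prime (p::nat)" and j: "j \<ge> 2" and t: "\<not> int p dvd t"
  shows "\<exists>b. \<not> int p dvd b \<and> (1 + int p ^ j * t) ^ (p ^ i) = 1 + int p ^ (j + i) * b"
proof (induction i)
  case 0
  then show ?case using t by auto
next
  case (Suc i)
  then obtain b where b: "\<not> int p dvd b" "(1 + int p ^ j * t) ^ (p ^ i) = 1 + int p ^ (j + i) * b" by blast
  define m where "m = j + i"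
  have m: "m \<ge> 2" using j by (simp add: m_def)
  obtain c where c: "(1 + int p ^ m * b) ^ p - (1 + int p * (int p ^ m * b)) = (int p ^ m * b)\<^sup>2 * c"
    using one_plus_power_approx[of "int p ^ m * b" p] by blast
  have "(int p ^ m * b)\<^sup>2 = int p ^ (m + m) * b\<^sup>2" by (simp add: power_mult_distrib power2_eq_square power_add)
  also have "m + m = Suc m + (m - 1)" using m by simp
  also have "int p ^ (Suc m + (m - 1)) * b\<^sup>2 = int p ^ Suc m * (int p ^ (m - 1) * b\<^sup>2)" by (simp only: power_add mult.assoc)
  finally have sq: "(int p ^ m * b)\<^sup>2 = int p ^ Suc m * (int p ^ (m - 1) * b\<^sup>2)" .
  have "(1 + int p ^ m * b) ^ p = 1 + int p ^ Suc m * b + int p ^ Suc m * (int p ^ (m - 1) * b\<^sup>2) * c"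
    using c unfolding sq by (simp add: algebra_simps)
  then have eq: "(1 + int p ^ m * b) ^ p = 1 + int p ^ Suc m * (b + int p ^ (m - 1) * (b\<^sup>2 * c))"
    by (simp add: algebra_simps)
  have "int p dvd int p ^ (m - 1) * (b\<^sup>2 * c)" using m by (intro dvd_mult2 dvd_power) auto
  then have "\<not> int p dvd b + int p ^ (m - 1) * (b\<^sup>2 * c)" using b(1) by (simp add: dvd_add_left_iff)
  moreover have "(1 + int p ^ j * t) ^ (p ^ Suc i) = (1 + int p ^ m * b) ^ p"
    using b(2) by (simp add: m_def power_mult mult.commute[of p])
  ultimately show ?case using eq by (auto simp: m_def)
qed

lemma prime_solve_linear:
  fixes a b :: int
  assumes p: "prime (p::nat)" and b: "\<not> int p dvd b"
  shows "\<exists>i::nat. int p dvd a + int i * b"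
proof -
  have p0: "int p > 0" using prime_gt_0_nat[OF p] by simp
  have "coprime (int p) b" using p b by (simp add: prime_imp_coprime)
  then obtain u v where uv: "u * b + v * int p = 1"
    using bezout_int[of b "int p"] by (auto simp: coprime_iff_gcd_eq_1 gcd.commute)
  define s where "s = - a * u"
  have "int p dvd a + (s mod int p) * b"
  proof -
    have "a * (u * b + v * int p) = a" using uv by simp
    then have 1: "a + s * b = a * (v * int p)" by (simp add: s_def algebra_simps)
    have "s mod int p = s - int p * (s div int p)" by (simp add: minus_mult_div_eq_mod)
    then have "a + (s mod int p) * b = a + (s - int p * (s div int p)) * b" by simp
    also have "\<dots> = (a + s * b) - int p * ((s div int p) * b)" by (simp only: algebra_simps)
    also have "\<dots> = int p * (a * v - (s div int p) * b)" unfolding 1 by (simp add: algebra_simps)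
    finally have "a + (s mod int p) * b = int p * (a * v - (s div int p) * b)" .
    then show ?thesis by simp
  qed
  then show ?thesis using p0 by (intro exI[of _ "nat (s mod int p)"]) simp
qed

section \<open>Conjugation, centralisers and commuting sets\<close>

context group
begin

definition conj_by :: "'a \<Rightarrow> 'a \<Rightarrow> 'a"
  where "conj_by g y = g \<otimes> y \<otimes> inv g"

lemma conj_by_closed [simp]: "g \<in> carrier G \<Longrightarrow> y \<in> carrier G \<Longrightarrow> conj_by g y \<in> carrier G"
  by (simp add: conj_by_def)

lemma conj_by_mult:
  assumes "g \<in> carrier G" "y \<in> carrier G" "z \<in> carrier G"
  shows "conj_by g (y \<otimes> z) = conj_by g y \<otimes> conj_by g z"
proof -
  have "conj_by g y \<otimes> conj_by g z = g \<otimes> y \<otimes> (inv g \<otimes> g) \<otimes> z \<otimes> inv g"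
    using assms by (simp only: conj_by_def m_assoc m_closed inv_closed)
  then show ?thesis using assms by (simp add: conj_by_def m_assoc)
qed

lemma conj_by_hom: "g \<in> carrier G \<Longrightarrow> conj_by g \<in> hom G G"
  by (simp add: hom_def conj_by_mult)

lemma conj_by_nat_pow: "g \<in> carrier G \<Longrightarrow> y \<in> carrier G \<Longrightarrow> conj_by g (y [^] (n::nat)) = conj_by g y [^] n"
  by (rule hom_nat_pow[OF conj_by_hom]) auto

lemma conj_by_int_pow: "g \<in> carrier G \<Longrightarrow> y \<in> carrier G \<Longrightarrow> conj_by g (y [^] (n::int)) = conj_by g y [^] n"
  by (rule hom_int_pow[OF conj_by_hom]) auto

lemma conj_by_comp:
  assumes "g \<in> carrier G" "h \<in> carrier G" "y \<in> carrier G"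
  shows "conj_by g (conj_by h y) = conj_by (g \<otimes> h) y"
  using assms by (simp add: conj_by_def inv_mult_group m_assoc)

lemma conj_by_one [simp]: "y \<in> carrier G \<Longrightarrow> conj_by \<one> y = y"
  by (simp add: conj_by_def)

lemma conj_by_eq_iff:
  assumes "g \<in> carrier G" "y \<in> carrier G" "z \<in> carrier G"
  shows "conj_by g y = z \<longleftrightarrow> g \<otimes> y = z \<otimes> g"
proof
  assume "conj_by g y = z"
  then have "z \<otimes> g = g \<otimes> y \<otimes> inv g \<otimes> g" by (simp add: conj_by_def)
  then show "g \<otimes> y = z \<otimes> g" using assms by (simp add: m_assoc)
next
  assume "g \<otimes> y = z \<otimes> g"
  then show "conj_by g y = z" using assms by (simp add: conj_by_def m_assoc)
qed

lemma conj_by_inverse [simp]: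
  "g \<in> carrier G \<Longrightarrow> y \<in> carrier G \<Longrightarrow> conj_by (inv g) (conj_by g y) = y"
  by (simp add: conj_by_comp)

definition centralizer :: "'a set \<Rightarrow> 'a set"
  where "centralizer S = {g \<in> carrier G. \<forall>s\<in>S. g \<otimes> s = s \<otimes> g}"

lemma centralizer_subgroup:
  assumes "S \<subseteq> carrier G" shows "subgroup (centralizer S) G"
proof (rule subgroupI)
  show "centralizer S \<subseteq> carrier G" by (auto simp: centralizer_def)
  have "\<one> \<in> centralizer S" using assms by (auto simp: centralizer_def subset_iff)
  then show "centralizer S \<noteq> {}" by blast
  fix a assume a: "a \<in> centralizer S"
  then have ac: "a \<in> carrier G" by (simp add: centralizer_def)
  have "inv a \<otimes> s = s \<otimes> inv a" if s: "s \<in> S" for s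
  proof -
    have sc: "s \<in> carrier G" using s assms by blast
    have "conj_by a s = s" using a s ac sc by (simp add: conj_by_eq_iff centralizer_def)
    then have "conj_by (inv a) s = s" using conj_by_inverse[OF ac sc] by simp
    then show ?thesis using ac sc by (simp add: conj_by_eq_iff)
  qed
  then show "inv a \<in> centralizer S" using ac by (simp add: centralizer_def)
  fix b assume b: "b \<in> centralizer S"
  have "a \<otimes> b \<otimes> s = s \<otimes> (a \<otimes> b)" if s: "s \<in> S" for s
  proof -
    have c: "s \<in> carrier G" "b \<in> carrier G" using s b assms by (auto simp: centralizer_def)
    have "a \<otimes> b \<otimes> s = a \<otimes> (s \<otimes> b)" using b s c ac by (simp add: centralizer_def m_assoc)
    also have "\<dots> = (a \<otimes> s) \<otimes> b" using c ac by (simp add: m_assoc)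
    also have "\<dots> = s \<otimes> (a \<otimes> b)" using a s c ac by (simp add: centralizer_def m_assoc)
    finally show ?thesis .
  qed
  then show "a \<otimes> b \<in> centralizer S" using ac b by (simp add: centralizer_def)
qed

lemma centralizer_antimono: "S \<subseteq> S' \<Longrightarrow> centralizer S' \<subseteq> centralizer S"
  by (auto simp: centralizer_def)

lemma centralizer_conj:
  assumes S: "S \<subseteq> carrier G" "\<And>g s. g \<in> carrier G \<Longrightarrow> s \<in> S \<Longrightarrow> conj_by g s \<in> S"
    and g: "g \<in> carrier G" and c: "c \<in> centralizer S"
  shows "conj_by g c \<in> centralizer S"
proof -
  have cc: "c \<in> carrier G" using c by (simp add: centralizer_def)
  have "conj_by g c \<otimes> s = s \<otimes> conj_by g c" if s: "s \<in> S" for s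
  proof -
    have sc: "s \<in> carrier G" "conj_by (inv g) s \<in> S" using s S g by auto
    have s': "s = conj_by g (conj_by (inv g) s)" using conj_by_inverse[of "inv g" s] sc g by simp
    have "c \<otimes> conj_by (inv g) s = conj_by (inv g) s \<otimes> c" using c sc(2) by (simp add: centralizer_def)
    then have "conj_by g (c \<otimes> conj_by (inv g) s) = conj_by g (conj_by (inv g) s \<otimes> c)" by simp
    then show ?thesis using g cc sc by (simp add: conj_by_mult flip: s')
  qed
  then show ?thesis using cc g by (simp add: centralizer_def)
qed

definition commuting :: "'a set \<Rightarrow> bool"
  where "commuting S \<longleftrightarrow> S \<subseteq> carrier G \<and> (\<forall>a\<in>S. \<forall>b\<in>S. a \<otimes> b = b \<otimes> a)"

definition bicentralizer :: "'a set \<Rightarrow> 'a set"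
  where "bicentralizer S = centralizer (centralizer S)"

lemma bicentralizer_subgroup: "subgroup (bicentralizer S) G"
  unfolding bicentralizer_def by (rule centralizer_subgroup) (auto simp: centralizer_def)

lemma subset_bicentralizer: "S \<subseteq> carrier G \<Longrightarrow> S \<subseteq> bicentralizer S"
  by (auto simp: bicentralizer_def centralizer_def)

text \<open>A commuting \<open>S\<close> lies in its centraliser, so the bicentraliser is contained
  in the centraliser of \<open>S\<close>, and each element of the former commutes with all of the
  latter.\<close>

lemma commuting_bicentralizer:
  assumes "commuting S" shows "commuting (bicentralizer S)"
proof -
  have "S \<subseteq> centralizer S" using assms by (auto simp: commuting_def centralizer_def)
  then have "bicentralizer S \<subseteq> centralizer S" unfolding bicentralizer_def by (rule centralizer_antimono)
  then have "a \<otimes> b = b \<otimes> a" if "a \<in> bicentralizer S" "b \<in> bicentralizer S" for a b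
  proof -
    have "a \<in> centralizer (centralizer S)" "b \<in> centralizer S"
      using that \<open>bicentralizer S \<subseteq> centralizer S\<close> unfolding bicentralizer_def by auto
    then show ?thesis by (simp add: centralizer_def)
  qed
  then show ?thesis using subgroup.subset[OF bicentralizer_subgroup] by (simp add: commuting_def)
qed

lemma commutator_in_derived:
  assumes "a \<in> H" "b \<in> H"
  shows "a \<otimes> b \<otimes> inv a \<otimes> inv b \<in> derived G H"
  unfolding derived_def by (rule generate.incl) (use assms in blast)

lemma commutator_eq_one_iff:
  assumes "a \<in> carrier G" "b \<in> carrier G"
  shows "a \<otimes> b \<otimes> inv a \<otimes> inv b = \<one> \<longleftrightarrow> a \<otimes> b = b \<otimes> a"
  using assms conj_by_eq_iff[of a b b] by (simp add: conj_by_def mult_inv_eq_one_iff)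

lemma derived_trivial_imp_commuting:
  assumes "H \<subseteq> carrier G" "derived G H = {\<one>}" shows "commuting H"
  unfolding commuting_def
proof (intro conjI ballI)
  fix a b assume ab: "a \<in> H" "b \<in> H"
  then have "a \<otimes> b \<otimes> inv a \<otimes> inv b = \<one>" using commutator_in_derived[OF ab] assms(2) by blast
  then show "a \<otimes> b = b \<otimes> a" using commutator_eq_one_iff ab assms(1) by blast
qed (rule assms(1))

lemma commuting_imp_derived_trivial:
  assumes "commuting H" shows "derived G H = {\<one>}"
proof -
  have "derived_set G H \<subseteq> {\<one>}"
  proof
    fix z assume "z \<in> derived_set G H"
    then obtain a b where ab: "a \<in> H" "b \<in> H" "z = a \<otimes> b \<otimes> inv a \<otimes> inv b" by blast
    then have "a \<in> carrier G" "b \<in> carrier G" "a \<otimes> b = b \<otimes> a" using assms by (auto simp: commuting_def)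
    then show "z \<in> {\<one>}" using ab(3) commutator_eq_one_iff[of a b] by simp
  qed
  then have "derived G H \<subseteq> {\<one>}"
    unfolding derived_def by (intro generate_subgroup_incl triv_subgroup)
  moreover have "\<one> \<in> derived G H" unfolding derived_def by (rule generate.one)
  ultimately show ?thesis by blast
qed

text \<open>In a group with finite commutator subgroup every finite set has an infinite centraliser, so a
  maximal commuting set cannot be finite.\<close>

lemma finite_derived_infinite_commuting:
  assumes H: "subgroup H G" "infinite H" and fin: "finite (derived G H)"
  shows "\<exists>S\<subseteq>H. commuting S \<and> infinite S"
proof -
  have HG: "\<And>x. x \<in> H \<Longrightarrow> x \<in> carrier G" using subgroup.mem_carrier[OF H(1)] .
  let ?A = "{S. S \<subseteq> H \<and> commuting S}"
  have "\<exists>M\<in>?A. \<forall>X\<in>?A. M \<subseteq> X \<longrightarrow> X = M"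
  proof (rule subset_Zorn')
    fix \<C> assume ch: "subset.chain ?A \<C>"
    have C: "\<And>S. S \<in> \<C> \<Longrightarrow> S \<subseteq> H \<and> commuting S" "\<And>R S. R \<in> \<C> \<Longrightarrow> S \<in> \<C> \<Longrightarrow> R \<subseteq> S \<or> S \<subseteq> R"
      using ch by (auto simp: subset_chain_def)
    have "a \<otimes> b = b \<otimes> a" if ab: "a \<in> \<Union>\<C>" "b \<in> \<Union>\<C>" for a b
    proof -
      obtain R S where RS: "R \<in> \<C>" "S \<in> \<C>" "a \<in> R" "b \<in> S" using ab by blast
      then obtain Q where "Q \<in> \<C>" "a \<in> Q" "b \<in> Q"
        using C(2)[OF RS(1,2)] by (cases "R \<subseteq> S") auto
      then show ?thesis using C(1)[of Q] by (simp add: commuting_def)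
    qed
    moreover have "\<Union>\<C> \<subseteq> H" using C(1) by fast
    ultimately show "\<Union>\<C> \<in> ?A" using HG by (auto simp: commuting_def)
  qed
  then obtain M where "M \<in> ?A" and max: "\<forall>X\<in>?A. M \<subseteq> X \<longrightarrow> X = M" ..
  then have M: "M \<subseteq> H" "commuting M" by simp_all
  have "infinite M"
  proof
    assume finM: "finite M"
    \<comment> \<open>A record of the commutators of \<open>h\<close> with the members of
      \<open>M\<close>. Only finitely many records are possible, and two elements with equal records
      differ by an element centralising \<open>M\<close>.\<close>
    define f where "f = (\<lambda>h. \<lambda>m\<in>M. h \<otimes> m \<otimes> inv h \<otimes> inv m)"
    have "f ` H \<subseteq> M \<rightarrow>\<^sub>E derived G H"
      unfolding f_def using M(1) commutator_in_derived[of _ H] by auto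
    moreover have "finite (M \<rightarrow>\<^sub>E derived G H)" using finM fin by (rule finite_PiE)
    ultimately have "finite (f ` H)" by (rule finite_subset)
    from pigeonhole_infinite[OF H(2) this]
    obtain a where a: "a \<in> H" "infinite {h \<in> H. f h = f a}" by blast
    have "(\<lambda>h. inv a \<otimes> h) ` {h \<in> H. f h = f a} \<subseteq> {h \<in> H. h \<in> centralizer M}"
    proof
      fix z assume "z \<in> (\<lambda>h. inv a \<otimes> h) ` {h \<in> H. f h = f a}"
      then obtain h where h: "h \<in> H" "f h = f a" "z = inv a \<otimes> h" by blast
      have "z \<otimes> m = m \<otimes> z" if m: "m \<in> M" for m
      proof -
        have c: "m \<in> carrier G" "h \<in> carrier G" "a \<in> carrier G" using m M(1) HG h a by auto
        have "f h m = f a m" using h by simp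
        then have "conj_by h m \<otimes> inv m = conj_by a m \<otimes> inv m" using m by (simp add: f_def conj_by_def)
        then have "conj_by h m = conj_by a m" using c by simp
        then have "conj_by (inv a) (conj_by h m) = m" using c by simp
        then have "conj_by z m = m" unfolding h(3) using c by (simp add: conj_by_comp)
        then show ?thesis using c h(3) by (simp add: conj_by_eq_iff)
      qed
      moreover have "z \<in> H" using h a subgroup.m_closed[OF H(1)] subgroup.m_inv_closed[OF H(1)] by blast
      ultimately show "z \<in> {h \<in> H. h \<in> centralizer M}" using HG by (simp add: centralizer_def)
    qed
    moreover have "inj_on (\<lambda>h. inv a \<otimes> h) {h \<in> H. f h = f a}"
      using HG a by (intro inj_onI) simp
    ultimately have "infinite {h \<in> H. h \<in> centralizer M}"
      using a(2) by (meson finite_imageD finite_subset)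
    then obtain h where h: "h \<in> H" "h \<in> centralizer M" "h \<notin> M"
      by (metis (no_types, lifting) finM finite_subset mem_Collect_eq subsetI)
    have "commuting (insert h M)" using h M HG by (auto simp: commuting_def centralizer_def)
    then have "insert h M \<in> ?A" using h(1) M(1) by simp
    then have "insert h M = M" using max by blast
    then show False using h(3) by blast
  qed
  then show ?thesis using M by blast
qed

text \<open>The last infinite term of the derived series has a finite commutator subgroup.\<close>

lemma infinite_solvable_infinite_commuting:
  assumes "solvable G" "infinite (carrier G)"
  shows "\<exists>S. commuting S \<and> infinite S"
proof -
  define D where "D = (\<lambda>n. (derived G ^^ n) (carrier G))"
  obtain n where n: "D n = {\<one>}" using assms(1) solvable_iff_trivial_derived_seq unfolding D_def by blast
  define m where "m = (LEAST m. finite (D m))"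
  have fm: "finite (D m)" unfolding m_def by (rule LeastI[of _ n]) (simp add: n)
  have "m \<noteq> 0" using fm assms(2) by (auto simp: D_def intro: ccontr)
  then obtain k where k: "m = Suc k" by (cases m) auto
  have "infinite (D k)" using not_less_Least[of k "\<lambda>m. finite (D m)"] k unfolding m_def by simp
  moreover have "finite (derived G (D k))" using fm unfolding k D_def by simp
  moreover have "subgroup (D k) G" unfolding D_def by (rule exp_of_derived_is_subgroup[OF subgroup_self])
  ultimately show ?thesis using finite_derived_infinite_commuting by blast
qed

lemma exp_of_derived_conj:
  assumes "g \<in> carrier G" "y \<in> (derived G ^^ n) (carrier G)"
  shows "conj_by g y \<in> (derived G ^^ n) (carrier G)"
proof -
  have "(derived G ^^ n) (carrier G) \<lhd> G"
    by (induction n) (auto intro: derived_is_normal normal_self)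
  then show ?thesis using assms unfolding conj_by_def normal_inv_iff by blast
qed

text \<open>Climb the derived series from its trivial term: in a torsion-free abelian term an element equals
  its conjugates as soon as some power of it is central.\<close>

lemma torsion_free_mod_center_commuting:
  assumes C: "subgroup C G" and tf: "\<And>y n. y \<in> C \<Longrightarrow> n > 0 \<Longrightarrow> y [^] (n::nat) = \<one> \<Longrightarrow> y = \<one>"
    and cent: "\<And>y. y \<in> C \<Longrightarrow> \<exists>n>0. \<forall>z\<in>C. y [^] (n::nat) \<otimes> z = z \<otimes> y [^] n"
    and triv: "(derived G ^^ n) C = {\<one>}"
  shows "commuting C"
proof -
  define E where "E = (\<lambda>i. (derived G ^^ i) C)"
  have CG: "\<And>x. x \<in> C \<Longrightarrow> x \<in> carrier G" using subgroup.mem_carrier[OF C] .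
  have Esub: "subgroup (E i) G" for i unfolding E_def by (rule exp_of_derived_is_subgroup[OF C])
  have EC: "E i \<subseteq> C" for i
  proof (induction i)
    case (Suc i)
    then show ?case unfolding E_def using derived_incl[OF _ C] by simp
  qed (simp add: E_def)
  have step: "commuting (E i)" if comm: "commuting (E (Suc i))" for i
  proof -
    have E': "E (Suc i) = derived G (E i)" by (simp add: E_def)
    \<comment> \<open>The element \<open>conj_by x b \<otimes> inv b\<close> lies in the abelian
      term \<open>E (Suc i)\<close>. Some \<open>b [^] n\<close> is central in \<open>C\<close>, so
      its \<open>n\<close>-th power is trivial, and torsion-freeness makes it trivial.\<close>
    have central: "x \<otimes> b = b \<otimes> x" if xb: "x \<in> E i" "b \<in> E (Suc i)" for x b
    proof -
      have c: "x \<in> C" "b \<in> C" "x \<in> carrier G" "b \<in> carrier G" using xb EC CG by blast+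
      have bE: "b \<in> E i" using xb(2) derived_incl[OF subset_refl Esub[of i]] unfolding E' by blast
      have "x \<otimes> b \<otimes> inv x \<otimes> inv b \<in> E (Suc i)" unfolding E' by (rule commutator_in_derived[OF xb(1) bE])
      then have "(x \<otimes> b \<otimes> inv x \<otimes> inv b) \<otimes> b \<in> E (Suc i)" using xb(2) subgroup.m_closed[OF Esub] by blast
      then have cE: "conj_by x b \<in> E (Suc i)" using c by (simp add: conj_by_def m_assoc)
      obtain n :: nat where n: "n > 0" "\<forall>z\<in>C. b [^] n \<otimes> z = z \<otimes> b [^] n" using cent c by blast
      have pw: "conj_by x b [^] n = b [^] n"
        using n(2) c by (simp add: conj_by_nat_pow[symmetric] conj_by_eq_iff)
      have ib: "inv b \<in> E (Suc i)" using xb(2) subgroup.m_inv_closed[OF Esub] by blast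
      have "conj_by x b \<otimes> inv b = inv b \<otimes> conj_by x b" using comm cE ib by (simp add: commuting_def)
      then have "(conj_by x b \<otimes> inv b) [^] n = conj_by x b [^] n \<otimes> inv b [^] n"
        using c by (intro pow_mult_distrib) auto
      then have "(conj_by x b \<otimes> inv b) [^] n = \<one>" using c pw by (simp add: nat_pow_inv)
      moreover have "conj_by x b \<otimes> inv b \<in> C" using cE ib subgroup.m_closed[OF Esub] EC by blast
      ultimately have "conj_by x b \<otimes> inv b = \<one>" using tf n(1) by blast
      then have "conj_by x b = b" using c by (simp add: mult_inv_eq_one_iff)
      then show ?thesis using c by (simp add: conj_by_eq_iff)
    qed
    have "x \<otimes> y = y \<otimes> x" if xy: "x \<in> E i" "y \<in> E i" for x y
    proof -
      have c: "x \<in> C" "y \<in> C" "x \<in> carrier G" "y \<in> carrier G" using xy EC CG by blast+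
      \<comment> \<open>The commutator \<open>k\<close> commutes with \<open>y\<close> by
        \<open>central\<close>, so conjugating \<open>y [^] n\<close> by \<open>x\<close> multiplies
        it by \<open>k [^] n\<close>. For central \<open>y [^] n\<close> this factor is trivial, and
        torsion-freeness removes \<open>k\<close>.\<close>
      define k where "k = x \<otimes> y \<otimes> inv x \<otimes> inv y"
      have kE: "k \<in> E (Suc i)" unfolding E' k_def by (rule commutator_in_derived[OF xy])
      have kc: "k \<in> carrier G" "k \<in> C" using kE EC CG by blast+
      obtain n :: nat where n: "n > 0" "\<forall>z\<in>C. y [^] n \<otimes> z = z \<otimes> y [^] n" using cent c by blast
      have ky: "conj_by x y = k \<otimes> y" unfolding k_def conj_by_def using c by (simp add: m_assoc)
      have "k \<otimes> y = y \<otimes> k" using central[OF xy(2) kE] by simp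
      then have "conj_by x y [^] n = k [^] n \<otimes> y [^] n" unfolding ky using kc c by (intro pow_mult_distrib) auto
      moreover have "conj_by x y [^] n = y [^] n"
        using n(2) c by (simp add: conj_by_nat_pow[symmetric] conj_by_eq_iff)
      ultimately have "k [^] n = \<one>" using kc c by (metis nat_pow_closed r_cancel_one')
      then have "k = \<one>" using tf kc n(1) by blast
      then show ?thesis unfolding k_def using commutator_eq_one_iff c by blast
    qed
    then show ?thesis using subgroup.subset[OF Esub] by (auto simp: commuting_def)
  qed
  have "commuting (E (n - i))" for i
  proof (induction i)
    case 0
    then show ?case using triv by (simp add: E_def commuting_def)
  next
    case (Suc i)
    show ?case
    proof (cases "i < n")
      case True
      then have "n - i = Suc (n - Suc i)" by simp
      then show ?thesis using Suc step by metis
    next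
      case False
      then show ?thesis using Suc by simp
    qed
  qed
  from this[of n] show ?thesis by (simp add: E_def)
qed

end

section \<open>Solvable groups\<close>

lemma (in hausdorff_group) centralizer_closed:
  assumes "S \<subseteq> carrier G"
  shows "closedin T (centralizer S)"
proof -
  have "closedin T {g \<in> carrier G. g \<otimes> s = s \<otimes> g}" if s: "s \<in> S" for s
  proof -
    have sc: "s \<in> carrier G" using s assms by blast
    have "closedin T {\<one>}" using closedin_Hausdorff_singleton[OF Hausdorff] by simp
    then have "closedin T {g \<in> carrier G. (g \<otimes> s) \<otimes> inv (s \<otimes> g) \<in> {\<one>}}"
      by (rule closed_vimage) (intro cont_intros sc)
    moreover have "{g \<in> carrier G. (g \<otimes> s) \<otimes> inv (s \<otimes> g) \<in> {\<one>}} = {g \<in> carrier G. g \<otimes> s = s \<otimes> g}"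
      using sc by (auto simp: mult_inv_eq_one_iff)
    ultimately show ?thesis by simp
  qed
  \<comment> \<open>The whole space is added so that the intersected family is nonempty when
    \<open>S\<close> is empty.\<close>
  then have "closedin T (\<Inter>(insert (topspace T) ((\<lambda>s. {g \<in> carrier G. g \<otimes> s = s \<otimes> g}) ` S)))"
    using closedin_topspace[of T] by (intro closedin_Inter) auto
  moreover have "\<Inter>(insert (topspace T) ((\<lambda>s. {g \<in> carrier G. g \<otimes> s = s \<otimes> g}) ` S)) = centralizer S"
    by (auto simp: centralizer_def)
  ultimately show ?thesis by simp
qed

lemma (in group) inf_order_subgroup_iff:
  assumes "subgroup H G"
  shows "group.inf_order (G\<lparr>carrier := H\<rparr>) x \<longleftrightarrow> x \<in> H \<and> inf_order x"
proof -
  interpret H: group "G\<lparr>carrier := H\<rparr>" by (rule subgroup.subgroup_is_group[OF assms is_group])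
  show ?thesis
    using subgroup.mem_carrier[OF assms] unfolding H.inf_order_def inf_order_def
    by (auto simp flip: nat_pow_consistent)
qed

text \<open>The order of \<open>x\<close> modulo the \<open>p ^ k\<close>-th powers is exactly
  \<open>p ^ k\<close>. If \<open>m\<close> contained only a smaller power of \<open>p\<close>,
  cancelling it would make a prime-to-\<open>p\<close> power of \<open>x\<close> a
  \<open>p\<close>-th power, and by Bezout \<open>x\<close> itself.\<close>

lemma (in hm_lca_group) padic_pow_in_powers:
  assumes px: "padic_generator p x" and m: "x [^] (m::nat) \<in> powers (p ^ k)"
  shows "p ^ k dvd m"
proof (cases "m = 0")
  case False
  have p: "prime p" and x: "inf_order x" "x \<notin> powers p" and xc: "x \<in> carrier G"
    using px unfolding padic_generator_def inf_order_def by auto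
  have p0: "p > 0" using prime_gt_0_nat[OF p] .
  obtain a m' where am: "m = p ^ a * m'" "\<not> p dvd m'"
    using prime_power_canonical[OF p, of m] False by (metis mult.commute neq0_conv)
  have "k \<le> a"
  proof (rule ccontr)
    assume "\<not> k \<le> a"
    then have k: "k = a + (k - a)" "k - a > 0" by auto
    obtain z where z: "z \<in> carrier G" "x [^] m = z [^] (p ^ k)" using m by (auto simp: powers_def)
    have "p ^ k = p ^ (k - a) * p ^ a" using k by (metis add.commute power_add)
    then have "(x [^] m') [^] (p ^ a) = (z [^] (p ^ (k - a))) [^] (p ^ a)"
      using z am(1) xc by (simp add: nat_pow_pow mult.commute)
    then have "x [^] m' = z [^] (p ^ (k - a))"
      using power_inj[OF x(1), of "x [^] m'" "z [^] (p ^ (k - a))" "p ^ a"] xc z(1) p0 by simp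
    then have "x [^] m' \<in> powers (p ^ (k - a))" using z(1) by (auto simp: powers_def)
    then have "x [^] m' \<in> powers p" using powers_dvd[of p "p ^ (k - a)"] k(2) by auto
    moreover have "x [^] p \<in> powers p" using xc by (auto simp: powers_def)
    moreover have "coprime m' p" using am(2) p by (metis coprime_commute prime_imp_coprime)
    ultimately show False using coprime_powers_in_subgroup[OF powers_subgroup xc] x(2) by blast
  qed
  then show ?thesis using am(1) by (simp add: le_imp_power_dvd)
qed simp

locale hm_lc_group = hm_group +
  assumes lc: "locally_compact_space T"
begin

lemma bicentralizer_closed: "closedin T (bicentralizer S)"
  unfolding bicentralizer_def by (rule centralizer_closed) (auto simp: centralizer_def)

lemma commuting_subgroup_lca:
  "subgroup H G \<Longrightarrow> closedin T H \<Longrightarrow> commuting H \<Longrightarrow> hm_lca_group (G\<lparr>carrier := H\<rparr>) (subtopology T H)"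
  by (intro sub_hm_lca_group lc) (auto simp: commuting_def)

lemma commuting_subgroup_compact:
  assumes "subgroup H G" "closedin T H" "commuting H"
  shows "compactin T H"
proof -
  interpret H: hm_lca_group "G\<lparr>carrier := H\<rparr>" "subtopology T H" by (rule commuting_subgroup_lca[OF assms])
  show ?thesis using H.compact closedin_subset[OF assms(2)] by (simp add: compactin_subspace)
qed

lemma infinite_commuting_subgroup_inf_order:
  assumes "subgroup H G" "closedin T H" "commuting H" "infinite H"
  shows "\<exists>x\<in>H. inf_order x"
proof -
  interpret H: hm_lca_group "G\<lparr>carrier := H\<rparr>" "subtopology T H" by (rule commuting_subgroup_lca[OF assms(1-3)])
  have "\<exists>x. H.inf_order x" using H.torsion_imp_finite assms(4) by auto
  then show ?thesis using inf_order_subgroup_iff[OF assms(1)] by blast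
qed

text \<open>The bicentraliser of \<open>S\<close> is a closed abelian subgroup, so it is
  torsion-free once it has an element of infinite order. This serves sets such as
  \<open>{z, a}\<close> and \<open>insert y N\<close>, which need not be subgroups.\<close>

lemma commuting_inf_order:
  assumes S: "commuting S" and x: "x \<in> S" "inf_order x" and y: "y \<in> S" "y \<noteq> \<one>"
  shows "inf_order y"
proof -
  let ?B = "bicentralizer S"
  interpret B: hm_lca_group "G\<lparr>carrier := ?B\<rparr>" "subtopology T ?B"
    by (rule commuting_subgroup_lca[OF bicentralizer_subgroup bicentralizer_closed commuting_bicentralizer[OF S]])
  have "S \<subseteq> ?B" using S by (intro subset_bicentralizer) (simp add: commuting_def)
  then show ?thesis
    using B.inf_order_of_ne_one[of x y] inf_order_subgroup_iff[OF bicentralizer_subgroup[of S]] x y by auto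
qed

lemma commuting_power_in:
  assumes S: "commuting S" and x: "x \<in> S" "inf_order x" and y: "y \<in> S" and L: "subgroup L G" "closedin T L" "x \<in> L"
  shows "\<exists>m>0. y [^] (m::nat) \<in> L"
proof -
  let ?B = "bicentralizer S"
  interpret B: hm_lca_group "G\<lparr>carrier := ?B\<rparr>" "subtopology T ?B"
    by (rule commuting_subgroup_lca[OF bicentralizer_subgroup bicentralizer_closed commuting_bicentralizer[OF S]])
  have SB: "S \<subseteq> ?B" using S by (intro subset_bicentralizer) (simp add: commuting_def)
  have "subgroup (L \<inter> ?B) G" by (rule subgroups_Inter_pair[OF L(1) bicentralizer_subgroup])
  then have 1: "subgroup (L \<inter> ?B) (G\<lparr>carrier := ?B\<rparr>)"
    by (rule subgroup_incl[OF _ bicentralizer_subgroup]) simp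
  have 2: "closedin (subtopology T ?B) (L \<inter> ?B)" using L(2) by (auto simp: closedin_subtopology)
  have "B.inf_order x" using inf_order_subgroup_iff[OF bicentralizer_subgroup] x SB by blast
  from B.power_in_closed_subgroup[OF this 1 2, of y] show ?thesis
    using L(3) x y SB by (auto simp flip: nat_pow_consistent)
qed

text \<open>Conjugation by the powers of \<open>x\<close> induces only finitely many maps on
  \<open>A\<close>, so a positive power of \<open>x\<close> commutes with all of \<open>A\<close>.
  That power has infinite order, so every nontrivial element of \<open>A\<close> would have infinite
  order as well. This makes the last nontrivial term of the derived series infinite.\<close>

lemma finite_invariant_subgroup_trivial:
  assumes x: "inf_order x" and A: "subgroup A G" "finite A"
    and inv: "\<And>g a. g \<in> carrier G \<Longrightarrow> a \<in> A \<Longrightarrow> conj_by g a \<in> A"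
  shows "A = {\<one>}"
proof -
  have AG: "\<And>a. a \<in> A \<Longrightarrow> a \<in> carrier G" using subgroup.mem_carrier[OF A(1)] .
  have xc: "x \<in> carrier G" using x by (simp add: inf_order_def)
  define f where "f = (\<lambda>n::nat. \<lambda>a\<in>A. conj_by (x [^] n) a)"
  have "range f \<subseteq> A \<rightarrow>\<^sub>E A" unfolding f_def using inv xc by auto
  moreover have "finite (A \<rightarrow>\<^sub>E A)" using A(2) by (simp add: finite_PiE)
  ultimately have "\<not> inj f" by (meson finite_imageD finite_subset infinite_UNIV_nat)
  then obtain i j where ij: "i < j" "f i = f j" unfolding inj_def by (metis linorder_neqE_nat)
  have "a = \<one>" if a: "a \<in> A" for a
  proof (rule ccontr)
    assume "a \<noteq> \<one>"
    have ac: "a \<in> carrier G" using AG a .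
    define z where "z = x [^] (j - i)"
    have zc: "z \<in> carrier G" using xc by (simp add: z_def)
    have "f i a = f j a" using ij by simp
    then have "conj_by (x [^] i) a = conj_by (x [^] j) a" using a by (simp add: f_def)
    also have "x [^] j = x [^] i \<otimes> z" unfolding z_def using xc ij(1) by (simp add: nat_pow_mult)
    also have "conj_by (x [^] i \<otimes> z) a = conj_by (x [^] i) (conj_by z a)" using xc zc ac by (simp add: conj_by_comp)
    finally have "conj_by (inv (x [^] i)) (conj_by (x [^] i) a) = conj_by (inv (x [^] i)) (conj_by (x [^] i) (conj_by z a))"
      by simp
    then have "conj_by z a = a" using xc zc ac by simp
    then have za: "z \<otimes> a = a \<otimes> z" using zc ac by (simp add: conj_by_eq_iff)
    have "commuting {z, a}" using za zc ac by (auto simp: commuting_def)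
    moreover have "inf_order z"
      unfolding inf_order_def
    proof (intro conjI allI impI zc)
      fix n :: nat assume "n > 0"
      then show "z [^] n \<noteq> \<one>" using x ij(1) xc unfolding z_def inf_order_def by (simp add: nat_pow_pow)
    qed
    ultimately have "inf_order a" using commuting_inf_order[of "{z, a}" z a] \<open>a \<noteq> \<one>\<close> by blast
    then have "infinite (generate G {a})" by (rule inf_order_infinite_generate)
    moreover have "generate G {a} \<subseteq> A" using a by (intro generate_subgroup_incl A(1)) simp
    ultimately show False using A(2) finite_subset by blast
  qed
  then show ?thesis using subgroup.one_closed[OF A(1)] by blast
qed

end

text \<open>\<open>C\<close> is a copy of the \<open>p\<close>-adic integers, topologically generated by \<open>x\<close>, which is normal and
  its own centraliser; \<open>G / C\<close> then acts on it faithfully by \<open>p\<close>-adic units.\<close>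

locale padic_normal_subgroup = hm_lc_group +
  fixes C p x
  assumes C: "subgroup C G" "compactin T C" "commuting C" "centralizer C = C"
    and normal: "\<And>g c. g \<in> carrier G \<Longrightarrow> c \<in> C \<Longrightarrow> conj_by g c \<in> C"
    and p: "prime (p::nat)" and x: "x \<in> C"
    and cosets: "\<And>k y. y \<in> C \<Longrightarrow> \<exists>i::nat. i < p ^ k \<and> (\<exists>z\<in>C. y = x [^] i \<otimes> z [^] (p ^ k))"
    and pow_in: "\<And>m k z. z \<in> C \<Longrightarrow> x [^] (m::nat) = z [^] (p ^ k) \<Longrightarrow> p ^ k dvd m"
    and Inter: "\<And>y. (\<And>k. y \<in> (\<lambda>c. c [^] (p ^ k)) ` C) \<Longrightarrow> y = \<one>"
begin

lemma CG [simp]: "c \<in> C \<Longrightarrow> c \<in> carrier G"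
  using subgroup.mem_carrier[OF C(1)] .

lemma C_comm: "a \<in> C \<Longrightarrow> b \<in> C \<Longrightarrow> a \<otimes> b = b \<otimes> a"
  using C(3) by (simp add: commuting_def)

section \<open>The filtration of C by p^k-th powers and the action of G on it\<close>

definition P :: "nat \<Rightarrow> 'a set"
  where "P k = (\<lambda>c. c [^] (p ^ k)) ` C"

lemma P_subset: "P k \<subseteq> C"
  using subgroup_nat_pow_closed[OF C(1)] by (auto simp: P_def)

lemma P_subgroup: "subgroup (P k) G"
  unfolding P_def by (rule power_image_subgroup[OF C(1) C_comm])

lemma P_closed: "closedin T (P k)"
  unfolding P_def by (rule power_image_closed[OF C(2)])

lemma P_conj: "g \<in> carrier G \<Longrightarrow> w \<in> P k \<Longrightarrow> conj_by g w \<in> P k"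
  using normal by (auto simp: P_def conj_by_nat_pow)

lemma P_antimono: "k \<le> l \<Longrightarrow> P l \<subseteq> P k"
proof
  fix y assume kl: "k \<le> l" and "y \<in> P l"
  then obtain c where c: "c \<in> C" "y = c [^] (p ^ l)" by (auto simp: P_def)
  have "p ^ l = p ^ (l - k) * p ^ k" using kl by (simp flip: power_add)
  then have "y = (c [^] (p ^ (l - k))) [^] (p ^ k)" using c by (simp add: nat_pow_pow)
  then show "y \<in> P k" using subgroup_nat_pow_closed[OF C(1) c(1)] by (auto simp: P_def)
qed

lemma int_pow_in_P: "y \<in> C \<Longrightarrow> int (p ^ k) dvd m \<Longrightarrow> y [^] (m::int) \<in> P k"
proof -
  assume y: "y \<in> C" and "int (p ^ k) dvd m"
  then obtain n where "m = n * int (p ^ k)" by (metis dvdE mult.commute)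
  then have "y [^] m = (y [^] n) [^] (p ^ k)" using y by (simp add: int_pow_pow flip: int_pow_int)
  then show ?thesis using subgroup_int_pow_closed[OF C(1) y] by (auto simp: P_def)
qed

text \<open>The integer \<open>u\<close> represents, modulo \<open>p ^ k\<close>, the
  \<open>p\<close>-adic unit by which \<open>g\<close> acts on \<open>C\<close>: conjugation is the
  \<open>u\<close>-th power map modulo \<open>P k\<close>. One integer for each level takes the
  place of an inverse limit.\<close>

definition act :: "'a \<Rightarrow> int \<Rightarrow> nat \<Rightarrow> bool"
  where "act g u k \<longleftrightarrow> (\<forall>y\<in>C. \<exists>w\<in>P k. conj_by g y = y [^] u \<otimes> w)"

text \<open>It suffices to test the topological generator \<open>x\<close>: modulo
  \<open>P k\<close> every element of \<open>C\<close> is a power of \<open>x\<close>, and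
  \<open>P k\<close> is stable under conjugation.\<close>

lemma actI:
  assumes g: "g \<in> carrier G" and l: "l \<in> P k" and eq: "conj_by g x = x [^] u \<otimes> l"
  shows "act g u k"
  unfolding act_def
proof
  fix y assume "y \<in> C"
  then obtain i :: nat and z where iz: "z \<in> C" "y = x [^] i \<otimes> z [^] (p ^ k)" using cosets by blast
  define b where "b = z [^] (p ^ k)"
  define d where "d = conj_by g b"
  have b: "b \<in> P k" unfolding b_def using iz by (auto simp: P_def)
  have d: "d \<in> P k" unfolding d_def using P_conj[OF g b] .
  note PC = subsetD[OF P_subset]
  have cl: "b \<in> C" "d \<in> C" "l \<in> C" "x [^] u \<in> C" "x [^] i \<in> C"
    using b d l PC subgroup_int_pow_closed[OF C(1) x] subgroup_nat_pow_closed[OF C(1) x] by auto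
  have "conj_by g y = (x [^] u \<otimes> l) [^] i \<otimes> d"
    unfolding iz(2) b_def[symmetric] d_def using g x cl by (simp add: conj_by_mult conj_by_nat_pow eq)
  also have "(x [^] u \<otimes> l) [^] i = (x [^] u) [^] i \<otimes> l [^] i"
    using cl C_comm by (intro pow_mult_distrib) auto
  also have "(x [^] u) [^] i = (x [^] i) [^] u"
    using x by (simp add: int_pow_pow mult.commute flip: int_pow_int)
  finally have 1: "conj_by g y = (x [^] i) [^] u \<otimes> (l [^] i \<otimes> d)"
    using cl x by (simp add: m_assoc)
  have 2: "y [^] u = (x [^] i) [^] u \<otimes> b [^] u"
    unfolding iz(2) b_def[symmetric] using cl C_comm by (intro int_pow_mult_distrib) auto
  have "conj_by g y = y [^] u \<otimes> (inv (b [^] u) \<otimes> (l [^] i \<otimes> d))"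
    unfolding 1 2 using cl by (simp add: m_assoc mult_inv_mult_cancel)
  moreover have "inv (b [^] u) \<otimes> (l [^] i \<otimes> d) \<in> P k"
    using b l d subgroup.m_closed[OF P_subgroup] subgroup.m_inv_closed[OF P_subgroup]
      subgroup_int_pow_closed[OF P_subgroup] subgroup_nat_pow_closed[OF P_subgroup] by simp
  ultimately show "\<exists>w\<in>P k. conj_by g y = y [^] u \<otimes> w" by blast
qed

lemma act_exists:
  assumes g: "g \<in> carrier G" shows "\<exists>i::nat. i < p ^ k \<and> act g (int i) k"
proof -
  obtain i z where iz: "i < p ^ k" "z \<in> C" "conj_by g x = x [^] i \<otimes> z [^] (p ^ k)"
    using cosets[OF normal[OF g x]] by blast
  then have "act g (int i) k" by (intro actI[OF g, of "z [^] (p ^ k)"]) (auto simp: P_def int_pow_int)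
  then show ?thesis using iz(1) by blast
qed

lemma act_mult:
  assumes g: "g \<in> carrier G" and h: "h \<in> carrier G" and "act g u k" "act h v k"
  shows "act (g \<otimes> h) (u * v) k"
  unfolding act_def
proof
  fix y assume y: "y \<in> C"
  obtain w where w: "w \<in> P k" "conj_by h y = y [^] v \<otimes> w" using assms(4) y by (auto simp: act_def)
  obtain w' where w': "w' \<in> P k" "conj_by g y = y [^] u \<otimes> w'" using assms(3) y by (auto simp: act_def)
  note PC = subsetD[OF P_subset]
  have c: "w \<in> C" "w' \<in> C" "conj_by g w \<in> C" "y [^] u \<in> C"
    using w w' PC normal[OF g] subgroup_int_pow_closed[OF C(1) y] by auto
  have "conj_by (g \<otimes> h) y = conj_by g (y [^] v \<otimes> w)" using g h y w(2) by (simp add: conj_by_comp[symmetric])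
  also have "\<dots> = (y [^] u \<otimes> w') [^] v \<otimes> conj_by g w"
    using g y c w'(2) by (simp add: conj_by_mult conj_by_int_pow)
  also have "(y [^] u \<otimes> w') [^] v = (y [^] u) [^] v \<otimes> w' [^] v"
    using c C_comm by (intro int_pow_mult_distrib) auto
  also have "(y [^] u) [^] v = y [^] (u * v)" using y by (simp add: int_pow_pow)
  finally have "conj_by (g \<otimes> h) y = y [^] (u * v) \<otimes> (w' [^] v \<otimes> conj_by g w)"
    using y c g by (simp add: m_assoc)
  moreover have "w' [^] v \<otimes> conj_by g w \<in> P k"
    using w w' P_conj[OF g] subgroup.m_closed[OF P_subgroup] subgroup_int_pow_closed[OF P_subgroup] by simp
  ultimately show "\<exists>w\<in>P k. conj_by (g \<otimes> h) y = y [^] (u * v) \<otimes> w" by blast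
qed

lemma act_one: "act \<one> 1 k"
  using x subgroup.one_closed[OF P_subgroup] by (intro actI[of \<one> \<one>]) auto

lemma act_pow:
  assumes g: "g \<in> carrier G" and "act g u k"
  shows "act (g [^] (n::nat)) (u ^ n) k"
proof (induction n)
  case 0
  then show ?case using act_one by simp
next
  case (Suc n)
  then show ?case using act_mult[OF _ g Suc assms(2)] g by (simp add: mult.commute)
qed

lemma act_mono:
  assumes "act g u l" "k \<le> l" shows "act g u k"
  using assms P_antimono[OF assms(2)] unfolding act_def by blast

lemma act_cong:
  assumes g: "g \<in> carrier G" and "act g u k" "int (p ^ k) dvd u - v"
  shows "act g v k"
proof -
  obtain w where w: "w \<in> P k" "conj_by g x = x [^] u \<otimes> w" using assms(2) x by (auto simp: act_def)
  have "x [^] (u - v) \<in> P k" using int_pow_in_P[OF x assms(3)] .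
  then have "x [^] (u - v) \<otimes> w \<in> P k" using w(1) subgroup.m_closed[OF P_subgroup] by blast
  moreover have "x [^] u = x [^] v \<otimes> x [^] (u - v)" using x by (simp flip: int_pow_mult)
  then have "conj_by g x = x [^] v \<otimes> (x [^] (u - v) \<otimes> w)"
    using w x subsetD[OF P_subset w(1)] by (simp add: m_assoc)
  ultimately show ?thesis using actI[OF g] by blast
qed

lemma act_unique:
  assumes g: "g \<in> carrier G" and "act g u k" "act g v k"
  shows "int (p ^ k) dvd u - v"
proof -
  obtain w where w: "w \<in> P k" "conj_by g x = x [^] u \<otimes> w" using assms(2) x by (auto simp: act_def)
  obtain w' where w': "w' \<in> P k" "conj_by g x = x [^] v \<otimes> w'" using assms(3) x by (auto simp: act_def)
  have c: "w \<in> carrier G" "w' \<in> carrier G" "x \<in> carrier G"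
    using w(1) w'(1) x subsetD[OF P_subset] by auto
  have "x [^] v \<otimes> (x [^] (u - v) \<otimes> w) = x [^] v \<otimes> w'"
    using w w' c by (simp add: m_assoc[symmetric] flip: int_pow_mult)
  then have "x [^] (u - v) \<otimes> w = w'" using c by simp
  then have "x [^] (u - v) = w' \<otimes> inv w" using c by (metis int_pow_closed inv_solve_right)
  then have "x [^] (u - v) \<in> P k"
    using w(1) w'(1) subgroup.m_closed[OF P_subgroup] subgroup.m_inv_closed[OF P_subgroup] by metis
  then have "x [^] nat \<bar>u - v\<bar> \<in> P k" by (intro nat_pow_abs_in_subgroup[OF P_subgroup]) (use c in auto)
  then obtain z where "z \<in> C" "x [^] nat \<bar>u - v\<bar> = z [^] (p ^ k)" by (auto simp: P_def)
  then have "p ^ k dvd nat \<bar>u - v\<bar>" by (rule pow_in)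
  then have "int (p ^ k) dvd int (nat \<bar>u - v\<bar>)" by (simp only: int_dvd_int_iff)
  then show ?thesis by simp
qed

text \<open>The residues at all levels determine the action, because the subgroups
  \<open>P k\<close> intersect trivially.\<close>

lemma same_act_imp_eq:
  assumes g: "g \<in> carrier G" and h: "h \<in> carrier G"
    and act: "\<And>k. \<exists>u. act g u k \<and> act h u k" and y: "y \<in> C"
  shows "conj_by g y = conj_by h y"
proof -
  have c: "conj_by g y \<in> carrier G" "conj_by h y \<in> carrier G" using g h y by auto
  have "inv (conj_by h y) \<otimes> conj_by g y = \<one>"
  proof (rule Inter)
    fix k
    obtain u where u: "act g u k" "act h u k" using act by blast
    obtain w where w: "w \<in> P k" "conj_by g y = y [^] u \<otimes> w" using u y by (auto simp: act_def)
    obtain w' where w': "w' \<in> P k" "conj_by h y = y [^] u \<otimes> w'" using u y by (auto simp: act_def)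
    have "w \<in> carrier G" "w' \<in> carrier G" using w w' subsetD[OF P_subset] by auto
    then have "inv (conj_by h y) \<otimes> conj_by g y = inv w' \<otimes> w"
      using w w' y by (simp add: inv_mult_group m_assoc mult_inv_mult_cancel)
    then show "inv (conj_by h y) \<otimes> conj_by g y \<in> (\<lambda>c. c [^] (p ^ k)) ` C"
      using w(1) w'(1) subgroup.m_closed[OF P_subgroup] subgroup.m_inv_closed[OF P_subgroup]
      unfolding P_def[symmetric] by metis
  qed
  then show ?thesis using c by (simp add: inv_mult_eq_one_iff)
qed

lemma act_trivial_imp_in_C:
  assumes g: "g \<in> carrier G" and act: "\<And>k. act g 1 k"
  shows "g \<in> C"
proof -
  have "g \<otimes> y = y \<otimes> g" if y: "y \<in> C" for y
  proof -
    have "conj_by g y = conj_by \<one> y"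
      by (rule same_act_imp_eq[OF g one_closed _ y]) (use act act_one in blast)
    then show ?thesis using g y by (simp add: conj_by_eq_iff)
  qed
  then have "g \<in> centralizer C" using g by (simp add: centralizer_def)
  then show ?thesis using C(4) by simp
qed

text \<open>Multiplication of residues is commutative, so \<open>g \<otimes> h\<close> and
  \<open>h \<otimes> g\<close> act alike on \<open>C\<close>. Their quotient, the commutator,
  therefore centralises \<open>C\<close>, which is its own centraliser.\<close>

lemma derived_subset_C: "derived G (carrier G) \<subseteq> C"
  unfolding derived_def
proof (rule generate_subgroup_incl[OF _ C(1)])
  show "derived_set G (carrier G) \<subseteq> C"
  proof
    fix z assume "z \<in> derived_set G (carrier G)"
    then obtain g h where gh: "g \<in> carrier G" "h \<in> carrier G" "z = g \<otimes> h \<otimes> inv g \<otimes> inv h" by blast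
    have same: "conj_by (g \<otimes> h) y = conj_by (h \<otimes> g) y" if y: "y \<in> C" for y
    proof (rule same_act_imp_eq[OF _ _ _ y])
      fix k
      obtain u where u: "act g u k" using act_exists[OF gh(1)] by blast
      obtain v where v: "act h v k" using act_exists[OF gh(2)] by blast
      show "\<exists>u. act (g \<otimes> h) u k \<and> act (h \<otimes> g) u k"
        using act_mult[OF gh(1,2) u v] act_mult[OF gh(2,1) v u] by (auto simp: mult.commute)
    qed (use gh in auto)
    have z: "z = (g \<otimes> h) \<otimes> inv (h \<otimes> g)" using gh by (simp add: inv_mult_group m_assoc)
    have "z \<otimes> y = y \<otimes> z" if y: "y \<in> C" for y
    proof -
      let ?y = "conj_by (inv (h \<otimes> g)) y"
      have "?y \<in> C" using normal gh y by simp
      have "conj_by z y = conj_by (g \<otimes> h) ?y" using gh y unfolding z by (simp add: conj_by_comp)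
      also have "\<dots> = conj_by (h \<otimes> g) ?y" using same[OF \<open>?y \<in> C\<close>] .
      also have "\<dots> = y" using gh y by (simp add: conj_by_comp)
      finally show ?thesis using gh y by (simp add: conj_by_eq_iff)
    qed
    then have "z \<in> centralizer C" using gh by (simp add: centralizer_def)
    then show "z \<in> C" using C(4) by simp
  qed
qed

lemma second_derived_trivial: "(derived G ^^ 2) (carrier G) = {\<one>}"
proof -
  have "derived G (derived G (carrier G)) \<subseteq> derived G C" by (rule mono_derived[OF derived_subset_C])
  also have "derived G C = {\<one>}" by (rule commuting_imp_derived_trivial[OF C(3)])
  finally have "derived G (derived G (carrier G)) \<subseteq> {\<one>}" .
  moreover have "\<one> \<in> derived G (derived G (carrier G))"
    unfolding derived_def by (rule generate.one)
  ultimately show ?thesis by (auto simp: numeral_2_eq_2)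
qed

section \<open>Congruence kernels of the action, and compactness\<close>

definition ker :: "nat \<Rightarrow> 'a set"
  where "ker k = {g \<in> carrier G. act g 1 k}"

text \<open>Testing the generator \<open>x\<close> alone turns membership into one closed condition
  on \<open>g\<close>.\<close>

lemma ker_closed: "closedin T (ker k)"
proof -
  have "closedin T {g \<in> carrier G. inv x \<otimes> conj_by g x \<in> P k}"
    unfolding conj_by_def by (rule closed_vimage[OF P_closed]) (intro cont_intros, use x in auto)
  moreover have "ker k = {g \<in> carrier G. inv x \<otimes> conj_by g x \<in> P k}"
  proof (intro subset_antisym subsetI)
    fix g assume "g \<in> ker k"
    then have g: "g \<in> carrier G" "act g 1 k" by (auto simp: ker_def)
    then obtain w where w: "w \<in> P k" "conj_by g x = x [^] (1::int) \<otimes> w" using x by (auto simp: act_def)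
    then have "inv x \<otimes> conj_by g x = w" using x subsetD[OF P_subset w(1)] by (simp add: mult_inv_mult_cancel)
    then show "g \<in> {g \<in> carrier G. inv x \<otimes> conj_by g x \<in> P k}" using g w by simp
  next
    fix g assume g: "g \<in> {g \<in> carrier G. inv x \<otimes> conj_by g x \<in> P k}"
    then have "conj_by g x = x [^] (1::int) \<otimes> (inv x \<otimes> conj_by g x)" using x by (simp add: mult_inv_mult_cancel)
    then have "act g 1 k" using g by (intro actI[of g "inv x \<otimes> conj_by g x"]) auto
    then show "g \<in> ker k" using g by (simp add: ker_def)
  qed
  ultimately show ?thesis by simp
qed

lemma ker_antimono: "k \<le> l \<Longrightarrow> ker l \<subseteq> ker k"
  by (auto simp: ker_def intro: act_mono)

lemma ker_Inter: "g \<in> carrier G \<Longrightarrow> (\<And>k. g \<in> ker k) \<Longrightarrow> g \<in> C"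
  by (rule act_trivial_imp_in_C) (auto simp: ker_def)

text \<open>There are at most \<open>p ^ k\<close> residues. If \<open>e\<close> and
  \<open>g\<close> have the same residue, the residue of \<open>inv e\<close> is inverse to it, so
  \<open>inv e \<otimes> g\<close> has residue 1.\<close>

lemma ker_finite_index:
  "\<exists>E. finite E \<and> E \<subseteq> carrier G \<and> (\<forall>g\<in>carrier G. \<exists>e\<in>E. inv e \<otimes> g \<in> ker k)"
proof -
  define f where "f = (\<lambda>g. SOME i::nat. i < p ^ k \<and> act g (int i) k)"
  have f: "f g < p ^ k" "act g (int (f g)) k" if "g \<in> carrier G" for g
    using someI_ex[OF act_exists[OF that, of k]] unfolding f_def by auto
  have "f ` carrier G \<subseteq> {..<p ^ k}" using f by auto
  then have fin: "finite (f ` carrier G)" using finite_subset by blast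
  have *: "inv e \<otimes> g \<in> ker k" if eg: "e \<in> carrier G" "g \<in> carrier G" "f e = f g" for e g
  proof -
    obtain v where v: "act (inv e) v k" using act_exists[of "inv e"] eg by blast
    have "act (inv e \<otimes> e) (v * int (f g)) k" using act_mult[OF _ eg(1) v] f(2)[OF eg(1)] eg by simp
    then have "int (p ^ k) dvd v * int (f g) - 1" using act_unique[OF one_closed _ act_one] eg by simp
    moreover have "act (inv e \<otimes> g) (v * int (f g)) k" using act_mult[OF _ eg(2) v] f(2)[OF eg(2)] eg by simp
    ultimately have "act (inv e \<otimes> g) 1 k" using act_cong eg by blast
    then show ?thesis using eg by (simp add: ker_def)
  qed
  obtain E where E: "finite E" "E \<subseteq> carrier G" "\<And>g. g \<in> carrier G \<Longrightarrow> \<exists>e\<in>E. f e = f g"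
    using finite_image_representatives[OF fin] by blast
  have "\<exists>e\<in>E. inv e \<otimes> g \<in> ker k" if g: "g \<in> carrier G" for g
    using E(3)[OF g] E(2) * g by blast
  then show ?thesis using E(1,2) by blast
qed

text \<open>The powers of \<open>h\<close> are dense in the units congruent to \<open>1\<close> modulo \<open>p ^ j\<close>, because
  \<open>h\<close> to the power \<open>p ^ (M - j)\<close> generates those congruent to \<open>1\<close> modulo \<open>p ^ M\<close> up to \<open>p ^ (M + 1)\<close>.\<close>

lemma ker_approx_step:
  assumes h: "h \<in> ker j" "h \<notin> ker (Suc j)" and j: "j \<ge> 2" and M: "j \<le> M" and z: "z \<in> ker M"
  shows "\<exists>i::nat. z \<otimes> h [^] i \<in> ker (Suc M)"
proof -
  have hc: "h \<in> carrier G" "act h 1 j" and zc: "z \<in> carrier G" "act z 1 M" using h z by (auto simp: ker_def)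
  obtain u where u: "act z u (Suc M)" using act_exists[OF zc(1)] by blast
  have "act z u M" by (rule act_mono[OF u]) simp
  then obtain a where "u - 1 = int (p ^ M) * a" using act_unique[OF zc(1) _ zc(2)] by blast
  then have a: "u = 1 + int p ^ M * a" by simp
  obtain v where v: "act h v (Suc M)" using act_exists[OF hc(1)] by blast
  have "act h v j" by (rule act_mono[OF v]) (use M in simp)
  then obtain t where "v - 1 = int (p ^ j) * t" using act_unique[OF hc(1) _ hc(2)] by blast
  then have t: "v = 1 + int p ^ j * t" by simp
  \<comment> \<open>As \<open>h\<close> is not in \<open>ker (Suc j)\<close>, its unit departs from
    1 exactly at level \<open>j\<close>.\<close>
  have pt: "\<not> int p dvd t"
  proof
    assume "int p dvd t"
    then have "int (p ^ Suc j) dvd v - 1" unfolding t by (auto simp: mult.commute mult.left_commute)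
    moreover have "act h v (Suc j)" by (rule act_mono[OF v]) (use M in simp)
    ultimately have "act h 1 (Suc j)" using act_cong[OF hc(1)] by blast
    then show False using h(2) hc(1) by (simp add: ker_def)
  qed
  obtain b where b: "\<not> int p dvd b" "v ^ (p ^ (M - j)) = 1 + int p ^ M * b"
    using one_plus_prime_power[OF p j pt, of "M - j"] M unfolding t by auto
  \<comment> \<open>The unit of \<open>z \<otimes> w\<close> will be
    \<open>1 + p ^ M * (a + i * b)\<close> modulo \<open>p ^ Suc M\<close>, and this
    \<open>i\<close> makes the bracket divisible by \<open>p\<close>.\<close>
  obtain i where i: "int p dvd a + int i * b" using prime_solve_linear[OF p b(1)] by blast
  define w where "w = (h [^] (p ^ (M - j))) [^] i"
  have w: "act w ((1 + int p ^ M * b) ^ i) (Suc M)"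
    unfolding w_def b(2)[symmetric] using hc by (intro act_pow v) auto
  have wc: "w \<in> carrier G" using hc by (simp add: w_def)
  have zw: "act (z \<otimes> w) (u * (1 + int p ^ M * b) ^ i) (Suc M)" by (rule act_mult[OF zc(1) wc u w])
  obtain c where c: "(1 + int p ^ M * b) ^ i - (1 + int i * (int p ^ M * b)) = (int p ^ M * b)\<^sup>2 * c"
    using one_plus_power_approx[of "int p ^ M * b" i] by blast
  obtain d where d: "a + int i * b = int p * d" using i by blast
  \<comment> \<open>The coefficient of all terms that carry the square of \<open>p ^ M\<close>; they
    vanish modulo \<open>p ^ Suc M\<close> because \<open>M\<close> is positive.\<close>
  define e where "e = (1 + int p ^ M * a) * b\<^sup>2 * c + a * int i * b"
  have "(1 + int p ^ M * b) ^ i = 1 + int i * (int p ^ M * b) + (int p ^ M * b)\<^sup>2 * c" using c by simp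
  then have "u * (1 + int p ^ M * b) ^ i - 1 = int p ^ M * (a + int i * b) + int p ^ M * int p ^ M * e"
    unfolding a e_def by (simp add: algebra_simps power2_eq_square)
  also have "\<dots> = int p ^ Suc M * d + int p ^ M * int p ^ M * e" unfolding d by (simp add: mult.commute mult.left_commute)
  also have "int p ^ M * int p ^ M = int p ^ Suc M * int p ^ (M - 1)"
    using j M by (simp flip: power_add power_Suc)
  finally have "u * (1 + int p ^ M * b) ^ i - 1 = int (p ^ Suc M) * (d + int p ^ (M - 1) * e)"
    by (simp add: algebra_simps)
  then have "int (p ^ Suc M) dvd u * (1 + int p ^ M * b) ^ i - 1" by (metis dvd_triv_left)
  then have "act (z \<otimes> w) 1 (Suc M)" using act_cong[OF _ zw] zc(1) wc by simp
  then have "z \<otimes> h [^] (p ^ (M - j) * i) \<in> ker (Suc M)"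
    using zc wc hc unfolding w_def by (simp add: ker_def nat_pow_pow)
  then show ?thesis by blast
qed

lemma ker_approx:
  assumes h: "h \<in> ker j" "h \<notin> ker (Suc j)" and j: "j \<ge> 2" and y: "y \<in> ker j"
  shows "\<exists>i::nat. y \<otimes> h [^] i \<in> ker (j + n)"
proof (induction n)
  case 0
  then show ?case using y by (intro exI[of _ 0]) (auto simp: ker_def)
next
  case (Suc n)
  then obtain i :: nat where i: "y \<otimes> h [^] i \<in> ker (j + n)" by blast
  obtain i' :: nat where i': "(y \<otimes> h [^] i) \<otimes> h [^] i' \<in> ker (Suc (j + n))"
    using ker_approx_step[OF h j _ i] by auto
  have "y \<in> carrier G" "h \<in> carrier G" using y h by (auto simp: ker_def)
  then have "(y \<otimes> h [^] i) \<otimes> h [^] i' = y \<otimes> h [^] (i + i')" by (simp add: m_assoc nat_pow_mult)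
  then show ?case using i' by (intro exI[of _ "i + i'"]) simp
qed

text \<open>By \<open>ker_approx\<close>, \<open>y\<close> times some power of \<open>h\<close> lies
  in any given \<open>ker (j + n)\<close>. Compactness of \<open>B\<close> replaces these powers by
  one \<open>m\<close> in \<open>B\<close> that works at all levels, and
  \<open>y \<otimes> m\<close> then lies in every \<open>ker k\<close>, hence in
  \<open>C\<close>.\<close>

lemma ker_subset_product:
  assumes h: "h \<in> ker j" "h \<notin> ker (Suc j)" and j: "j \<ge> 2"
    and B: "subgroup B G" "compactin T B" "h \<in> B" and y: "y \<in> ker j"
  shows "\<exists>c\<in>C. \<exists>b\<in>B. y = c \<otimes> b"
proof -
  have yc: "y \<in> carrier G" using y by (simp add: ker_def)
  have BG: "\<And>b. b \<in> B \<Longrightarrow> b \<in> carrier G" using subgroup.mem_carrier[OF B(1)] .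
  define F where "F = (\<lambda>n. {m \<in> B. y \<otimes> m \<in> ker (j + n)})"
  have "(\<Inter>n. F n) \<noteq> {}"
  proof (rule compact_space_imp_nest)
    show "compact_space (subtopology T B)" by (rule compact_space_subtopology[OF B(2)])
    show "closedin (subtopology T B) (F n)" for n
    proof -
      have "closedin T {m \<in> carrier G. y \<otimes> m \<in> ker (j + n)}"
        by (rule closed_vimage[OF ker_closed]) (intro cont_intros yc)
      moreover have "F n = {m \<in> carrier G. y \<otimes> m \<in> ker (j + n)} \<inter> B" using BG by (auto simp: F_def)
      ultimately show ?thesis by (auto simp: closedin_subtopology)
    qed
    show "F n \<noteq> {}" for n
    proof -
      obtain i :: nat where "y \<otimes> h [^] i \<in> ker (j + n)" using ker_approx[OF h j y] by blast
      then have "h [^] i \<in> F n" using subgroup_nat_pow_closed[OF B(1,3)] by (simp add: F_def)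
      then show ?thesis by blast
    qed
    show "decseq F"
      unfolding decseq_def
    proof (intro allI impI)
      fix m n :: nat assume "m \<le> n"
      then have "ker (j + n) \<subseteq> ker (j + m)" by (intro ker_antimono) simp
      then show "F n \<subseteq> F m" by (auto simp: F_def)
    qed
  qed
  then obtain m where m: "\<And>n. m \<in> F n" by blast
  have mB: "m \<in> B" "m \<in> carrier G" using m[of 0] BG by (auto simp: F_def)
  have "y \<otimes> m \<in> ker k" for k using m[of k] ker_antimono[of k "j + k"] by (auto simp: F_def)
  then have "y \<otimes> m \<in> C" using ker_Inter yc mB by simp
  moreover have "y = (y \<otimes> m) \<otimes> inv m" using yc mB by (simp add: m_assoc)
  moreover have "inv m \<in> B" using mB subgroup.m_closed[OF B(1)] subgroup.m_inv_closed[OF B(1)] by blast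
  ultimately show ?thesis by blast
qed

lemma compact_of_ker_subset:
  assumes K: "compactin T K" and sub: "ker k \<subseteq> K"
  shows "compact_space T"
proof -
  obtain E where E: "finite E" "E \<subseteq> carrier G" "\<forall>g\<in>carrier G. \<exists>e\<in>E. inv e \<otimes> g \<in> ker k"
    using ker_finite_index[of k] by blast
  show ?thesis by (rule compact_of_translates[OF K E(1,2)]) (use E(3) sub in blast)
qed

lemma compact: "compact_space T"
proof (cases "ker 2 \<subseteq> C")
  case True
  then show ?thesis using compact_of_ker_subset[OF C(2)] by blast
next
  case False
  \<comment> \<open>Level 2 is where \<open>ker_approx\<close> starts to apply. The exact level
    \<open>j\<close> of \<open>h\<close> is at least 2, and \<open>ker j\<close> is covered by the
    product of \<open>C\<close> with the compact abelian bicentraliser of \<open>h\<close>.\<close>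
  then obtain h where h: "h \<in> ker 2" "h \<notin> C" by blast
  have hc: "h \<in> carrier G" using h by (simp add: ker_def)
  have ex: "\<exists>k. h \<notin> ker k" using ker_Inter[OF hc] h(2) by blast
  define k where "k = (LEAST k. h \<notin> ker k)"
  have k: "h \<notin> ker k" unfolding k_def by (rule LeastI_ex[OF ex])
  have "k > 2" using k h(1) ker_antimono[of k 2] by (metis linorder_not_less subsetD)
  then obtain j where j: "k = Suc j" "j \<ge> 2" by (cases k) auto
  have hj: "h \<in> ker j" "h \<notin> ker (Suc j)"
    using not_less_Least[of j "\<lambda>k. h \<notin> ker k"] k j unfolding k_def by auto
  define B where "B = bicentralizer {h}"
  have "commuting {h}" using hc by (simp add: commuting_def)
  then have B: "subgroup B G" "compactin T B" "h \<in> B"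
    unfolding B_def using subset_bicentralizer[of "{h}"] hc
    by (auto intro: bicentralizer_subgroup commuting_subgroup_compact bicentralizer_closed commuting_bicentralizer)
  define K where "K = (\<lambda>(c, b). c \<otimes> b) ` (C \<times> B)"
  have "continuous_map (prod_topology T T) T (\<lambda>(c, b). c \<otimes> b)"
    using hgt by (simp add: hausdorff_group_topology_def)
  then have "compactin T K" unfolding K_def
    by (rule image_compactin[rotated]) (use C(2) B(2) in \<open>simp add: compactin_Times\<close>)
  moreover have "ker j \<subseteq> K"
  proof
    fix y assume "y \<in> ker j"
    from ker_subset_product[OF hj j(2) B this] show "y \<in> K" unfolding K_def by force
  qed
  ultimately show ?thesis by (rule compact_of_ker_subset)
qed

end

theorem (in hm_lc_group) compact_and_second_derived_trivial:
  assumes inf: "infinite (carrier G)" and solv: "solvable G"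
  shows "compact_space T \<and> (derived G ^^ 2) (carrier G) = {\<one>}"
proof -
  obtain S where S: "commuting S" "infinite S" using infinite_solvable_infinite_commuting[OF solv inf] by blast
  have "infinite (bicentralizer S)"
    using S subset_bicentralizer[of S] finite_subset unfolding commuting_def by blast
  then obtain x0 where x0: "inf_order x0"
    using infinite_commuting_subgroup_inf_order[OF bicentralizer_subgroup bicentralizer_closed commuting_bicentralizer[OF S(1)]]
    by blast
  define D where "D = (\<lambda>n. (derived G ^^ n) (carrier G))"
  have ex: "\<exists>n. D n = {\<one>}" using solv solvable_iff_trivial_derived_seq unfolding D_def by blast
  define n where "n = (LEAST n. D n = {\<one>})"
  have Dn: "D n = {\<one>}" unfolding n_def by (rule LeastI_ex[OF ex])
  have "n \<noteq> 0"
  proof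
    assume "n = 0"
    then have "carrier G = {\<one>}" using Dn by (simp add: D_def)
    then show False using inf by simp
  qed
  then obtain m where m: "n = Suc m" by (cases n) auto
  have "D m \<noteq> {\<one>}" using not_less_Least[of m "\<lambda>n. D n = {\<one>}"] m unfolding n_def by simp
  have Dsub: "subgroup (D m) G" unfolding D_def by (rule exp_of_derived_is_subgroup[OF subgroup_self])
  have Dconj: "conj_by g y \<in> D m" if "g \<in> carrier G" "y \<in> D m" for g y
    using exp_of_derived_conj that unfolding D_def by blast
  have Dcomm: "commuting (D m)"
    using derived_trivial_imp_commuting[OF subgroup.subset[OF Dsub]] Dn unfolding m D_def by simp
  have "infinite (D m)"
    using finite_invariant_subgroup_trivial[OF x0 Dsub] Dconj \<open>D m \<noteq> {\<one>}\<close> by blast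
  \<comment> \<open>The term \<open>D m\<close> need not be closed; its bicentraliser is, and it is
    still commuting and invariant under conjugation.\<close>
  define N where "N = bicentralizer (D m)"
  have DN: "D m \<subseteq> N" unfolding N_def by (rule subset_bicentralizer[OF subgroup.subset[OF Dsub]])
  have N: "subgroup N G" "closedin T N" "commuting N" "infinite N"
    unfolding N_def using bicentralizer_subgroup bicentralizer_closed commuting_bicentralizer[OF Dcomm]
      \<open>infinite (D m)\<close> DN[unfolded N_def] finite_subset by blast+
  have Nc: "N \<subseteq> carrier G" using subgroup.subset[OF N(1)] .
  have Nconj: "conj_by g y \<in> N" if g: "g \<in> carrier G" "y \<in> N" for g y
    unfolding N_def bicentralizer_def
  proof (rule centralizer_conj)
    show "centralizer (D m) \<subseteq> carrier G" by (auto simp: centralizer_def)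
    show "conj_by g s \<in> centralizer (D m)" if "g \<in> carrier G" "s \<in> centralizer (D m)" for g s
      using centralizer_conj[OF subgroup.subset[OF Dsub] Dconj that] .
  qed (use g in \<open>auto simp: N_def bicentralizer_def\<close>)
  obtain x1 where x1: "x1 \<in> N" "inf_order x1" using infinite_commuting_subgroup_inf_order[OF N] by blast
  \<comment> \<open>Passing to the centraliser makes the action faithful later: since
    \<open>N \<subseteq> C\<close>, the centraliser of \<open>C\<close> lies in that of
    \<open>N\<close>, which is \<open>C\<close>, so \<open>C\<close> is self-centralising once it is
    abelian.\<close>
  define C where "C = centralizer N"
  have C: "subgroup C G" "closedin T C" unfolding C_def by (rule centralizer_subgroup[OF Nc] centralizer_closed[OF Nc])+
  have NC: "N \<subseteq> C" unfolding C_def using N(3) by (auto simp: commuting_def centralizer_def)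
  have Cconj: "conj_by g y \<in> C" if "g \<in> carrier G" "y \<in> C" for g y
    using centralizer_conj[OF Nc Nconj] that unfolding C_def by blast
  have CG: "\<And>c. c \<in> C \<Longrightarrow> c \<in> carrier G" using subgroup.mem_carrier[OF C(1)] .
  \<comment> \<open>Adjoining one element of \<open>C\<close> to \<open>N\<close> keeps a commuting
    set that contains \<open>x1\<close>. Hence \<open>C\<close> is torsion-free, and each of its
    elements has a positive power in \<open>N\<close>, which is central in \<open>C\<close>.\<close>
  have ins: "commuting (insert y N)" if y: "y \<in> C" for y
    using y N(3) CG[OF y] unfolding C_def by (auto simp: commuting_def centralizer_def)
  have Ccomm: "commuting C"
  proof (rule torsion_free_mod_center_commuting[OF C(1)])
    fix y and k :: nat assume y: "y \<in> C" and k: "k > 0" "y [^] k = \<one>"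
    show "y = \<one>"
    proof (rule ccontr)
      assume "y \<noteq> \<one>"
      then have "inf_order y" using commuting_inf_order[OF ins[OF y], of x1 y] x1 by blast
      then show False using k by (simp add: inf_order_def)
    qed
  next
    fix y assume y: "y \<in> C"
    obtain k :: nat where k: "k > 0" "y [^] k \<in> N"
      using commuting_power_in[OF ins[OF y] _ x1(2) _ N(1,2) x1(1)] x1(1) by blast
    have "\<forall>z\<in>C. y [^] k \<otimes> z = z \<otimes> y [^] k" using k(2) unfolding C_def by (simp add: centralizer_def)
    then show "\<exists>n>0. \<forall>z\<in>C. y [^] (n::nat) \<otimes> z = z \<otimes> y [^] n" using k(1) by blast
  next
    have "(derived G ^^ n) C \<subseteq> {\<one>}"
      using mono_exp_of_derived[OF subgroup.subset[OF C(1)], of n] Dn unfolding D_def by simp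
    then show "(derived G ^^ n) C = {\<one>}"
      using subgroup.one_closed[OF exp_of_derived_is_subgroup[OF C(1)]] by blast
  qed
  interpret A: hm_lca_group "G\<lparr>carrier := C\<rparr>" "subtopology T C" by (rule commuting_subgroup_lca[OF C Ccomm])
  have "A.inf_order x1" using inf_order_subgroup_iff[OF C(1)] x1 NC by blast
  then obtain p x where px: "A.padic_generator p x" using A.exists_padic_generator by blast
  have p: "prime p" and x: "A.inf_order x" "x \<in> C" and gen: "A.cyclic_closure x = C"
    using px inf_order_subgroup_iff[OF C(1)] unfolding A.padic_generator_def by auto
  have pow: "A.powers k = (\<lambda>c. c [^] k) ` C" for k :: nat
    unfolding A.powers_def by (simp flip: nat_pow_consistent)
  interpret padic_normal_subgroup G T C p x
  proof (rule padic_normal_subgroup.intro[OF hm_lc_group_axioms], rule padic_normal_subgroup_axioms.intro)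
    show "subgroup C G" "commuting C" by fact+
    show "compactin T C" by (rule commuting_subgroup_compact[OF C Ccomm])
    show "centralizer C = C"
    proof
      show "centralizer C \<subseteq> C" using centralizer_antimono[OF NC] unfolding C_def .
      show "C \<subseteq> centralizer C" using Ccomm by (auto simp: commuting_def centralizer_def)
    qed
    show "conj_by g c \<in> C" if "g \<in> carrier G" "c \<in> C" for g c using Cconj that .
    show "prime p" "x \<in> C" by fact+
    show "\<exists>i::nat. i < p ^ k \<and> (\<exists>z\<in>C. y = x [^] i \<otimes> z [^] (p ^ k))" if y: "y \<in> C" for k y
    proof -
      have "p ^ k > 0" using prime_gt_0_nat[OF p] by simp
      moreover have "x [^]\<^bsub>G\<lparr>carrier := C\<rparr>\<^esub> (p ^ k) \<in> A.powers (p ^ k)" using x(2) by (auto simp: A.powers_def)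
      ultimately have "\<exists>i<p ^ k. \<exists>l\<in>A.powers (p ^ k). y = x [^]\<^bsub>G\<lparr>carrier := C\<rparr>\<^esub> i \<otimes>\<^bsub>G\<lparr>carrier := C\<rparr>\<^esub> l"
        using A.cyclic_closure_cosets[OF _ A.powers_subgroup A.powers_closed[OF A.compact], of x "p ^ k" "p ^ k" y] x(2) gen y
        by simp
      then obtain i l where "i < p ^ k" "l \<in> A.powers (p ^ k)" "y = x [^] i \<otimes> l"
        by (auto simp flip: nat_pow_consistent)
      moreover from this obtain z where "z \<in> C" "l = z [^] (p ^ k)" unfolding pow by blast
      ultimately show ?thesis by blast
    qed
    show "p ^ k dvd m" if "z \<in> C" "x [^] m = z [^] (p ^ k)" for m k z
      by (rule A.padic_pow_in_powers[OF px]) (use that in \<open>auto simp: pow simp flip: nat_pow_consistent\<close>)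
    show "y = \<one>" if y: "\<And>k. y \<in> (\<lambda>c. c [^] (p ^ k)) ` C" for y
    proof (rule ccontr)
      assume "y \<noteq> \<one>"
      have "y \<in> C" using y[of 0] CG by auto
      then have "y \<in> carrier (G\<lparr>carrier := C\<rparr>)" "y \<noteq> \<one>\<^bsub>G\<lparr>carrier := C\<rparr>\<^esub>"
        using \<open>y \<noteq> \<one>\<close> by simp_all
      then obtain U where U: "openin (subtopology T C) U" "\<one>\<^bsub>G\<lparr>carrier := C\<rparr>\<^esub> \<in> U" "y \<notin> U"
        by (rule A.separate_nbhd)
      obtain k where "A.powers (p ^ k) \<subseteq> U"
        using px U(1,2) unfolding A.padic_generator_def by blast
      then show False using y[of k] U(3) unfolding pow by blast
    qed
  qed
  show ?thesis using compact second_derived_trivial by blast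
qed

theorem corollary1p12:
  fixes G :: "('a, 'b) monoid_scheme" and T :: "'a topology"
  assumes "hausdorff_topological_group G T"
    and "infinite (carrier G)"
    and "hereditarily_minimal G T"
    and "locally_compact_space T"
    and "solvable G"
  shows "compact_space T \<and> metabelian G"
proof -
  interpret group G using assms(1) by (simp add: hausdorff_topological_group_def)
  interpret hm_lc_group G T
    by unfold_locales (use assms in \<open>auto simp: hausdorff_topological_group_def\<close>)
  have *: "compact_space T" "(derived G ^^ 2) (carrier G) = {\<one>\<^bsub>G\<^esub>}"
    using compact_and_second_derived_trivial[OF assms(2,5)] by auto
  have "solvability_class G \<le> 2"
    unfolding solvability_class_def by (rule Least_le) (rule *(2))
  then show ?thesis using *(1) assms(5) is_group by (simp add: metabelian_def)
qed

end
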